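(* Let $X$ be a Hausdorff sequentially complete locally convex space over $\mathbb{C}$ and $C\in L(X)$. Suppose that $\alpha\in(0,2]$, $\beta\geq 0$, and a closed MLO $\mathcal{A}$ in $X$ is a subgenerator of an exponentially equicontinuous $(g_{\alpha},g_{\beta+1})$-regularized $C$-resolvent family $(S(t))_{t\geq 0}$ such that the operator family $\{t^{-\beta}S(t):t>0\}\subseteq L(X)$ is equicontinuous. Then, for every number $\gamma>\beta+(1/2)$, the operator $\mathcal{A}^{-1}$ is a subgenerator of a $(g_{\alpha},g_{\gamma+1})$-regularized $C$-resolvent family $(R(t))_{t\geq 0}$ such that the operator family $\{t^{-\gamma}R(t):t>0\}\subseteq L(X)$ is equicontinuous.
   Context: MLOs: a map $\mathcal{A}:X\to P(X)$ is a multivalued linear operator (MLO) in $X$ if $D(\mathcal{A}):=\{x:\mathcal{A}x\neq\emptyset\}$ is a linear subspace, $\mathcal{A}x+\mathcal{A}y\subseteq\mathcal{A}(x+y)$ and $\lambda\mathcal{A}x\subseteq\mathcal{A}(\lambda x)$ for $x,y\in D(\mathcal{A})$, $\lambda\in\mathbb{C}$; it is identified with its graph in $X\times X$ (a linear subspace), is closed if the graph is closed, and inclusions are inclusions of graphs. $\mathcal{A}^{-1}=\{(y,x):(x,y)\in\mathcal{A}\}$. $g_{\zeta}(t):=t^{\zeta-1}/\Gamma(\zeta)$ for $\zeta>0$, $t>0$ (extended continuously to $t=0$ when $\zeta\ge 1$). Families: let $k\in C([0,\infty))$, $k\neq 0$, $a\in L^{1}_{loc}([0,\infty))$, $a\neq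 0$. For an MLO $\mathcal{M}$ in $X$ and $C\in L(X)$ (not necessarily injective) with $C\mathcal{M}\subseteq\mathcal{M}C$, a strongly continuous family $(R(t))_{t\geq 0}\subseteq L(X)$ is an $(a,k)$-regularized $C$-resolvent family with a subgenerator $\mathcal{M}$ if: $\int_{0}^{t}a(t-s)R(s)y\,ds=R(t)x-k(t)Cx$ for all $t\geq 0$ and $(x,y)\in\mathcal{M}$; $R(t)C=CR(t)$; and $R(t)\mathcal{M}\subseteq\mathcal{M}R(t)$ for all $t\geq 0$. (The requirement $C\mathcal{M}\subseteq\mathcal{M}C$ is part of the notion.) It is exponentially equicontinuous if $\{e^{-\omega t}R(t):t\geq 0\}$ is equicontinuous for some $\omega\in\mathbb{R}$. *)

theory Defs
  imports "HOL-Analysis.Analysis"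
begin

section \<open>Sequentially complete locally convex spaces over the complex numbers\<close>

text \<open>
  A complex vector space carries its underlying real structure, so that the library's notions for
  real vector spaces (convexity, integrals of simple functions) apply to it.
\<close>

class complex_vector = real_vector +
  fixes scaleC :: "complex \<Rightarrow> 'a \<Rightarrow> 'a"  (infixr \<open>*\<^sub>C\<close> 75)
  assumes scaleC_add_right: "c *\<^sub>C (x + y) = c *\<^sub>C x + c *\<^sub>C y"
    and scaleC_add_left: "(c + d) *\<^sub>C x = c *\<^sub>C x + d *\<^sub>C x"
    and scaleC_scaleC: "c *\<^sub>C (d *\<^sub>C x) = (c * d) *\<^sub>C x"
    and scaleC_one: "1 *\<^sub>C x = x"
    and scaleR_scaleC: "r *\<^sub>R x = complex_of_real r *\<^sub>C x"

global_interpretation complex_vector: vector_space "scaleC :: complex \<Rightarrow> 'a \<Rightarrow> 'a::complex_vector"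
  by unfold_locales (simp_all add: scaleC_add_right scaleC_add_left scaleC_scaleC scaleC_one)

text \<open>
  In a \<^class>\<open>uniform_topological_group_add\<close> the uniformity is determined by the topology, its
  entourages being generated by the sets of pairs whose difference lies in a neighbourhood of
  \<open>0\<close>. The uniform structure is therefore no additional datum; it provides \<^const>\<open>Cauchy\<close>.
\<close>

class complex_locally_convex_space =
  complex_vector + topological_ab_group_add + uniform_topological_group_add +
  assumes tendsto_scaleC_Pair: "LIM p (nhds c \<times>\<^sub>F nhds x). fst p *\<^sub>C snd p :> nhds (c *\<^sub>C x)"
    and convex_nhds_0_aux: "open U \<Longrightarrow> 0 \<in> U \<Longrightarrow>
      \<exists>V. open V \<and> 0 \<in> V \<and> V \<subseteq> U \<and>
        (\<forall>x\<in>V. \<forall>y\<in>V. \<forall>u\<ge>0. \<forall>v\<ge>0. u + v = 1 \<longrightarrow> u *\<^sub>R x + v *\<^sub>R y \<in> V)"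

text \<open>The class axiom spells out \<^const>\<open>convex\<close>, which is not available inside class specifications.\<close>

lemma convex_nhds_0:
  fixes U :: "'x::complex_locally_convex_space set"
  assumes "open U" "0 \<in> U"
  shows "\<exists>V. open V \<and> convex V \<and> 0 \<in> V \<and> V \<subseteq> U"
  using convex_nhds_0_aux[OF assms] unfolding convex_def by blast

class seq_complete_complex_lcs = complex_locally_convex_space + t2_space +
  assumes Cauchy_imp_convergent: "Cauchy X \<Longrightarrow> convergent X"

definition continuous_seminorm :: "('x::complex_locally_convex_space \<Rightarrow> real) \<Rightarrow> bool" where
  "continuous_seminorm p \<longleftrightarrow>
     (\<forall>x y. p (x + y) \<le> p x + p y) \<and> (\<forall>c x. p (c *\<^sub>C x) = cmod c * p x) \<and> continuous_on UNIV p"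

definition continuous_linear_operators :: "('x::complex_locally_convex_space \<Rightarrow> 'x) set" where
  "continuous_linear_operators = {T. Vector_Spaces.linear scaleC scaleC T \<and> continuous_on UNIV T}"

text \<open>Meant for families of linear operators, for which neighbourhoods of \<open>0\<close> suffice.\<close>

definition equicontinuous :: "('x::complex_locally_convex_space \<Rightarrow> 'x) set \<Rightarrow> bool" where
  "equicontinuous F \<longleftrightarrow>
     (\<forall>U. open U \<and> 0 \<in> U \<longrightarrow> (\<exists>V. open V \<and> 0 \<in> V \<and> (\<forall>T\<in>F. T ` V \<subseteq> U)))"


section \<open>Integration of vector-valued functions\<close>

text \<open>
  The usual integral in sequentially complete locally convex spaces: \<open>f\<close> is the almost everywhere
  limit of simple functions that are Cauchy in mean with respect to every continuous seminorm, and
  \<open>I\<close> is the limit of their integrals.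
\<close>

definition has_lc_integral ::
    "'s measure \<Rightarrow> ('s \<Rightarrow> 'x::complex_locally_convex_space) \<Rightarrow> 'x \<Rightarrow> bool" where
  "has_lc_integral M f I \<longleftrightarrow>
     (\<exists>\<phi> :: nat \<Rightarrow> 's \<Rightarrow> 'x.
        (\<forall>n. Bochner_Integration.simple_bochner_integrable M (\<phi> n)) \<and>
        (AE s in M. (\<lambda>n. \<phi> n s) \<longlonglongrightarrow> f s) \<and>
        (\<forall>p. continuous_seminorm p \<longrightarrow>
           (\<forall>\<epsilon>>0. \<exists>N. \<forall>m\<ge>N. \<forall>n\<ge>N. (\<integral>s. p (\<phi> m s - \<phi> n s) \<partial>M) \<le> \<epsilon>)) \<and>
        (\<lambda>n. Bochner_Integration.simple_bochner_integral M (\<phi> n)) \<longlonglongrightarrow> I)"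


section \<open>Multivalued linear operators\<close>

text \<open>Multivalued operators are identified with their graphs.\<close>

definition mlo :: "('x::complex_vector \<times> 'x) set \<Rightarrow> bool" where
  "mlo A \<longleftrightarrow>
     complex_vector.subspace (Domain A) \<and>
     (\<forall>x\<in>Domain A. \<forall>y\<in>Domain A. \<forall>u\<in>A``{x}. \<forall>v\<in>A``{y}. u + v \<in> A``{x + y}) \<and>
     (\<forall>c. \<forall>x\<in>Domain A. \<forall>u\<in>A``{x}. c *\<^sub>C u \<in> A``{c *\<^sub>C x})"

definition op_graph :: "('x \<Rightarrow> 'x) \<Rightarrow> ('x \<times> 'x) set" where
  "op_graph T = {(x, T x) | x. True}"

text \<open>
  The inclusion \<open>T M \<subseteq> M T\<close> of graphs. In the relational composition \<open>M O op_graph T\<close> the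
  operator \<open>M\<close> is applied first, so this is the graph of the product \<open>T M\<close>.
\<close>

definition op_commutes_with :: "('x \<Rightarrow> 'x) \<Rightarrow> ('x \<times> 'x) set \<Rightarrow> bool" where
  "op_commutes_with T M \<longleftrightarrow> M O op_graph T \<subseteq> op_graph T O M"


section \<open>Regularized resolvent families\<close>

text \<open>
  Since \<open>0 powr 0 = 0\<close> in the library, the value \<open>1\<close> at \<open>t = 0\<close> of the continuous extension for
  \<open>\<zeta> = 1\<close> has to be set explicitly. For \<open>\<zeta> > 1\<close> the value \<open>0\<close> at \<open>t = 0\<close> is the right one.
\<close>

definition g :: "real \<Rightarrow> real \<Rightarrow> complex" where
  "g \<zeta> t = (if t = 0 \<and> \<zeta> = 1 then 1 else complex_of_real (t powr (\<zeta> - 1) / Gamma \<zeta>))"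

definition regularized_resolvent_family ::
    "(real \<Rightarrow> complex) \<Rightarrow> (real \<Rightarrow> complex) \<Rightarrow> ('x::complex_locally_convex_space \<Rightarrow> 'x) \<Rightarrow>
     (real \<Rightarrow> 'x \<Rightarrow> 'x) \<Rightarrow> ('x \<times> 'x) set \<Rightarrow> bool" where
  "regularized_resolvent_family a k C R M \<longleftrightarrow>
     continuous_on {0..} k \<and> (\<exists>t\<ge>0. k t \<noteq> 0) \<and>
     (\<forall>t\<ge>0. a absolutely_integrable_on {0..t}) \<and> \<not> (AE t in lebesgue. 0 \<le> t \<longrightarrow> a t = 0) \<and>
     mlo M \<and> C \<in> continuous_linear_operators \<and> op_commutes_with C M \<and>
     (\<forall>t\<ge>0. R t \<in> continuous_linear_operators) \<and>
     (\<forall>x. continuous_on {0..} (\<lambda>t. R t x)) \<and>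
     (\<forall>t\<ge>0. \<forall>(x, y)\<in>M.
        has_lc_integral (lebesgue_on {0..t}) (\<lambda>s. a (t - s) *\<^sub>C R s y) (R t x - k t *\<^sub>C C x)) \<and>
     (\<forall>t\<ge>0. R t \<circ> C = C \<circ> R t) \<and>
     (\<forall>t\<ge>0. op_commutes_with (R t) M)"

definition exponentially_equicontinuous ::
    "(real \<Rightarrow> 'x::complex_locally_convex_space \<Rightarrow> 'x) \<Rightarrow> bool" where
  "exponentially_equicontinuous R \<longleftrightarrow>
     (\<exists>\<omega>::real. equicontinuous {\<lambda>x. exp (- \<omega> * t) *\<^sub>R R t x | t. t \<ge> 0})"

end

theory Submission
  imports Defs
begin

text \<open>
  Formally the Laplace transform of \<open>S\<close> is
  \<open>\<lambda> powr (\<alpha> - \<beta> - 1) (\<lambda> powr \<alpha> - \<A>)\<inverse> C\<close>, and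
  \<open>(\<lambda> powr \<alpha> - \<A>\<inverse>)\<inverse> C = \<lambda> powr (- \<alpha>) C - \<lambda> powr (- 2\<alpha>) (\<lambda> powr (- \<alpha>) - \<A>)\<inverse> C\<close>.
  Hence the transform of the desired family at \<open>\<lambda>\<close> involves that of \<open>S\<close> at \<open>1 / \<lambda>\<close>, which
  leads, with \<open>\<nu> = \<gamma> + \<beta> + 1\<close>, to
  \<open>R t x = t powr \<gamma> / \<Gamma>(\<gamma> + 1) C x - \<integral> (t/s) powr (\<nu>/2) J\<^sub>\<nu>(2 \<surd>(t s)) S s x ds\<close> over \<open>s > 0\<close>.
  As \<open>J\<^sub>\<nu>(z)\<close> decays like \<open>z powr (- 1/2)\<close> and \<open>S s\<close> grows like \<open>s powr \<beta>\<close>, the integral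
  converges absolutely because \<open>\<gamma> > \<beta> + 1/2\<close>, and scaling \<open>s\<close> by \<open>t\<close> shows that it is of
  order \<open>t powr \<gamma>\<close>. The resolvent equation is tested against continuous real-linear functionals,
  where it follows by comparing Laplace transforms. The remaining properties pass
  from \<open>S\<close> to \<open>R\<close> because \<open>R t\<close> is a pointwise limit of linear combinations of \<open>C\<close> and the \<open>S s\<close>.
\<close>

section \<open>Dominated linear functionals\<close>

text \<open>\<open>C\<close> need not be injective and \<open>\<A>\<close> is multivalued, so no
  resolvent of \<open>\<A>\<close> is ever formed; everything rests on the integral equation of
  \<open>S\<close>. For \<open>(y, x) \<in> \<A>\<close> and a continuous functional
  \<open>\<phi>\<close>, its Laplace transform is one scalar relation between
  \<open>\<phi> (S s x)\<close> and \<open>\<phi> (S s y)\<close>, and this relation is used at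
  \<open>1 / l\<close>. The transform of \<open>\<phi> (R t y)\<close> is
  \<open>l powr (- \<gamma> - 1) * \<phi> (C y)\<close> minus \<open>l powr (- \<nu> - 1)\<close>
  times that of \<open>\<phi> (S s y)\<close> at \<open>1 / l\<close>; the value of
  \<open>\<nu>\<close> is forced, as the terms with \<open>\<phi> (C y)\<close> have to cancel.
  Functionals compare vectors but do not produce them. Existence of the integrals therefore comes
  from quadrature sums and sequential completeness, with nodes and weights shared by all vectors.
  Estimates, on the other hand, lose nothing under functionals: below a seminorm \<open>p\<close>
  there is a linear functional that attains \<open>p\<close> at one prescribed vector, so each
  seminorm bound is a scalar bound. Real-linear functionals suffice because all kernels are
  real.\<close>

definition sublinear :: "('a::real_vector \<Rightarrow> real) \<Rightarrow> bool" where
  "sublinear q \<longleftrightarrow> (\<forall>x y. q (x + y) \<le> q x + q y) \<and> (\<forall>x. \<forall>r\<ge>0. q (r *\<^sub>R x) = r * q x)"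

lemma sublinear_add: "sublinear q \<Longrightarrow> q (x + y) \<le> q x + q y"
  and sublinear_scale: "sublinear q \<Longrightarrow> 0 \<le> r \<Longrightarrow> q (r *\<^sub>R x) = r * q x"
  by (simp_all add: sublinear_def)

lemma sublinear_zero: "sublinear q \<Longrightarrow> q 0 = 0"
  using sublinear_scale[of q 0 0] by simp

lemma sublinear_lower:
  assumes "sublinear q"
  shows "- q (- x) \<le> q x"
  using sublinear_add[OF assms, of x "- x"] sublinear_zero[OF assms] by simp

text \<open>The inequality for positive factors is enough: used for \<open>1 / r\<close> it yields
  its own converse.\<close>

lemma sublinearI:
  fixes q :: "'a::real_vector \<Rightarrow> real"
  assumes add: "\<And>x y. q (x + y) \<le> q x + q y" and zero: "q 0 = 0"
    and scale: "\<And>r x. 0 < r \<Longrightarrow> q (r *\<^sub>R x) \<le> r * q x"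
  shows "sublinear q"
  unfolding sublinear_def
proof (intro conjI allI impI)
  fix x and r :: real assume "0 \<le> r"
  show "q (r *\<^sub>R x) = r * q x"
  proof (cases "r = 0")
    case False
    with \<open>0 \<le> r\<close> have r: "0 < r" by simp
    have "q x \<le> q (r *\<^sub>R x) / r"
      using scale[of "1 / r" "r *\<^sub>R x"] r by simp
    then show ?thesis
      using scale[OF r, of x] r by (simp add: field_simps)
  qed (simp add: zero)
qed (rule add)

text \<open>Pushes the value at \<open>- z\<close> down to \<open>- q z\<close>, so a minimal sublinear functional is odd.\<close>

lemma sublinear_smaller:
  fixes q :: "'a::real_vector \<Rightarrow> real"
  assumes q: "sublinear q"
  obtains q' where "sublinear q'" "q' \<le> q" "q' (- z) \<le> - q z"
proof
  \<comment> \<open>All translates of \<open>x\<close> along the ray of \<open>z\<close> compete.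
    For \<open>x = - z\<close> the choice \<open>t = 1\<close> already gives \<open>- q z\<close>,
    and \<open>- q (- x)\<close> bounds the infimum from below.\<close>
  define F where "F x = (\<lambda>t. q (x + t *\<^sub>R z) - t * q z) ` {0..}" for x
  define q' where "q' x = Inf (F x)" for x
  have lower: "- q (- x) \<le> q (x + t *\<^sub>R z) - t * q z" if "t \<ge> 0" for x t
    using sublinear_add[OF q, of "- x" "x + t *\<^sub>R z"] sublinear_scale[OF q that, of z] by simp
  have bdd: "bdd_below (F x)" for x
    unfolding F_def by (rule bdd_belowI2[where m = "- q (- x)"]) (use lower in auto)
  have ne: "F x \<noteq> {}" for x
    by (auto simp: F_def)
  have q'_le: "q' x \<le> q (x + t *\<^sub>R z) - t * q z" if "t \<ge> 0" for x t
    unfolding q'_def using that by (intro cInf_lower bdd) (auto simp: F_def)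
  have q'_ge: "c \<le> q' x" if "\<And>t. t \<ge> 0 \<Longrightarrow> c \<le> q (x + t *\<^sub>R z) - t * q z" for x c
    unfolding q'_def using that by (intro cInf_greatest ne) (auto simp: F_def)
  show "q' \<le> q"
    using q'_le[of 0] by (simp add: le_fun_def)
  show "q' (- z) \<le> - q z"
    using q'_le[of 1 "- z"] sublinear_zero[OF q] by simp
  show "sublinear q'"
  proof (rule sublinearI)
    fix x y
    have "q' (x + y) - (q (x + s *\<^sub>R z) - s * q z) \<le> q' y" if "s \<ge> 0" for s
    proof (rule q'_ge)
      fix t :: real assume "t \<ge> 0"
      have "q' (x + y) \<le> q (x + y + (s + t) *\<^sub>R z) - (s + t) * q z"
        using that \<open>t \<ge> 0\<close> by (intro q'_le) simp
      moreover have "q (x + y + (s + t) *\<^sub>R z) \<le> q (x + s *\<^sub>R z) + q (y + t *\<^sub>R z)"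
        using sublinear_add[OF q, of "x + s *\<^sub>R z" "y + t *\<^sub>R z"]
        by (simp add: algebra_simps)
      ultimately show "q' (x + y) - (q (x + s *\<^sub>R z) - s * q z) \<le> q (y + t *\<^sub>R z) - t * q z"
        by (simp add: algebra_simps)
    qed
    then have "q' (x + y) - q' y \<le> q' x"
      by (intro q'_ge) (simp add: algebra_simps)
    then show "q' (x + y) \<le> q' x + q' y" by simp
    show "q' 0 = 0"
    proof (rule antisym)
      show "q' 0 \<le> 0" using q'_le[of 0 0] sublinear_zero[OF q] by simp
      show "0 \<le> q' 0" by (rule q'_ge) (simp add: sublinear_scale[OF q])
    qed
    fix r :: real and x assume r: "0 < r"
    have "q' (r *\<^sub>R x) / r \<le> q' x"
    proof (rule q'_ge)
      fix t :: real assume "t \<ge> 0"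
      have "q (r *\<^sub>R x + (r * t) *\<^sub>R z) = r * q (x + t *\<^sub>R z)"
        using sublinear_scale[OF q, of r "x + t *\<^sub>R z"] r by (simp add: scaleR_add_right)
      then show "q' (r *\<^sub>R x) / r \<le> q (x + t *\<^sub>R z) - t * q z"
        using q'_le[of "r * t" "r *\<^sub>R x"] r \<open>t \<ge> 0\<close> by (simp add: field_simps)
    qed
    then show "q' (r *\<^sub>R x) \<le> r * q' x" using r by (simp add: field_simps)
  qed
qed

text \<open>\<open>sublinear_smaller\<close> cannot lower a minimal \<open>q\<close>, which forces
  \<open>q (- x) \<le> - q x\<close>; an odd subadditive function is additive.\<close>

lemma minimal_sublinear_linear:
  fixes q :: "'a::real_vector \<Rightarrow> real"
  assumes q: "sublinear q" and min: "\<And>q'. sublinear q' \<Longrightarrow> q' \<le> q \<Longrightarrow> q' = q"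
  shows "linear q"
proof -
  have odd: "q (- x) = - q x" for x
  proof -
    obtain q' where "sublinear q'" "q' \<le> q" "q' (- x) \<le> - q x"
      using sublinear_smaller[OF q, of x] by blast
    then show ?thesis
      using min[of q'] sublinear_lower[OF q, of x] by auto
  qed
  have add: "q (x + y) = q x + q y" for x y
    using sublinear_add[OF q, of x y] sublinear_add[OF q, of "- x" "- y"] odd[of "x + y"]
      odd[of x] odd[of y] by simp
  have "q (r *\<^sub>R x) = r *\<^sub>R q x" for r x
  proof (cases "r \<ge> 0")
    case True then show ?thesis by (simp add: sublinear_scale[OF q])
  next
    case False
    then show ?thesis
      using sublinear_scale[OF q, of "- r" x] odd[of "r *\<^sub>R x"] by simp
  qed
  with add show ?thesis by (intro linearI) auto
qed

text \<open>Hahn-Banach with a prescribed value at one point in place of an extension from a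
  subspace. \<open>p\<close> is first lowered to \<open>p'\<close> with
  \<open>p' (- z) \<le> - p z\<close>; every linear functional below \<open>p'\<close> then takes
  the value \<open>p z\<close> at \<open>z\<close>, so Zorn's lemma only has to supply a minimal
  sublinear functional below \<open>p'\<close>.\<close>

theorem dominated_linear_functional:
  fixes p :: "'a::real_vector \<Rightarrow> real"
  assumes p: "sublinear p"
  obtains \<phi> where "linear \<phi>" "\<And>x. \<phi> x \<le> p x" "\<phi> z = p z"
proof -
  obtain p' where p': "sublinear p'" "p' \<le> p" "p' (- z) \<le> - p z"
    using sublinear_smaller[OF p, of z] by blast
  define A where "A = {q. sublinear q \<and> q \<le> p'}"
  \<comment> \<open>Reversed order: \<open>predicate_Zorn\<close> yields a maximal element, and a
    minimal functional is wanted.\<close>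
  define G :: "('a \<Rightarrow> real) \<Rightarrow> ('a \<Rightarrow> real) \<Rightarrow> bool" where "G = (\<lambda>a b. b \<le> a)"
  have "\<exists>m\<in>A. \<forall>a\<in>A. G m a \<longrightarrow> a = m"
  proof (rule predicate_Zorn)
    show "partial_order_on A (relation_of G A)"
      by (rule partial_order_on_relation_ofI) (auto simp: G_def)
    fix Q assume "Q \<in> Chains (relation_of G A)"
    then have Q: "Q \<subseteq> A" and chain: "\<And>a b. a \<in> Q \<Longrightarrow> b \<in> Q \<Longrightarrow> a \<le> b \<or> b \<le> a"
      by (auto simp: Chains_def relation_of_def G_def)
    show "\<exists>u\<in>A. \<forall>a\<in>Q. G a u"
    proof (cases "Q = {}")
      case True
      then show ?thesis using p' by (auto simp: A_def)
    next
      case ne: False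
      define u where "u x = (INF q\<in>Q. q x)" for x
      have sub: "sublinear q" "q \<le> p'" if "q \<in> Q" for q
        using Q that by (auto simp: A_def)
      have bdd: "bdd_below ((\<lambda>q. q x) ` Q)" for x
      proof (rule bdd_belowI2[where m = "- p' (- x)"])
        fix q assume "q \<in> Q"
        then show "- p' (- x) \<le> q x"
          using sublinear_lower[OF sub(1), of q x] le_funD[OF sub(2), of q "- x"] by linarith
      qed
      have u_le: "u x \<le> q x" if "q \<in> Q" for q x
        unfolding u_def by (rule cINF_lower[OF bdd that])
      have u_ge: "c \<le> u x" if "\<And>q. q \<in> Q \<Longrightarrow> c \<le> q x" for c x
        unfolding u_def using that by (intro cINF_greatest ne)
      have "sublinear u"
      proof (rule sublinearI)
        fix x y
        have "u (x + y) - a x \<le> u y" if a: "a \<in> Q" for a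
        proof (rule u_ge)
          fix b assume "b \<in> Q"
          \<comment> \<open>The chain supplies one \<open>c\<close> below both \<open>a\<close> and
            \<open>b\<close>, and subadditivity of this \<open>c\<close> carries over to the
            pointwise infimum.\<close>
          obtain c where "c \<in> Q" "c \<le> a" "c \<le> b"
            using chain[OF a \<open>b \<in> Q\<close>] a \<open>b \<in> Q\<close> by blast
          then have "u (x + y) \<le> c x + c y"
            using u_le[of c "x + y"] sublinear_add[OF sub(1), of c x y] by simp
          also have "\<dots> \<le> a x + b y"
            using \<open>c \<le> a\<close> \<open>c \<le> b\<close> by (intro add_mono) (auto simp: le_fun_def)
          finally show "u (x + y) - a x \<le> b y" by simp
        qed
        then have "u (x + y) - u y \<le> u x"
          by (intro u_ge) (simp add: algebra_simps)
        then show "u (x + y) \<le> u x + u y" by simp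
        have "(\<lambda>q. q 0) ` Q = {0}"
          using ne sublinear_zero[OF sub(1)] by (force simp: image_iff)
        then show "u 0 = 0" by (simp add: u_def)
        fix r :: real and x assume r: "0 < r"
        have "u (r *\<^sub>R x) / r \<le> u x"
        proof (rule u_ge)
          fix q assume q: "q \<in> Q"
          show "u (r *\<^sub>R x) / r \<le> q x"
            using u_le[OF q, of "r *\<^sub>R x"] sublinear_scale[OF sub(1)[OF q], of r x] r by (simp add: field_simps)
        qed
        then show "u (r *\<^sub>R x) \<le> r * u x" using r by (simp add: field_simps)
      qed
      moreover have "u \<le> p'"
        using ne u_le sub(2) by (meson all_not_in_conv le_funI le_fun_def order_trans)
      ultimately show ?thesis
        using u_le by (intro bexI[of _ u]) (auto simp: A_def G_def le_fun_def)
    qed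
  qed
  then obtain m where m: "m \<in> A" and min: "\<And>a. a \<in> A \<Longrightarrow> a \<le> m \<Longrightarrow> a = m"
    by (auto simp: G_def)
  show thesis
  proof
    show lin: "linear m"
      using m by (intro minimal_sublinear_linear min) (auto simp: A_def)
    show le: "m x \<le> p x" for x
      using m p'(2) by (auto simp: A_def le_fun_def intro: order_trans)
    have "m (- z) \<le> - p z"
      using m p'(3) by (auto simp: A_def le_fun_def intro: order_trans)
    then show "m z = p z"
      using le[of z] linear_uminus[THEN linear_compose, OF lin] linear_neg[OF lin, of z] by simp
  qed
qed

section \<open>Seminorms and the topology\<close>

lemma scaleC_zero_left [simp]: "0 *\<^sub>C (x::'x::complex_vector) = 0"
  by (rule complex_vector.scale_zero_left)

lemma scaleC_zero_right [simp]: "c *\<^sub>C (0::'x::complex_vector) = 0"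
  by (rule complex_vector.scale_zero_right)

lemma scaleC_minus1: "(- 1) *\<^sub>C x = - (x::'x::complex_vector)"
  using complex_vector.scale_minus_left[of 1 x] by (simp add: scaleC_one)

lemma scaleR_scaleC_commute: "r *\<^sub>R c *\<^sub>C x = c *\<^sub>C r *\<^sub>R (x::'x::complex_vector)"
  by (simp add: scaleR_scaleC scaleC_scaleC mult.commute)

context
  fixes p :: "'x::complex_locally_convex_space \<Rightarrow> real"
  assumes p: "continuous_seminorm p"
begin

lemma seminorm_add: "p (x + y) \<le> p x + p y"
  and seminorm_scaleC: "p (c *\<^sub>C x) = cmod c * p x"
  and seminorm_continuous: "continuous_on UNIV p"
  using p by (auto simp: continuous_seminorm_def)

lemma seminorm_scaleR: "p (r *\<^sub>R x) = \<bar>r\<bar> * p x"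
  by (simp add: scaleR_scaleC seminorm_scaleC)

lemma seminorm_zero [simp]: "p 0 = 0"
  using seminorm_scaleR[of 0 0] by simp

lemma seminorm_minus [simp]: "p (- x) = p x"
  using seminorm_scaleR[of "- 1" x] by simp

lemma seminorm_diff_commute: "p (x - y) = p (y - x)"
  using seminorm_minus[of "x - y"] by simp

lemma seminorm_diff: "p (x - y) \<le> p x + p y"
  using seminorm_add[of x "- y"] by simp

lemma seminorm_diff_triangle: "p (x - z) \<le> p (x - y) + p (y - z)"
  using seminorm_add[of "x - y" "y - z"] by simp

lemma seminorm_nonneg [simp]: "0 \<le> p x"
  using seminorm_diff[of x x] by simp

lemma seminorm_reverse_triangle: "\<bar>p x - p y\<bar> \<le> p (x - y)"
  using seminorm_add[of "x - y" y] seminorm_add[of "y - x" x] seminorm_diff_commute[of x y]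
  by (simp add: abs_le_iff)

lemma seminorm_sublinear: "sublinear p"
  unfolding sublinear_def by (simp add: seminorm_add seminorm_scaleR)

lemma seminorm_ball_open: "open {x. p x < e}"
  using open_vimage[OF open_lessThan[of e] seminorm_continuous] by (simp add: vimage_def)

lemma tendsto_seminorm:
  assumes "(X \<longlongrightarrow> x) F"
  shows "((\<lambda>n. p (X n - x)) \<longlongrightarrow> 0) F"
proof -
  have "((\<lambda>n. X n - x) \<longlongrightarrow> x - x) F"
    unfolding diff_conv_add_uminus by (intro tendsto_add tendsto_const assms)
  then have "((\<lambda>n. p (X n - x)) \<longlongrightarrow> p (x - x)) F"
    by (rule continuous_on_tendsto_compose[OF seminorm_continuous]) auto
  then show ?thesis by simp
qed

text \<open>The absolute value comes for free since \<open>p (- x) = p x\<close>. Because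
  \<open>p\<close> is attained at \<open>z\<close>, a seminorm of a vector-valued integral can be
  estimated through a single scalar integral without losing a constant.\<close>

lemma seminorm_functional:
  obtains \<phi> :: "'x \<Rightarrow> real" where "linear \<phi>" "\<And>x. \<bar>\<phi> x\<bar> \<le> p x" "\<phi> z = p z"
proof -
  obtain \<phi> :: "'x \<Rightarrow> real" where \<phi>: "linear \<phi>" "\<And>x. \<phi> x \<le> p x" "\<phi> z = p z"
    using dominated_linear_functional[OF seminorm_sublinear, of z] by blast
  have "\<bar>\<phi> x\<bar> \<le> p x" for x
    using \<phi>(2)[of x] \<phi>(2)[of "- x"] linear_neg[OF \<phi>(1), of x] by (simp add: abs_le_iff)
  with \<phi> that show thesis by blast
qed

end

lemma continuous_seminormI:
  fixes p :: "'x::complex_locally_convex_space \<Rightarrow> real"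
  assumes add: "\<And>x y. p (x + y) \<le> p x + p y" and scale: "\<And>c x. p (c *\<^sub>C x) = cmod c * p x"
    and nhds: "\<And>e. e > 0 \<Longrightarrow> \<forall>\<^sub>F x in nhds 0. p x \<le> e"
  shows "continuous_seminorm p"
proof -
  have "p (- x) = p x" for x
    using scale[of "- 1" x] by (simp add: scaleC_minus1)
  from this[of "x - y" for x y] have "p (y - x) = p (x - y)" for x y
    by simp
  then have rev: "\<bar>p x - p y\<bar> \<le> p (x - y)" for x y
    using add[of "x - y" y] add[of "y - x" x] by (simp add: abs_le_iff)
  have "(p \<longlongrightarrow> p x) (at x)" for x
  proof (rule tendstoI)
    fix e :: real assume "e > 0"
    have "((\<lambda>y. y - x) \<longlongrightarrow> x - x) (at x)"
      unfolding diff_conv_add_uminus by (intro tendsto_add tendsto_const tendsto_ident_at)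
    then have "\<forall>\<^sub>F y in at x. p (y - x) \<le> e / 2"
      using nhds[of "e / 2"] \<open>e > 0\<close> eventually_compose_filterlim by fastforce
    then show "\<forall>\<^sub>F y in at x. dist (p y) (p x) < e"
    proof eventually_elim
      case (elim y)
      then show ?case using rev[of y x] \<open>e > 0\<close> by (simp add: dist_real_def)
    qed
  qed
  then have "continuous_on UNIV p"
    by (simp add: continuous_on_def)
  with add scale show ?thesis by (simp add: continuous_seminorm_def)
qed

lemma eventually_nhds_scaleC:
  fixes x :: "'x::complex_locally_convex_space"
  assumes "eventually P (nhds (c *\<^sub>C x))"
  obtains P' Q' where "eventually P' (nhds c)" "eventually Q' (nhds x)"
    "\<And>d y. P' d \<Longrightarrow> Q' y \<Longrightarrow> P (d *\<^sub>C y)"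
proof -
  have "\<forall>\<^sub>F q in nhds c \<times>\<^sub>F nhds x. P (fst q *\<^sub>C snd q)"
    by (rule eventually_compose_filterlim[OF assms tendsto_scaleC_Pair])
  then show thesis
    unfolding eventually_prod_filter using that by auto
qed

text \<open>Joint continuity at \<open>(0, 0)\<close> only covers scalars of modulus below some
  \<open>d\<close>. Moving the fixed factor \<open>e = d / 2\<close> from the vector to the scalar
  enlarges that disc to one containing the closed unit disc.\<close>

lemma balanced_nhds_0:
  fixes U :: "'x::complex_locally_convex_space set"
  assumes "open U" "0 \<in> U"
  obtains W where "open W" "0 \<in> W" "\<And>c x. cmod c \<le> 1 \<Longrightarrow> x \<in> W \<Longrightarrow> c *\<^sub>C x \<in> U"
proof -
  have "\<forall>\<^sub>F x in nhds (0 *\<^sub>C (0::'x)). x \<in> U"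
    using assms unfolding scaleC_zero_left eventually_nhds by blast
  then obtain P Q where P: "eventually P (nhds (0::complex))" and Q: "eventually Q (nhds (0::'x))"
    and PQ: "\<And>c x. P c \<Longrightarrow> Q x \<Longrightarrow> c *\<^sub>C x \<in> U"
    by (rule eventually_nhds_scaleC) blast
  obtain d where d: "d > 0" "\<And>c. cmod c < d \<Longrightarrow> P c"
    using P by (auto simp: eventually_nhds_metric dist_norm)
  define e where "e = complex_of_real (d / 2)"
  have e: "e \<noteq> 0" "cmod e < d" using d by (auto simp: e_def)
  have "eventually Q (nhds (inverse e *\<^sub>C (0::'x)))"
    using Q by simp
  then obtain P' Q' where P': "eventually P' (nhds (inverse e))" and Q': "eventually Q' (nhds (0::'x))"
    and PQ': "\<And>c x. P' c \<Longrightarrow> Q' x \<Longrightarrow> Q (c *\<^sub>C x)"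
    by (rule eventually_nhds_scaleC) blast
  have Qe: "Q (inverse e *\<^sub>C x)" if "Q' x" for x
    using PQ' eventually_nhds_x_imp_x[OF P'] that by blast
  obtain W where W: "open W" "0 \<in> W" "\<And>x. x \<in> W \<Longrightarrow> Q' x"
    using Q' unfolding eventually_nhds by blast
  show thesis
  proof (rule that[OF W(1,2)])
    fix c x assume c: "cmod c \<le> 1" and "x \<in> W"
    have "cmod (c * e) \<le> cmod e"
      using mult_right_mono[OF c, of "cmod e"] by (simp add: norm_mult)
    then have "P (c * e)"
      using e by (intro d) simp
    moreover have "Q (inverse e *\<^sub>C x)"
      by (rule Qe[OF W(3)[OF \<open>x \<in> W\<close>]])
    ultimately have "(c * e) *\<^sub>C inverse e *\<^sub>C x \<in> U"
      by (rule PQ)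
    then show "c *\<^sub>C x \<in> U"
      using e by (simp add: scaleC_scaleC mult.assoc)
  qed
qed

text \<open>The Minkowski functional of the absolutely convex hull of a small neighbourhood.\<close>

theorem seminorm_in_nhds_0:
  fixes U :: "'x::complex_locally_convex_space set"
  assumes U: "open U" "0 \<in> U"
  obtains p where "continuous_seminorm p" "{x. p x < 1} \<subseteq> U"
proof -
  obtain V where V: "open V" "convex V" "0 \<in> V" "V \<subseteq> U"
    using convex_nhds_0[OF U] by blast
  obtain W where W: "open W" "0 \<in> W" and WV: "\<And>c x. cmod c \<le> 1 \<Longrightarrow> x \<in> W \<Longrightarrow> c *\<^sub>C x \<in> V"
    using balanced_nhds_0[OF V(1,3)] by blast
  define B0 where "B0 = {c *\<^sub>C x | c x. cmod c \<le> 1 \<and> x \<in> W}"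
  \<comment> \<open>The hull stays in \<open>V\<close> because \<open>V\<close> is convex; it is
    balanced because \<open>B0\<close> is and multiplication by \<open>c\<close> is linear, hence
    commutes with taking hulls.\<close>
  define B where "B = convex hull B0"
  have BV: "B \<subseteq> V"
    unfolding B_def using WV V(2) by (intro hull_minimal) (auto simp: B0_def)
  have WB: "W \<subseteq> B"
  proof
    fix x assume "x \<in> W"
    then have "1 *\<^sub>C x \<in> B0" unfolding B0_def by (intro CollectI exI[of _ 1] exI[of _ x]) auto
    then show "x \<in> B" using hull_subset[of B0 convex] by (auto simp: B_def scaleC_one)
  qed
  have convB: "convex B" by (simp add: B_def)
  have balB: "c *\<^sub>C x \<in> B" if "cmod c \<le> 1" "x \<in> B" for c x
  proof -
    have lin: "linear (\<lambda>x::'x. c *\<^sub>C x)"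
      by (intro linearI) (simp_all add: scaleC_add_right scaleR_scaleC_commute)
    have "(\<lambda>x. c *\<^sub>C x) ` B0 \<subseteq> B0"
    proof safe
      fix x assume "x \<in> B0"
      then obtain d w where "x = d *\<^sub>C w" "cmod d \<le> 1" "w \<in> W" by (auto simp: B0_def)
      moreover then have "cmod (c * d) \<le> 1"
        using that mult_mono[of "cmod c" 1 "cmod d" 1] by (simp add: norm_mult)
      ultimately show "c *\<^sub>C x \<in> B0" by (auto simp: B0_def scaleC_scaleC)
    qed
    then have "(\<lambda>x. c *\<^sub>C x) ` B \<subseteq> B"
      unfolding B_def convex_hull_linear_image[OF lin] by (rule hull_mono)
    with that show ?thesis by blast
  qed
  have B0: "0 \<in> B" using W(2) WB by blast
  define P where "P x = {r. r > 0 \<and> (1 / r) *\<^sub>R x \<in> B}" for x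
  define p where "p x = Inf (P x)" for x
  have evW: "eventually (\<lambda>x. x \<in> W) (nhds 0)"
    using W unfolding eventually_nhds by blast
  have nhds_scale: "\<forall>\<^sub>F x in nhds (0::'x). (1 / r) *\<^sub>R x \<in> B" for r
  proof -
    have "\<forall>\<^sub>F x in nhds (complex_of_real (1 / r) *\<^sub>C (0::'x)). x \<in> W"
      using evW by simp
    then obtain P' Q' where P': "eventually P' (nhds (complex_of_real (1 / r)))"
      and Q': "eventually Q' (nhds (0::'x))" and PQ': "\<And>c x. P' c \<Longrightarrow> Q' x \<Longrightarrow> c *\<^sub>C x \<in> W"
      by (rule eventually_nhds_scaleC) blast
    show ?thesis
      using Q' unfolding scaleR_scaleC
      by eventually_elim (use WB PQ' eventually_nhds_x_imp_x[OF P'] in blast)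
  qed
  \<comment> \<open>\<open>B\<close> absorbs every \<open>x\<close>, by continuity of the scalar
    multiplication at \<open>(0, x)\<close>.\<close>
  have ne: "P x \<noteq> {}" for x
  proof -
    have "\<forall>\<^sub>F y in nhds (0 *\<^sub>C x). y \<in> W"
      using evW by simp
    then obtain P' Q' where P': "eventually P' (nhds (0::complex))" and Q': "eventually Q' (nhds x)"
      and PQ': "\<And>c x. P' c \<Longrightarrow> Q' x \<Longrightarrow> c *\<^sub>C x \<in> W"
      by (rule eventually_nhds_scaleC) blast
    obtain d where d: "d > 0" "\<And>c. cmod c < d \<Longrightarrow> P' c"
      using P' by (auto simp: eventually_nhds_metric dist_norm)
    have "complex_of_real (d / 2) *\<^sub>C x \<in> W"
      using d by (intro PQ' eventually_nhds_x_imp_x[OF Q'] d(2)) simp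
    then have "(d / 2) *\<^sub>R x \<in> B" using WB by (auto simp: scaleR_scaleC)
    then have "2 / d \<in> P x" using d by (simp add: P_def)
    then show ?thesis by blast
  qed
  have bdd: "bdd_below (P x)" for x
    by (rule bdd_belowI[where m = 0]) (auto simp: P_def)
  have p_le: "p x \<le> r" if "r \<in> P x" for x r
    unfolding p_def using that bdd by (rule cInf_lower)
  have p_ge: "c \<le> p x" if "\<And>r. r \<in> P x \<Longrightarrow> c \<le> r" for c x
    unfolding p_def using that by (intro cInf_greatest ne)
  have P_add: "r + s \<in> P (x + y)" if "r \<in> P x" "s \<in> P y" for x y r s
  proof -
    have pos: "r > 0" "s > 0" using that by (auto simp: P_def)
    have "(r / (r + s)) *\<^sub>R (1 / r) *\<^sub>R x + (s / (r + s)) *\<^sub>R (1 / s) *\<^sub>R y \<in> B"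
      using that pos by (intro convexD[OF convB]) (auto simp: P_def simp flip: add_divide_distrib)
    then show ?thesis using pos by (simp add: P_def scaleR_add_right)
  qed
  have P_scale: "cmod c * r \<in> P (c *\<^sub>C x)" if "r \<in> P x" "c \<noteq> 0" for c r x
  proof -
    have "(1 / (cmod c * r)) *\<^sub>R c *\<^sub>C x = (c / cmod c) *\<^sub>C (1 / r) *\<^sub>R x"
      by (simp add: scaleR_scaleC scaleC_scaleC)
    moreover have "\<dots> \<in> B"
      using that by (intro balB) (auto simp: P_def norm_divide)
    ultimately show ?thesis using that by (auto simp: P_def)
  qed
  have "continuous_seminorm p"
  proof (rule continuous_seminormI)
    show "p (x + y) \<le> p x + p y" for x y
    proof -
      have "p (x + y) - r \<le> p y" if "r \<in> P x" for r
      proof (rule p_ge)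
        fix s assume "s \<in> P y"
        then show "p (x + y) - r \<le> s"
          using p_le[OF P_add[OF that]] by (simp add: diff_le_eq add.commute[of s r])
      qed
      then have "p (x + y) - p y \<le> p x"
        by (intro p_ge) (simp add: algebra_simps)
      then show ?thesis by simp
    qed
    have le: "p (c *\<^sub>C x) \<le> cmod c * p x" if "c \<noteq> 0" for c x
    proof -
      have "p (c *\<^sub>C x) / cmod c \<le> p x"
        using p_le[OF P_scale] that by (intro p_ge) (simp add: field_simps)
      then show ?thesis using that by (simp add: field_simps)
    qed
    show "p (c *\<^sub>C x) = cmod c * p x" for c x
    proof (cases "c = 0")
      case True
      have "p (0::'x) \<le> e" if "e > 0" for e
        using B0 that by (intro p_le) (simp add: P_def)
      moreover have "0 \<le> p (0::'x)" by (rule p_ge) (simp add: P_def)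
      ultimately have "p (0::'x) = 0"
        by (meson dense_ge less_eq_real_def order_antisym)
      with True show ?thesis by simp
    next
      case False
      have "p x \<le> cmod (inverse c) * p (c *\<^sub>C x)"
        using le[of "inverse c" "c *\<^sub>C x"] False by (simp add: scaleC_scaleC scaleC_one)
      then have "cmod c * p x \<le> p (c *\<^sub>C x)"
        using False unfolding norm_inverse by (simp add: field_simps)
      with le[OF False] show ?thesis by (intro antisym)
    qed
    fix e :: real assume "e > 0"
    show "\<forall>\<^sub>F x in nhds 0. p x \<le> e"
      using nhds_scale[of e] by eventually_elim (use \<open>e > 0\<close> in \<open>auto intro!: p_le simp: P_def\<close>)
  qed
  moreover have "{x. p x < 1} \<subseteq> U"
  proof safe
    fix x assume "p x < 1"
    then obtain r where r: "r \<in> P x" "r < 1"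
      using p_ge[of x 1] by (meson not_le)
    \<comment> \<open>For \<open>r < 1\<close> the point \<open>x\<close> is a convex combination of
      \<open>0\<close> and the multiple of \<open>x\<close> known to lie in
      \<open>B\<close>.\<close>
    then have "r *\<^sub>R (1 / r) *\<^sub>R x + (1 - r) *\<^sub>R 0 \<in> B"
      using B0 by (intro convexD[OF convB]) (auto simp: P_def)
    then have "x \<in> B" using r by (auto simp: P_def)
    then show "x \<in> U" using BV V(4) by blast
  qed
  ultimately show thesis by (rule that)
qed

lemma tendsto_seminormI:
  fixes X :: "'a \<Rightarrow> 'x::complex_locally_convex_space"
  assumes "\<And>p. continuous_seminorm p \<Longrightarrow> ((\<lambda>n. p (X n - x)) \<longlongrightarrow> 0) F"
  shows "(X \<longlongrightarrow> x) F"
proof (rule topological_tendstoI)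
  fix S assume S: "open S" "x \<in> S"
  have cont: "continuous_on UNIV (\<lambda>y. y + x)" 
    unfolding continuous_on_def by (intro ballI tendsto_add tendsto_ident_at tendsto_const)
  have "open ((\<lambda>y. y + x) -` S)" "0 \<in> (\<lambda>y. y + x) -` S"
    using open_vimage[OF S(1) cont] S(2) by auto
  then obtain p where p: "continuous_seminorm p" "{y. p y < 1} \<subseteq> (\<lambda>y. y + x) -` S"
    by (rule seminorm_in_nhds_0)
  have "\<forall>\<^sub>F n in F. p (X n - x) < 1"
    using assms[OF p(1)] by (rule order_tendstoD) simp
  then show "\<forall>\<^sub>F n in F. X n \<in> S"
    by eventually_elim (use p(2) in force)
qed

lemma Cauchy_seminormI:
  fixes X :: "nat \<Rightarrow> 'x::complex_locally_convex_space"
  assumes "\<And>p e. continuous_seminorm p \<Longrightarrow> e > 0 \<Longrightarrow> \<exists>N. \<forall>m\<ge>N. \<forall>n\<ge>N. p (X m - X n) \<le> e"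
  shows "Cauchy X"
  unfolding Cauchy_uniform_iff
proof (intro allI impI)
  fix P :: "'x \<times> 'x \<Rightarrow> bool" assume "eventually P uniformity"
  then have "eventually P (filtercomap (\<lambda>(x, y). y - x) (nhds 0))"
    by (simp only: cauchy_seq_finset_iff_vanishing)
  then obtain S where S: "open S" "0 \<in> S" "\<And>x y. y - x \<in> S \<Longrightarrow> P (x, y)"
    unfolding eventually_filtercomap eventually_nhds by fastforce
  obtain p where p: "continuous_seminorm p" "{y. p y < 1} \<subseteq> S"
    using seminorm_in_nhds_0[OF S(1,2)] by blast
  obtain N where N: "\<And>m n. m \<ge> N \<Longrightarrow> n \<ge> N \<Longrightarrow> p (X m - X n) \<le> 1 / 2"
    using assms[OF p(1), of "1 / 2"] by auto
  have "P (X n, X m)" if "n \<ge> N" "m \<ge> N" for n m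
    using N[OF that(2,1)] p(2) by (intro S(3)) force
  then show "\<exists>N. \<forall>n\<ge>N. \<forall>m\<ge>N. P (X n, X m)" by blast
qed

lemma seminorm_separation:
  fixes x :: "'x::{complex_locally_convex_space, t2_space}"
  assumes "\<And>p. continuous_seminorm p \<Longrightarrow> p x = 0"
  shows "x = 0"
proof -
  have "((\<lambda>_::nat. x) \<longlonglongrightarrow> 0)"
    by (rule tendsto_seminormI) (simp add: assms)
  then show ?thesis
    using LIMSEQ_unique tendsto_const by blast
qed

text \<open>If some seminorm of \<open>x - y\<close> were nonzero, the functional attaining it would
  tell the two vectors apart. This is how the value of a vector-valued integral is
  identified.\<close>

lemma functional_separation:
  fixes x y :: "'x::{complex_locally_convex_space, t2_space}"
  assumes "\<And>p \<phi>. continuous_seminorm p \<Longrightarrow> linear \<phi> \<Longrightarrow> (\<And>x. \<bar>\<phi> x\<bar> \<le> p x) \<Longrightarrow> \<phi> x = \<phi> y"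
  shows "x = y"
proof -
  have "x - y = 0"
  proof (rule seminorm_separation)
    fix p :: "'x \<Rightarrow> real" assume p: "continuous_seminorm p"
    obtain \<phi> where \<phi>: "linear \<phi>" "\<And>x. \<bar>\<phi> x\<bar> \<le> p x" "\<phi> (x - y) = p (x - y)"
      using seminorm_functional[OF p, of "x - y"] by blast
    then show "p (x - y) = 0"
      using assms[OF p \<phi>(1,2)] linear_diff[OF \<phi>(1), of x y] by simp
  qed
  then show ?thesis by simp
qed

lemma continuous_seminorm_scale:
  assumes p: "continuous_seminorm p" and c: "0 \<le> c"
  shows "continuous_seminorm (\<lambda>x. c * p x)"
  unfolding continuous_seminorm_def
proof (intro conjI allI)
  show "c * p (x + y) \<le> c * p x + c * p y" for x y
    using mult_left_mono[OF seminorm_add[OF p, of x y] c] by (simp add: distrib_left)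
  show "c * p (d *\<^sub>C x) = cmod d * (c * p x)" for d x
    by (simp add: seminorm_scaleC[OF p])
  show "continuous_on UNIV (\<lambda>x. c * p x)"
    by (intro continuous_intros seminorm_continuous p)
qed

lemma continuous_seminorm_add:
  assumes p: "continuous_seminorm p" and q: "continuous_seminorm q"
  shows "continuous_seminorm (\<lambda>x. p x + q x)"
  unfolding continuous_seminorm_def
proof (intro conjI allI)
  show "p (x + y) + q (x + y) \<le> p x + q x + (p y + q y)" for x y
    using seminorm_add[OF p, of x y] seminorm_add[OF q, of x y] by linarith
  show "p (d *\<^sub>C x) + q (d *\<^sub>C x) = cmod d * (p x + q x)" for d x
    by (simp add: seminorm_scaleC[OF p] seminorm_scaleC[OF q] distrib_left)
  show "continuous_on UNIV (\<lambda>x. p x + q x)"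
    by (intro continuous_intros seminorm_continuous p q)
qed

text \<open>Homogeneity turns an inclusion of neighbourhoods into an inequality: \<open>x\<close> is
  scaled by \<open>1 / r\<close> for each \<open>r > q x\<close>.\<close>

lemma equicontinuous_seminorm:
  fixes F :: "('x::complex_locally_convex_space \<Rightarrow> 'x) set"
  assumes F: "equicontinuous F" and lin: "\<And>T x r. T \<in> F \<Longrightarrow> T (r *\<^sub>R x) = r *\<^sub>R T x"
    and p: "continuous_seminorm p"
  obtains q where "continuous_seminorm q" "\<And>T x. T \<in> F \<Longrightarrow> p (T x) \<le> q x"
proof -
  have "open {x. p x < 1} \<and> 0 \<in> {x. p x < 1}"
    using seminorm_ball_open[OF p] seminorm_zero[OF p] by auto
  from F[unfolded equicontinuous_def, rule_format, OF this]
  obtain V where V: "open V" "0 \<in> V" "\<forall>T\<in>F. T ` V \<subseteq> {x. p x < 1}"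
    by blast
  obtain q where q: "continuous_seminorm q" "{x. q x < 1} \<subseteq> V"
    using seminorm_in_nhds_0[OF V(1,2)] by blast
  have "p (T x) \<le> q x" if T: "T \<in> F" for T x
  proof (rule dense_ge)
    fix r assume r: "q x < r"
    then have "r > 0" using seminorm_nonneg[OF q(1), of x] by simp
    then have "q ((1 / r) *\<^sub>R x) < 1"
      using r by (simp add: seminorm_scaleR[OF q(1)])
    then have "p (T ((1 / r) *\<^sub>R x)) < 1"
      using q(2) V(3) T by blast
    then show "p (T x) \<le> r"
      using \<open>r > 0\<close> by (simp add: lin[OF T] seminorm_scaleR[OF p] field_simps)
  qed
  with q(1) show thesis by (rule that)
qed

lemma equicontinuous_seminormI:
  fixes F :: "('x::complex_locally_convex_space \<Rightarrow> 'x) set"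
  assumes "\<And>p. continuous_seminorm p \<Longrightarrow> \<exists>q. continuous_seminorm q \<and> (\<forall>T\<in>F. \<forall>x. p (T x) \<le> q x)"
  shows "equicontinuous F"
  unfolding equicontinuous_def
proof (intro allI impI)
  fix U :: "'x set" assume "open U \<and> 0 \<in> U"
  then obtain p where p: "continuous_seminorm p" "{x. p x < 1} \<subseteq> U"
    using seminorm_in_nhds_0 by blast
  obtain q where q: "continuous_seminorm q" "\<And>T x. T \<in> F \<Longrightarrow> p (T x) \<le> q x"
    using assms[OF p(1)] by blast
  show "\<exists>V. open V \<and> 0 \<in> V \<and> (\<forall>T\<in>F. T ` V \<subseteq> U)"
  proof (intro exI[of _ "{x. q x < 1}"] conjI ballI)
    show "open {x. q x < 1}" using seminorm_ball_open[OF q(1)] .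
    show "0 \<in> {x. q x < 1}" by (simp add: seminorm_zero[OF q(1)])
    show "T ` {x. q x < 1} \<subseteq> U" if "T \<in> F" for T
      using q(2)[OF that] p(2) by (force intro: le_less_trans)
  qed
qed

lemma continuous_seminorm_boundI:
  fixes T :: "'x::complex_locally_convex_space \<Rightarrow> 'x"
  assumes diff: "\<And>x y. T (x - y) = T x - T y"
    and bound: "\<And>p. continuous_seminorm p \<Longrightarrow> \<exists>q. continuous_seminorm q \<and> (\<forall>x. p (T x) \<le> q x)"
  shows "continuous_on UNIV T"
  unfolding continuous_on_def
proof (intro ballI tendsto_seminormI)
  fix x p assume "continuous_seminorm (p :: 'x \<Rightarrow> real)"
  then obtain q where q: "continuous_seminorm q" "\<And>x. p (T x) \<le> q x"
    using bound by blast
  show "((\<lambda>y. p (T y - T x)) \<longlongrightarrow> 0) (at x)"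
  proof (rule tendsto_sandwich[OF always_eventually always_eventually tendsto_const])
    show "\<forall>y. p (T y - T x) \<le> q (y - x)" using q(2) by (simp flip: diff)
    show "((\<lambda>y. q (y - x)) \<longlongrightarrow> 0) (at x)"
      by (rule tendsto_seminorm[OF q(1) tendsto_ident_at])
    show "\<forall>y. 0 \<le> p (T y - T x)"
      using \<open>continuous_seminorm p\<close> by simp
  qed
qed

lemma continuous_operator_seminorm:
  fixes T :: "'x::complex_locally_convex_space \<Rightarrow> 'x"
  assumes T: "T \<in> continuous_linear_operators" and p: "continuous_seminorm p"
  shows "continuous_seminorm (\<lambda>x. p (T x))"
proof -
  have lin: "Vector_Spaces.linear scaleC scaleC T" and cont: "continuous_on UNIV T"
    using T by (auto simp: continuous_linear_operators_def)
  interpret Vector_Spaces.linear scaleC scaleC T by (rule lin)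
  show ?thesis
    unfolding continuous_seminorm_def
    using seminorm_add[OF p] seminorm_scaleC[OF p]
      continuous_on_compose2[OF seminorm_continuous[OF p] cont]
    by (simp add: add scale)
qed

section \<open>Vector-valued integrals\<close>

lemmas integrable_dominated = Bochner_Integration.integrable_bound

abbreviation (input) "sb_integrable \<equiv> Bochner_Integration.simple_bochner_integrable"
abbreviation (input) "sb_integral \<equiv> Bochner_Integration.simple_bochner_integral"

text \<open>Bridges two notions of integral: \<open>has_lc_integral\<close> asks for simple
  functions that are Cauchy in mean, \<open>has_bochner_integral\<close> for convergence in mean to
  \<open>f\<close>. Fatou's lemma, applied as the first index tends to infinity, derives the latter
  from the former and the limit almost everywhere.\<close>

lemma has_bochner_integral_L1_Cauchy:
  fixes f :: "'a \<Rightarrow> real"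
  assumes f: "f \<in> borel_measurable M"
    and simple: "\<And>n. sb_integrable M (s n)"
    and lim: "AE x in M. (\<lambda>n. s n x) \<longlonglongrightarrow> f x"
    and Cauchy: "\<And>e. e > 0 \<Longrightarrow> \<exists>N. \<forall>m\<ge>N. \<forall>n\<ge>N. (\<integral>x. \<bar>s m x - s n x\<bar> \<partial>M) \<le> e"
    and I: "(\<lambda>n. sb_integral M (s n)) \<longlonglongrightarrow> I"
  shows "has_bochner_integral M f I"
proof (rule has_bochner_integral.intros[OF f simple _ I])
  have int: "integrable M (s n)" for n
    using simple by (rule integrableI_simple_bochner_integrable)
  have [measurable]: "s n \<in> borel_measurable M" for n
    using int by auto
  show "(\<lambda>n. \<integral>\<^sup>+x. norm (f x - s n x) \<partial>M) \<longlonglongrightarrow> 0"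
  proof (rule order_tendstoI)
    fix a :: ennreal assume "0 < a"
    then obtain b where b: "0 < b" "b < a" using dense by blast
    define e where "e = enn2real b"
    have b_e: "b = ennreal e"
      using b by (simp add: e_def) (metis ennreal_enn2real less_trans order_less_le_trans top_greatest)
    then have "e > 0" using b(1) by (simp add: ennreal_less_zero_iff)
    then obtain N where N: "\<And>m n. m \<ge> N \<Longrightarrow> n \<ge> N \<Longrightarrow> (\<integral>x. \<bar>s m x - s n x\<bar> \<partial>M) \<le> e"
      using Cauchy by blast
    show "\<forall>\<^sub>F n in sequentially. (\<integral>\<^sup>+x. norm (f x - s n x) \<partial>M) < a"
      using eventually_ge_at_top[of N]
    proof eventually_elim
      case (elim n)
      have "(\<integral>\<^sup>+x. norm (f x - s n x) \<partial>M) = (\<integral>\<^sup>+x. liminf (\<lambda>m. ennreal \<bar>s m x - s n x\<bar>) \<partial>M)"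
      proof (rule nn_integral_cong_AE)
        show "AE x in M. ennreal (norm (f x - s n x)) = liminf (\<lambda>m. ennreal \<bar>s m x - s n x\<bar>)"
          using lim
        proof eventually_elim
          case (elim x)
          then have "(\<lambda>m. ennreal \<bar>s m x - s n x\<bar>) \<longlonglongrightarrow> ennreal \<bar>f x - s n x\<bar>"
            by (intro tendsto_ennrealI tendsto_rabs tendsto_diff tendsto_const)
          then show ?case
            by (intro lim_imp_Liminf[symmetric]) auto
        qed
      qed
      also have "\<dots> \<le> liminf (\<lambda>m. \<integral>\<^sup>+x. ennreal \<bar>s m x - s n x\<bar> \<partial>M)"
        by (rule nn_integral_liminf) measurable
      also have "\<dots> \<le> liminf (\<lambda>m. ennreal e)"
      proof (rule Liminf_mono)
        show "\<forall>\<^sub>F m in sequentially. (\<integral>\<^sup>+x. ennreal \<bar>s m x - s n x\<bar> \<partial>M) \<le> ennreal e"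
          using eventually_ge_at_top[of N]
        proof eventually_elim
          fix m assume "N \<le> m"
          have "(\<integral>\<^sup>+x. ennreal \<bar>s m x - s n x\<bar> \<partial>M) = ennreal (\<integral>x. \<bar>s m x - s n x\<bar> \<partial>M)"
            by (intro nn_integral_eq_integral integrable_abs Bochner_Integration.integrable_diff int) auto
          then show "(\<integral>\<^sup>+x. ennreal \<bar>s m x - s n x\<bar> \<partial>M) \<le> ennreal e"
            using N[OF \<open>N \<le> m\<close> elim] by (simp add: ennreal_leI)
        qed
      qed
      also have "\<dots> = b" by (simp add: Liminf_const b_e)
      finally show ?case using b(2) by (rule le_less_trans)
    qed
  qed simp
qed

text \<open>A linear \<open>\<phi>\<close> maps simple functions to simple functions and commutes
  with their integrals, and domination by \<open>p\<close> makes their images Cauchy in mean. All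
  later computations with integrals can thus be scalar.\<close>

theorem has_lc_integral_functional:
  fixes \<phi> :: "'x::complex_locally_convex_space \<Rightarrow> real"
  assumes F: "has_lc_integral M F I" and \<phi>: "linear \<phi>" "\<And>x. \<bar>\<phi> x\<bar> \<le> p x"
    and p: "continuous_seminorm p" and meas: "(\<lambda>s. \<phi> (F s)) \<in> borel_measurable M"
  shows "has_bochner_integral M (\<lambda>s. \<phi> (F s)) (\<phi> I)"
proof -
  obtain f where simple: "\<And>n. sb_integrable M (f n)"
    and lim: "AE s in M. (\<lambda>n. f n s) \<longlonglongrightarrow> F s"
    and Cauchy: "\<And>e. e > 0 \<Longrightarrow> \<exists>N. \<forall>m\<ge>N. \<forall>n\<ge>N. (\<integral>s. p (f m s - f n s) \<partial>M) \<le> e"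
    and I: "(\<lambda>n. sb_integral M (f n)) \<longlonglongrightarrow> I"
    using F p unfolding has_lc_integral_def by blast
  have \<phi>_lim: "(\<lambda>n. \<phi> (X n)) \<longlonglongrightarrow> \<phi> x" if "X \<longlonglongrightarrow> x" for X x
  proof -
    have "(\<lambda>n. \<phi> (X n) - \<phi> x) \<longlonglongrightarrow> 0"
      by (rule tendsto_rabs_zero_cancel, rule tendsto_sandwich[OF always_eventually always_eventually tendsto_const tendsto_seminorm[OF p that]])
        (use \<phi>(2) in \<open>auto simp flip: linear_diff[OF \<phi>(1)]\<close>)
    then show ?thesis by (simp add: LIM_zero_iff)
  qed
  have simple\<phi>: "sb_integrable M (\<lambda>s. \<phi> (f n s))" for n
    using simple_bochner_integrable_compose2[where p = "\<lambda>x y. \<phi> x", OF _ simple[of n] simple[of n]]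
    by (simp add: linear_0[OF \<phi>(1)])
  have intp: "integrable M (\<lambda>s. p (f m s - f n s))" for m n
    by (intro integrableI_simple_bochner_integrable simple_bochner_integrable_compose2[where p = "\<lambda>x y. p (x - y)"] simple)
      (simp add: seminorm_zero[OF p])
  show ?thesis
  proof (rule has_bochner_integral_L1_Cauchy[OF meas simple\<phi>])
    show "AE s in M. (\<lambda>n. \<phi> (f n s)) \<longlonglongrightarrow> \<phi> (F s)"
      using lim by eventually_elim (rule \<phi>_lim)
    show "(\<lambda>n. sb_integral M (\<lambda>s. \<phi> (f n s))) \<longlonglongrightarrow> \<phi> I"
      using \<phi>_lim[OF I] by (simp add: simple_bochner_integral_linear[OF \<phi>(1) simple])
    fix e :: real assume "e > 0"
    then obtain N where N: "\<And>m n. m \<ge> N \<Longrightarrow> n \<ge> N \<Longrightarrow> (\<integral>s. p (f m s - f n s) \<partial>M) \<le> e"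
      using Cauchy by blast
    have le: "(\<integral>s. \<bar>\<phi> (f m s) - \<phi> (f n s)\<bar> \<partial>M) \<le> (\<integral>s. p (f m s - f n s) \<partial>M)" for m n
    proof (rule integral_mono)
      show "integrable M (\<lambda>s. \<bar>\<phi> (f m s) - \<phi> (f n s)\<bar>)"
        by (intro integrable_abs Bochner_Integration.integrable_diff integrableI_simple_bochner_integrable simple\<phi>)
      show "\<bar>\<phi> (f m s) - \<phi> (f n s)\<bar> \<le> p (f m s - f n s)" for s
        using \<phi>(2) by (simp flip: linear_diff[OF \<phi>(1)])
    qed (rule intp)
    show "\<exists>N. \<forall>m\<ge>N. \<forall>n\<ge>N. (\<integral>s. \<bar>\<phi> (f m s) - \<phi> (f n s)\<bar> \<partial>M) \<le> e"
      by (intro exI[of _ N] allI impI) (rule order_trans[OF le N])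
  qed
qed

section \<open>Quadrature sums and existence of vector-valued integrals\<close>

lemma simple_bochner_integral_sum:
  fixes f :: "'i \<Rightarrow> 'a \<Rightarrow> 'b::real_vector"
  assumes "finite A" "\<And>i. i \<in> A \<Longrightarrow> sb_integrable M (f i)"
  shows "sb_integrable M (\<lambda>x. \<Sum>i\<in>A. f i x)"
    and "sb_integral M (\<lambda>x. \<Sum>i\<in>A. f i x) =
      (\<Sum>i\<in>A. sb_integral M (f i))"
proof -
  have "sb_integrable M (\<lambda>x. \<Sum>i\<in>A. f i x) \<and>
    sb_integral M (\<lambda>x. \<Sum>i\<in>A. f i x) =
      (\<Sum>i\<in>A. sb_integral M (f i))"
    using assms
  proof (induction A rule: finite_induct)
    case empty
    have zero: "sb_integrable M (\<lambda>x. 0::'b)"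
      by (intro simple_bochner_integrable.intros) auto
    moreover have "sb_integral M (\<lambda>x. 0::'b) = 0"
      unfolding simple_bochner_integral_def by (rule sum.neutral) auto
    ultimately show ?case by simp
  next
    case (insert i A)
    then have A: "sb_integrable M (\<lambda>x. \<Sum>i\<in>A. f i x)"
      "sb_integral M (\<lambda>x. \<Sum>i\<in>A. f i x) =
        (\<Sum>i\<in>A. sb_integral M (f i))"
      and i: "sb_integrable M (f i)" by auto
    show ?case
      using simple_bochner_integrable_compose2[where p = "(+)", OF _ i A(1)]
        simple_bochner_integral_add[OF i A(1)] insert(1,2) A(2) by simp
  qed
  then show "sb_integrable M (\<lambda>x. \<Sum>i\<in>A. f i x)"
    and "sb_integral M (\<lambda>x. \<Sum>i\<in>A. f i x) =
      (\<Sum>i\<in>A. sb_integral M (f i))" by auto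
qed

lemma tendsto_floor_grid:
  assumes "0 \<le> s"
  shows "(\<lambda>n. real (nat \<lfloor>real (Suc n) * s\<rfloor>) / real (Suc n)) \<longlonglongrightarrow> s"
proof (rule LIM_zero_cancel, rule Lim_null_comparison[OF _ LIMSEQ_inverse_real_of_nat], intro always_eventually allI)
  fix n
  define k where "k = real (Suc n)"
  have k: "0 < k" by (simp add: k_def)
  have eq: "real (nat \<lfloor>k * s\<rfloor>) / k - s = (real_of_int \<lfloor>k * s\<rfloor> - k * s) / k"
    using assms k by (simp add: diff_divide_distrib)
  have "\<bar>real_of_int \<lfloor>k * s\<rfloor> - k * s\<bar> / k \<le> 1 / k"
    using k by (intro divide_right_mono) linarith+
  then show "norm (real (nat \<lfloor>real (Suc n) * s\<rfloor>) / real (Suc n) - s) \<le> inverse (real (Suc n))"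
    unfolding k_def[symmetric] eq using k by (simp add: abs_divide inverse_eq_divide)
qed

text \<open>The nodes and weights do not depend on the integrand, so limits of the same quadrature sums
  can be taken simultaneously for several integrands.\<close>

theorem quadrature_has_lc_integral:
  fixes h w :: "real \<Rightarrow> real"
  assumes \<Omega>: "\<Omega> \<in> sets lebesgue" "\<And>s. s \<in> \<Omega> \<Longrightarrow> 0 \<le> s" "\<And>r s. s \<in> \<Omega> \<Longrightarrow> 0 \<le> r \<Longrightarrow> r \<le> s \<Longrightarrow> r \<in> \<Omega>"
    and h: "h \<in> borel_measurable (lebesgue_on \<Omega>)"
    and hw: "integrable (lebesgue_on \<Omega>) (\<lambda>s. h s * w s)"
    and w: "\<And>r s. s \<in> \<Omega> \<Longrightarrow> 0 \<le> r \<Longrightarrow> r \<le> s \<Longrightarrow> w r \<le> w s" "\<And>s. s \<in> \<Omega> \<Longrightarrow> 0 \<le> w s"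
  obtains N :: "nat \<Rightarrow> nat" and c \<sigma> :: "nat \<Rightarrow> nat \<Rightarrow> real" where "\<And>n j. 0 \<le> \<sigma> n j"
    "\<And>f :: real \<Rightarrow> 'x::seq_complete_complex_lcs. continuous_on \<Omega> f \<Longrightarrow>
       (\<And>p. continuous_seminorm p \<Longrightarrow> \<exists>B. \<forall>s\<in>\<Omega>. p (f s) \<le> B * w s) \<Longrightarrow>
       \<exists>I. (\<lambda>n. \<Sum>j<N n. c n j *\<^sub>R f (\<sigma> n j)) \<longlonglongrightarrow> I \<and> has_lc_integral (lebesgue_on \<Omega>) (\<lambda>s. h s *\<^sub>R f s) I"
proof -
  let ?M = "lebesgue_on \<Omega>"
  note [simp del] = of_nat_Suc
  have sp: "space ?M = \<Omega>" using \<Omega>(1) by (simp add: space_restrict_space)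
  \<comment> \<open>With base point 0 the metric approximation gives
    \<open>\<bar>H n s\<bar> \<le> 2 * \<bar>h s\<bar>\<close>, which feeds the dominating function
    below.\<close>
  have "\<exists>H. (\<forall>n. simple_function ?M (H n)) \<and> (\<forall>s\<in>\<Omega>. (\<lambda>n. H n s) \<longlonglongrightarrow> h s) \<and>
      (\<forall>n. \<forall>s\<in>\<Omega>. \<bar>H n s\<bar> \<le> 2 * \<bar>h s\<bar>)"
    using borel_measurable_implies_sequence_metric[OF h, of 0] by (simp add: sp)
  then obtain H where H: "\<And>n. simple_function ?M (H n)" "\<And>s. s \<in> \<Omega> \<Longrightarrow> (\<lambda>n. H n s) \<longlonglongrightarrow> h s"
    "\<And>n s. s \<in> \<Omega> \<Longrightarrow> \<bar>H n s\<bar> \<le> 2 * \<bar>h s\<bar>"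
    by blast
  \<comment> \<open>\<open>J n s\<close> is the cell of \<open>s\<close> in the grid of mesh
    \<open>1 / (n + 1)\<close>, and \<open>\<sigma>\<close> its left endpoint. Left endpoints stay
    in \<open>\<Omega>\<close>, and since \<open>w\<close> is monotone a bound by \<open>w\<close>
    at the node is also one by \<open>w s\<close>. The interval from 0 to \<open>n\<close> has
    \<open>N n\<close> cells.\<close>
  define J where "J n s = nat \<lfloor>real (Suc n) * s\<rfloor>" for n s
  define \<sigma> where "\<sigma> n j = real j / real (Suc n)" for n j :: nat
  define N where "N n = n * Suc n" for n :: nat
  \<comment> \<open>Cutting off at \<open>n\<close> keeps the support of finite measure. The weight
    of a node is the integral of \<open>H n\<close> over its cell and does not involve
    \<open>f\<close>.\<close>
  define u where "u n j s = (if s < real n \<and> J n s = j then H n s else 0)" for n j s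
  define c where "c n j = sb_integral ?M (u n j)" for n j
  have \<sigma>_nonneg: "0 \<le> \<sigma> n j" for n j by (simp add: \<sigma>_def)
  have \<sigma>_le: "\<sigma> n (J n s) \<le> s" if "s \<in> \<Omega>" for n s
  proof -
    have "real_of_int \<lfloor>real (Suc n) * s\<rfloor> \<le> real (Suc n) * s" by linarith
    then show ?thesis using \<Omega>(2)[OF that] by (simp add: \<sigma>_def J_def field_simps)
  qed
  have \<sigma>_lim: "(\<lambda>n. \<sigma> n (J n s)) \<longlonglongrightarrow> s" if "s \<in> \<Omega>" for s
    unfolding \<sigma>_def J_def by (rule tendsto_floor_grid) (rule \<Omega>(2)[OF that])
  have J_less: "J n s < N n" if "s < real n" "s \<in> \<Omega>" for n s
  proof -
    have "real_of_int \<lfloor>real (Suc n) * s\<rfloor> \<le> real (Suc n) * s" by linarith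
    also have "\<dots> < real (Suc n) * real n"
      using that by (intro mult_strict_left_mono) auto
    also have "\<dots> = real (N n)"
      unfolding N_def of_nat_mult by (rule mult.commute)
    finally have "real_of_int \<lfloor>real (Suc n) * s\<rfloor> < real (N n)" .
    then have "\<lfloor>real (Suc n) * s\<rfloor> < int (N n)" by linarith
    moreover have "0 \<le> \<lfloor>real (Suc n) * s\<rfloor>" using \<Omega>(2)[OF that(2)] by simp
    ultimately show ?thesis unfolding J_def by linarith
  qed
  have J_iff: "J n s = j \<longleftrightarrow> real j / real (Suc n) \<le> s \<and> s < (real j + 1) / real (Suc n)" if "s \<in> \<Omega>" for n j s
  proof -
    have "0 \<le> \<lfloor>real (Suc n) * s\<rfloor>" using \<Omega>(2)[OF that] by simp
    then have "J n s = j \<longleftrightarrow> \<lfloor>real (Suc n) * s\<rfloor> = int j"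
      unfolding J_def by linarith
    also have "\<dots> \<longleftrightarrow> real j \<le> real (Suc n) * s \<and> real (Suc n) * s < real j + 1"
      by (simp add: floor_eq_iff del: of_nat_Suc)
    also have "\<dots> \<longleftrightarrow> real j / real (Suc n) \<le> s \<and> s < (real j + 1) / real (Suc n)"
      by (simp add: pos_divide_le_eq pos_less_divide_eq mult.commute del: of_nat_Suc)
    finally show ?thesis .
  qed
  have u_simple: "sb_integrable ?M (u n j)" for n j
  proof
    have "{s \<in> space ?M. s < real n \<and> J n s = j} \<in> sets ?M"
    proof -
      have "{s \<in> space ?M. s < real n \<and> J n s = j} = \<Omega> \<inter> ({..<real n} \<inter> {real j / real (Suc n)..<(real j + 1) / real (Suc n)})"
        by (rule set_eqI) (simp add: sp J_iff cong: conj_cong)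
      then show ?thesis
        unfolding sets_restrict_space by (auto intro!: image_eqI)
    qed
    then have "simple_function ?M (\<lambda>s. if s \<in> {s \<in> space ?M. s < real n \<and> J n s = j} then H n s else 0)"
      by (intro simple_function_If_set H(1)) auto
    then show "simple_function ?M (u n j)"
      by (rule simple_function_cong[THEN iffD1, rotated]) (auto simp: u_def)
    have "emeasure ?M {s \<in> space ?M. u n j s \<noteq> 0} \<le> emeasure ?M (\<Omega> \<inter> {0..real n})"
      using \<Omega>(1,2) by (intro emeasure_mono) (auto simp: u_def sp sets_restrict_space split: if_splits)
    also have "\<dots> = emeasure lebesgue (\<Omega> \<inter> {0..real n})"
      using \<Omega>(1) by (intro emeasure_restrict_space) auto
    also have "\<dots> \<le> emeasure lebesgue {0..real n}"
      using \<Omega>(1) by (intro emeasure_mono) auto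
    also have "\<dots> < \<infinity>" by simp
    finally show "emeasure ?M {s \<in> space ?M. u n j s \<noteq> 0} \<noteq> \<infinity>" by simp
  qed
  show thesis
  proof (rule that[of \<sigma> c N])
    show "0 \<le> \<sigma> n j" for n j by (rule \<sigma>_nonneg)
    fix f :: "real \<Rightarrow> 'x"
    assume f: "continuous_on \<Omega> f" and bound: "\<And>p. continuous_seminorm p \<Longrightarrow> \<exists>B. \<forall>s\<in>\<Omega>. p (f s) \<le> B * w s"
    define \<Phi> where "\<Phi> n s = (\<Sum>j<N n. u n j s *\<^sub>R f (\<sigma> n j))" for n s
    have \<Phi>_eq: "\<Phi> n s = (if s < real n then H n s *\<^sub>R f (\<sigma> n (J n s)) else 0)" if "s \<in> \<Omega>" for n s
    proof -
      have "\<Phi> n s = (\<Sum>j<N n. if j = J n s then (if s < real n then H n s *\<^sub>R f (\<sigma> n j) else 0) else 0)"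
        unfolding \<Phi>_def u_def by (intro sum.cong) auto
      then show ?thesis using J_less[OF _ that, of n] by (simp add: sum.delta)
    qed
    have lin: "linear (\<lambda>r. r *\<^sub>R x)" for x :: 'x
      by (intro linearI) (auto simp: scaleR_add_left)
    have term_simple: "sb_integrable ?M (\<lambda>s. u n j s *\<^sub>R f (\<sigma> n j))" for n j
      by (rule simple_bochner_integrable_compose2[where p = "\<lambda>r _. r *\<^sub>R f (\<sigma> n j)", OF _ u_simple u_simple]) simp
    have \<Phi>_simple: "sb_integrable ?M (\<Phi> n)"
      and \<Phi>_integral: "sb_integral ?M (\<Phi> n) = (\<Sum>j<N n. c n j *\<^sub>R f (\<sigma> n j))" for n
      unfolding \<Phi>_def c_def
      using simple_bochner_integral_sum[where A = "{..<N n}" and M = ?M and f = "\<lambda>j s. u n j s *\<^sub>R f (\<sigma> n j)", OF _ term_simple]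
        simple_bochner_integral_linear[OF lin u_simple] by auto
    have \<Phi>_lim: "(\<lambda>n. p (\<Phi> n s - h s *\<^sub>R f s)) \<longlonglongrightarrow> 0" if p: "continuous_seminorm p" and s: "s \<in> \<Omega>" for p s
    proof -
      have "((\<lambda>n. f (\<sigma> n (J n s))) \<longlonglongrightarrow> f s)"
        using \<Omega>(3)[OF s \<sigma>_nonneg \<sigma>_le[OF s]] by (intro continuous_on_tendsto_compose[OF f \<sigma>_lim[OF s] s]) auto
      then have fl: "(\<lambda>n. p (f (\<sigma> n (J n s)) - f s)) \<longlonglongrightarrow> 0"
        by (rule tendsto_seminorm[OF p])
      let ?e = "\<lambda>n. (2 * \<bar>h s\<bar>) * p (f (\<sigma> n (J n s)) - f s) + \<bar>H n s - h s\<bar> * p (f s)"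
      have "?e \<longlonglongrightarrow> (2 * \<bar>h s\<bar>) * 0 + \<bar>h s - h s\<bar> * p (f s)"
        by (intro tendsto_intros fl H(2) s)
      then have lim0: "?e \<longlonglongrightarrow> 0"
        by simp
      have ev: "\<forall>\<^sub>F n in sequentially. p (\<Phi> n s - h s *\<^sub>R f s) \<le> ?e n"
      proof -
        obtain n0 where n0: "s < real n0" using reals_Archimedean2 by blast
        show ?thesis
          using eventually_ge_at_top[of n0]
        proof eventually_elim
          case (elim n)
          with n0 have "s < real n" by simp
          then have "\<Phi> n s - h s *\<^sub>R f s = H n s *\<^sub>R (f (\<sigma> n (J n s)) - f s) + (H n s - h s) *\<^sub>R f s"
            by (simp add: \<Phi>_eq[OF s] algebra_simps)
          then have "p (\<Phi> n s - h s *\<^sub>R f s) \<le> \<bar>H n s\<bar> * p (f (\<sigma> n (J n s)) - f s) + \<bar>H n s - h s\<bar> * p (f s)"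
            using seminorm_add[OF p] by (simp add: seminorm_scaleR[OF p, symmetric])
          moreover have "\<bar>H n s\<bar> * p (f (\<sigma> n (J n s)) - f s) \<le> (2 * \<bar>h s\<bar>) * p (f (\<sigma> n (J n s)) - f s)"
            by (intro mult_right_mono H(3) s seminorm_nonneg[OF p])
          ultimately show ?case by linarith
        qed
      qed
      show ?thesis
      proof (rule Lim_null_comparison[OF _ lim0])
        show "\<forall>\<^sub>F n in sequentially. norm (p (\<Phi> n s - h s *\<^sub>R f s)) \<le> ?e n"
          using ev by eventually_elim (simp add: seminorm_nonneg[OF p])
      qed
    qed
    have Cauchy: "\<exists>K. \<forall>m\<ge>K. \<forall>n\<ge>K. (\<integral>s. p (\<Phi> m s - \<Phi> n s) \<partial>?M) \<le> e" if p: "continuous_seminorm p" and e: "e > 0" for p e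
    proof -
      obtain B where B: "\<And>s. s \<in> \<Omega> \<Longrightarrow> p (f s) \<le> B * w s" using bound[OF p] by blast
      have meas_diff: "(\<lambda>s. p (\<Phi> m s - \<Phi> n s)) \<in> borel_measurable ?M" for m n
        by (intro borel_measurable_integrable integrableI_simple_bochner_integrable
            simple_bochner_integrable_compose2[where p = "\<lambda>x y. p (x - y)"] \<Phi>_simple) (simp add: seminorm_zero[OF p])
      define D where "D n s = p (\<Phi> n s - h s *\<^sub>R f s)" for n s
      \<comment> \<open>\<open>f\<close> is vector-valued and no measurability notion is at hand for
        it; \<open>D n\<close> is instead a pointwise limit of seminorms of simple
        functions.\<close>
      have D_meas: "D n \<in> borel_measurable ?M" for n
      proof (rule borel_measurable_LIMSEQ_real)
        show "(\<lambda>m. p (\<Phi> n s - \<Phi> m s)) \<longlonglongrightarrow> D n s" if "s \<in> space ?M" for s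
        proof -
          have "(\<lambda>m. p (\<Phi> n s - \<Phi> m s) - D n s) \<longlonglongrightarrow> 0"
          proof (rule tendsto_rabs_zero_cancel, rule tendsto_sandwich[OF always_eventually always_eventually tendsto_const \<Phi>_lim[OF p]])
            show "\<forall>m. \<bar>p (\<Phi> n s - \<Phi> m s) - D n s\<bar> \<le> p (\<Phi> m s - h s *\<^sub>R f s)"
            proof
              fix m
              have "\<bar>p (\<Phi> n s - \<Phi> m s) - D n s\<bar> \<le> p ((\<Phi> n s - \<Phi> m s) - (\<Phi> n s - h s *\<^sub>R f s))"
                unfolding D_def by (rule seminorm_reverse_triangle[OF p])
              then show "\<bar>p (\<Phi> n s - \<Phi> m s) - D n s\<bar> \<le> p (\<Phi> m s - h s *\<^sub>R f s)"
                using seminorm_diff_commute[OF p, of "h s *\<^sub>R f s" "\<Phi> m s"] by simp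
            qed
            show "s \<in> \<Omega>" using that by (simp add: sp)
          qed simp
          then show ?thesis by (simp add: LIM_zero_iff)
        qed
      qed (rule meas_diff)
      \<comment> \<open>The factor 3 consists of 2 from the bound on \<open>H n\<close> and 1 from
        \<open>h s *\<^sub>R f s\<close> itself.\<close>
      have dom: "\<bar>D n s\<bar> \<le> 3 * (\<bar>B\<bar> * \<bar>h s * w s\<bar>)" if s: "s \<in> \<Omega>" for n s
      proof -
        have hf: "\<bar>h s\<bar> * p (f r) \<le> \<bar>B\<bar> * \<bar>h s * w s\<bar>" if r: "r \<in> \<Omega>" "0 \<le> r" "r \<le> s" for r
        proof -
          have "p (f r) \<le> \<bar>B\<bar> * w s"
            using B[OF r(1)] w(1)[OF s r(2,3)] w(2)[OF r(1)] w(2)[OF s]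
              mult_mono[of B "\<bar>B\<bar>" "w r" "w s"] by linarith
          then have "\<bar>h s\<bar> * p (f r) \<le> \<bar>h s\<bar> * (\<bar>B\<bar> * w s)" by (intro mult_left_mono) auto
          then show ?thesis using w(2)[OF s] by (simp add: abs_mult mult_ac)
        qed
        have "p (\<Phi> n s) \<le> 2 * (\<bar>B\<bar> * \<bar>h s * w s\<bar>)"
        proof (cases "s < real n")
          case True
          have "p (\<Phi> n s) = \<bar>H n s\<bar> * p (f (\<sigma> n (J n s)))"
            using True by (simp add: \<Phi>_eq[OF s] seminorm_scaleR[OF p])
          also have "\<dots> \<le> (2 * \<bar>h s\<bar>) * p (f (\<sigma> n (J n s)))"
            by (intro mult_right_mono H(3) s seminorm_nonneg[OF p])
          finally show ?thesis
            using hf[of "\<sigma> n (J n s)"] \<Omega>(3)[OF s \<sigma>_nonneg \<sigma>_le[OF s]] \<sigma>_nonneg \<sigma>_le[OF s] by fastforce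
        qed (simp add: \<Phi>_eq[OF s] seminorm_zero[OF p])
        moreover have "p (h s *\<^sub>R f s) \<le> \<bar>B\<bar> * \<bar>h s * w s\<bar>"
          using hf[OF s] \<Omega>(2)[OF s] by (simp add: seminorm_scaleR[OF p])
        ultimately show ?thesis
          using seminorm_diff[OF p, of "\<Phi> n s" "h s *\<^sub>R f s"] seminorm_nonneg[OF p, of "\<Phi> n s - h s *\<^sub>R f s"]
          unfolding D_def by linarith
      qed
      have dom_int: "integrable ?M (\<lambda>s. 3 * (\<bar>B\<bar> * \<bar>h s * w s\<bar>))"
        using hw by (intro integrable_mult_right integrable_abs)
      have D_int: "integrable ?M (D n)" for n
        using dom by (intro integrable_dominated[OF dom_int D_meas] AE_I2) (force simp: sp)
      have "(\<lambda>n. \<integral>s. D n s \<partial>?M) \<longlonglongrightarrow> (\<integral>s. 0 \<partial>?M)"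
        using \<Phi>_lim[OF p] dom
        by (intro integral_dominated_convergence[OF _ D_meas dom_int] AE_I2) (auto simp: sp D_def)
      then have "\<forall>\<^sub>F n in sequentially. (\<integral>s. D n s \<partial>?M) < e / 2"
        using e by (intro order_tendstoD(2)) auto
      then obtain K where K: "\<And>n. n \<ge> K \<Longrightarrow> (\<integral>s. D n s \<partial>?M) < e / 2"
        by (auto simp: eventually_sequentially)
      have "(\<integral>s. p (\<Phi> m s - \<Phi> n s) \<partial>?M) \<le> e" if "m \<ge> K" "n \<ge> K" for m n
      proof -
        have le: "p (\<Phi> m s - \<Phi> n s) \<le> D m s + D n s" for s
          unfolding D_def
          using seminorm_diff_triangle[OF p, of "\<Phi> m s" "\<Phi> n s" "h s *\<^sub>R f s"]
            seminorm_diff_commute[OF p, of "h s *\<^sub>R f s" "\<Phi> n s"] by simp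
        have "(\<integral>s. p (\<Phi> m s - \<Phi> n s) \<partial>?M) \<le> (\<integral>s. D m s + D n s \<partial>?M)"
          using le by (intro integral_mono_AE' AE_I2 Bochner_Integration.integrable_add D_int)
            (auto simp: seminorm_nonneg[OF p] D_def)
        also have "\<dots> = (\<integral>s. D m s \<partial>?M) + (\<integral>s. D n s \<partial>?M)"
          by (intro Bochner_Integration.integral_add D_int)
        also have "\<dots> \<le> e" using K[OF that(1)] K[OF that(2)] by simp
        finally show ?thesis .
      qed
      then show ?thesis by blast
    qed
    have "Cauchy (\<lambda>n. sb_integral ?M (\<Phi> n))"
    proof (rule Cauchy_seminormI)
      fix p :: "'x \<Rightarrow> real" and e :: real assume p: "continuous_seminorm p" and "e > 0"
      \<comment> \<open>The triangle inequality for integrals under a seminorm, obtained from a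
        functional that attains \<open>p\<close> at the integral of the difference.\<close>
      have le: "p (sb_integral ?M (\<Phi> m) - sb_integral ?M (\<Phi> n))
        \<le> (\<integral>s. p (\<Phi> m s - \<Phi> n s) \<partial>?M)" for m n
      proof -
        let ?d = "\<lambda>s. \<Phi> m s - \<Phi> n s"
        have d: "sb_integrable ?M ?d"
          by (rule simple_bochner_integrable_compose2[where p = "(-)"]) (simp_all add: \<Phi>_simple)
        have pd: "sb_integrable ?M (\<lambda>s. p (?d s))"
          by (rule simple_bochner_integrable_compose2[where p = "\<lambda>x y. p x", OF _ d d]) (simp add: seminorm_zero[OF p])
        obtain \<phi> where \<phi>: "linear \<phi>" "\<And>x. \<bar>\<phi> x\<bar> \<le> p x"
          "\<phi> (sb_integral ?M ?d) = p (sb_integral ?M ?d)"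
          by (rule seminorm_functional[OF p]) blast
        have \<phi>d: "sb_integrable ?M (\<lambda>s. \<phi> (?d s))"
          by (rule simple_bochner_integrable_compose2[where p = "\<lambda>x y. \<phi> x", OF _ d d]) (simp add: linear_0[OF \<phi>(1)])
        have "p (sb_integral ?M ?d) = sb_integral ?M (\<lambda>s. \<phi> (?d s))"
          by (simp add: simple_bochner_integral_linear[OF \<phi>(1) d] \<phi>(3))
        also have "\<dots> = (\<integral>s. \<phi> (?d s) \<partial>?M)"
          by (rule simple_bochner_integrable_eq_integral[OF \<phi>d])
        also have "\<dots> \<le> (\<integral>s. p (?d s) \<partial>?M)"
          using \<phi>(2) by (intro integral_mono integrableI_simple_bochner_integrable \<phi>d pd) (rule abs_le_D1)
        finally show ?thesis
          by (simp add: simple_bochner_integral_diff[OF \<Phi>_simple \<Phi>_simple])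
      qed
      obtain K where "\<And>m n. m \<ge> K \<Longrightarrow> n \<ge> K \<Longrightarrow> (\<integral>s. p (\<Phi> m s - \<Phi> n s) \<partial>?M) \<le> e"
        using Cauchy[OF p \<open>e > 0\<close>] by blast
      then show "\<exists>K. \<forall>m\<ge>K. \<forall>n\<ge>K. p (sb_integral ?M (\<Phi> m) - sb_integral ?M (\<Phi> n)) \<le> e"
        by (intro exI[of _ K] allI impI) (rule order_trans[OF le])
    qed
    then obtain I where I: "(\<lambda>n. sb_integral ?M (\<Phi> n)) \<longlonglongrightarrow> I"
      using Cauchy_imp_convergent convergent_def by blast
    have "has_lc_integral ?M (\<lambda>s. h s *\<^sub>R f s) I"
      unfolding has_lc_integral_def
    proof (intro exI[of _ \<Phi>] conjI allI impI)
      show "AE s in ?M. (\<lambda>n. \<Phi> n s) \<longlonglongrightarrow> h s *\<^sub>R f s"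
        using \<Phi>_lim by (intro AE_I2 tendsto_seminormI) (auto simp: sp)
    qed (use \<Phi>_simple Cauchy I in auto)
    with I show "\<exists>I. (\<lambda>n. \<Sum>j<N n. c n j *\<^sub>R f (\<sigma> n j)) \<longlonglongrightarrow> I \<and> has_lc_integral ?M (\<lambda>s. h s *\<^sub>R f s) I"
      unfolding \<Phi>_integral by blast
  qed
qed

section \<open>The Bessel--Clifford function\<close>

definition bc_coeff :: "real \<Rightarrow> nat \<Rightarrow> real" where
  "bc_coeff \<nu> k = (- 1) ^ k / (fact k * Gamma (\<nu> + real k + 1))"

text \<open>In terms of the Bessel function, for \<open>x > 0\<close> this is
  \<open>x powr (- \<nu> / 2)\<close> times \<open>J\<^sub>\<nu>\<close> at
  \<open>2 * sqrt x\<close>. Removing the power leaves an everywhere convergent series, smooth also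
  at 0.\<close>

definition bessel_clifford :: "real \<Rightarrow> real \<Rightarrow> real" where
  "bessel_clifford \<nu> x = (\<Sum>k. bc_coeff \<nu> k * x ^ k)"

lemma Gamma_Suc_real: "0 < x \<Longrightarrow> Gamma (x + 1) = x * Gamma (x::real)"
  by (rule Gamma_plus1) (auto simp: nonpos_Ints_def)

text \<open>Each new factor \<open>\<nu> + k + 1\<close> is at least 1. Hence the coefficients are
  dominated by those of an exponential series.\<close>

lemma Gamma_add_nat_ge:
  fixes \<nu> :: real
  assumes "0 \<le> \<nu>"
  shows "Gamma (\<nu> + 1) \<le> Gamma (\<nu> + real k + 1)"
proof (induction k)
  case (Suc k)
  have "Gamma (\<nu> + real (Suc k) + 1) = (\<nu> + real k + 1) * Gamma (\<nu> + real k + 1)"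
    using Gamma_Suc_real[of "\<nu> + real k + 1"] assms by (simp add: add_ac)
  moreover have "1 * Gamma (\<nu> + real k + 1) \<le> (\<nu> + real k + 1) * Gamma (\<nu> + real k + 1)"
    using assms by (intro mult_right_mono less_imp_le[OF Gamma_real_pos]) auto
  ultimately show ?case using Suc by simp
qed simp

lemma abs_bc_coeff:
  assumes "0 \<le> \<nu>"
  shows "\<bar>bc_coeff \<nu> k\<bar> = 1 / (fact k * Gamma (\<nu> + real k + 1))"
  using Gamma_real_pos[of "\<nu> + real k + 1"] assms
  by (simp add: bc_coeff_def abs_mult power_abs)

lemma summable_bc_norm:
  assumes "0 \<le> \<nu>"
  shows "summable (\<lambda>k. norm (bc_coeff \<nu> k * x ^ k))"
proof (rule summable_comparison_test')
  show "summable (\<lambda>k. 1 / Gamma (\<nu> + 1) * (inverse (fact k) * \<bar>x\<bar> ^ k))"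
    by (intro summable_mult summable_exp)
  fix k :: nat
  have "0 < Gamma (\<nu> + 1)" using assms by (intro Gamma_real_pos) simp
  then show "norm (norm (bc_coeff \<nu> k * x ^ k)) \<le> 1 / Gamma (\<nu> + 1) * (inverse (fact k) * \<bar>x\<bar> ^ k)"
    using Gamma_add_nat_ge[OF assms, of k]
    by (simp add: abs_mult abs_bc_coeff[OF assms] power_abs divide_simps mult_mono)
qed

lemma summable_bc:
  assumes "0 \<le> \<nu>"
  shows "summable (\<lambda>k. bc_coeff \<nu> k * x ^ k)"
  by (rule summable_norm_cancel[OF summable_bc_norm[OF assms]])

lemma diffs_bc_coeff:
  assumes "0 \<le> \<nu>"
  shows "diffs (bc_coeff \<nu>) k = - bc_coeff (\<nu> + 1) k"
  by (simp add: diffs_def bc_coeff_def add_ac)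

lemma DERIV_bessel_clifford:
  assumes "0 \<le> \<nu>"
  shows "(bessel_clifford \<nu> has_real_derivative - bessel_clifford (\<nu> + 1) x) (at x)"
proof -
  have "((\<lambda>x. \<Sum>k. bc_coeff \<nu> k * x ^ k) has_real_derivative (\<Sum>k. diffs (bc_coeff \<nu>) k * x ^ k)) (at x)"
    by (rule termdiffs_strong_converges_everywhere) (rule summable_bc[OF assms])
  then show ?thesis
    using summable_bc[of "\<nu> + 1" x] assms
    by (simp add: bessel_clifford_def[abs_def] diffs_bc_coeff suminf_minus)
qed

text \<open>The three-term recurrence of Bessel functions. Since differentiation raises the order by
  one, it is equivalent to the Bessel differential equation, in which form the energy estimate uses
  it.\<close>

lemma bessel_clifford_recurrence:
  assumes "0 \<le> \<nu>"
  shows "x * bessel_clifford (\<nu> + 2) x = (\<nu> + 1) * bessel_clifford (\<nu> + 1) x - bessel_clifford \<nu> x"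
proof -
  define d where "d k = (\<nu> + 1) * bc_coeff (\<nu> + 1) k - bc_coeff \<nu> k" for k
  have d0: "d 0 = 0"
  proof -
    have "Gamma (\<nu> + 1 + 1) = (\<nu> + 1) * Gamma (\<nu> + 1)"
      using assms by (intro Gamma_Suc_real) simp
    then show ?thesis
      using assms by (simp add: d_def bc_coeff_def)
  qed
  have dSuc: "d (Suc k) = bc_coeff (\<nu> + 2) k" for k
  proof -
    define z where "z = \<nu> + real k + 2"
    have z: "z > 0" "Gamma z > 0" using assms by (auto simp: z_def intro!: Gamma_real_pos)
    have "Gamma (z + 1) = z * Gamma z" by (rule Gamma_Suc_real[OF z(1)])
    then have "d (Suc k) = (- 1) ^ Suc k / fact (Suc k) * ((\<nu> + 1) / (z * Gamma z) - 1 / Gamma z)"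
      by (simp add: d_def bc_coeff_def z_def add_ac algebra_simps)
    also have "(\<nu> + 1) / (z * Gamma z) - 1 / Gamma z = (\<nu> + 1 - z) / (z * Gamma z)"
      using z by (simp add: diff_divide_distrib)
    also have "\<nu> + 1 - z = - real (Suc k)"
      by (simp add: z_def)
    also have "(- 1) ^ Suc k / fact (Suc k) * (- real (Suc k) / (z * Gamma z)) = (- 1) ^ k / (fact k * (z * Gamma z))"
    proof -
      have "(- 1) ^ Suc k / (r * f) * (- r / w) = (- 1) ^ k / (f * w)" if "r \<noteq> 0" for r f w :: real
        using that by simp
      from this[of "real (Suc k)"] show ?thesis
        by (simp add: fact_Suc del: of_nat_Suc)
    qed
    also have "\<dots> = bc_coeff (\<nu> + 2) k"
      using \<open>Gamma (z + 1) = z * Gamma z\<close> by (simp add: bc_coeff_def z_def add_ac)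
    finally show ?thesis .
  qed
  have sm: "summable (\<lambda>k. d k * x ^ k)"
    using summable_diff[OF summable_mult[OF summable_bc[of "\<nu> + 1" x], of "\<nu> + 1"] summable_bc[OF assms, of x]] assms
    by (simp add: d_def algebra_simps)
  have "(\<nu> + 1) * bessel_clifford (\<nu> + 1) x - bessel_clifford \<nu> x = (\<Sum>k. d k * x ^ k)"
    using suminf_diff[OF summable_mult[OF summable_bc[of "\<nu> + 1" x], of "\<nu> + 1"] summable_bc[OF assms, of x]]
      suminf_mult[OF summable_bc[of "\<nu> + 1" x], of "\<nu> + 1"] assms
    by (simp add: bessel_clifford_def d_def algebra_simps)
  also have "\<dots> = (\<Sum>k. d (Suc k) * x ^ Suc k)"
    using suminf_split_head[OF sm] d0 by simp
  also have "\<dots> = x * bessel_clifford (\<nu> + 2) x"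
    using suminf_mult[OF summable_bc[of "\<nu> + 2" x], of x] assms
    by (simp add: bessel_clifford_def dSuc mult_ac)
  finally show ?thesis by simp
qed

lemma continuous_on_bessel_clifford: "0 \<le> \<nu> \<Longrightarrow> continuous_on A (bessel_clifford \<nu>)"
  by (meson DERIV_bessel_clifford DERIV_isCont continuous_at_imp_continuous_on)

text \<open>In the variable \<open>z = 2 \<surd>x\<close> the function \<open>u z = z powr (\<nu> + 1/2) * bessel_clifford \<nu> (z\<^sup>2 / 4)\<close>
  solves \<open>u'' = - (1 - (\<nu>\<^sup>2 - 1/4) / z\<^sup>2) u\<close>, so that \<open>(u\<^sup>2 + u'\<^sup>2) exp ((\<nu>\<^sup>2 - 1/4) / z)\<close> decreases.\<close>

lemma bessel_clifford_energy:
  fixes \<nu> :: real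
  assumes \<nu>: "1 / 2 \<le> \<nu>"
  obtains E where "\<And>z. z \<ge> 1 \<Longrightarrow> (z powr (\<nu> + 1 / 2) * bessel_clifford \<nu> (z\<^sup>2 / 4))\<^sup>2 \<le> E"
proof -
  define K0 K1 K2 where K: "K0 z = bessel_clifford \<nu> (z\<^sup>2 / 4)" "K1 z = bessel_clifford (\<nu> + 1) (z\<^sup>2 / 4)"
    "K2 z = bessel_clifford (\<nu> + 2) (z\<^sup>2 / 4)" for z :: real
  define c where "c = \<nu>\<^sup>2 - 1 / 4"
  \<comment> \<open>The sign of \<open>c\<close> decides the monotonicity of the energy; it is here
    that \<open>1 / 2 \<le> \<nu>\<close> enters.\<close>
  have c: "0 \<le> c"
    using power_mono[OF \<nu>, of 2] by (simp add: c_def power2_eq_square)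
  define u where "u z = z powr (\<nu> + 1 / 2) * K0 z" for z
  define v where "v z = (\<nu> + 1 / 2) * z powr (\<nu> - 1 / 2) * K0 z - 1 / 2 * z powr (\<nu> + 3 / 2) * K1 z" for z
  have sq: "((\<lambda>z. z\<^sup>2 / 4) has_real_derivative z / 2) (at z)" for z :: real
    by (auto intro!: derivative_eq_intros)
  have v': "v = (\<lambda>z. (\<nu> + 1 / 2) * (z powr (\<nu> - 1 / 2) * K0 z) - 1 / 2 * (z powr (\<nu> + 3 / 2) * K1 z))"
    by (simp add: v_def fun_eq_iff)
  have dK0: "(K0 has_real_derivative - K1 z * (z / 2)) (at z)" for z
    unfolding K[abs_def] by (rule DERIV_chain2[OF DERIV_bessel_clifford sq]) (use \<nu> in simp)
  have dK1: "(K1 has_real_derivative - K2 z * (z / 2)) (at z)" for z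
    using DERIV_chain2[OF DERIV_bessel_clifford[of "\<nu> + 1"] sq[of z]] \<nu>
    unfolding K[abs_def] by (simp add: add.assoc)
  have rec: "K2 z = ((\<nu> + 1) * K1 z - K0 z) * 4 / z\<^sup>2" if "z > 0" for z
    using bessel_clifford_recurrence[of \<nu> "z\<^sup>2 / 4"] \<nu> that by (simp add: K field_simps)
  \<comment> \<open>All powers are referred to the single factor
    \<open>z powr (\<nu> - 3 / 2)\<close>, which turns the differential equation into an identity of
    polynomials in \<open>z\<close>.\<close>
  have pw: "z powr (\<nu> - 1 / 2) = z powr (\<nu> - 3 / 2) * z" "z powr (\<nu> + 1 / 2) = z powr (\<nu> - 3 / 2) * z ^ 2"
    "z powr (\<nu> + 3 / 2) = z powr (\<nu> - 3 / 2) * z ^ 3" if "z > 0" for z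
  proof -
    have "\<nu> - 1 / 2 = \<nu> - 3 / 2 + 1" "\<nu> + 1 / 2 = \<nu> - 3 / 2 + 2" "\<nu> + 3 / 2 = \<nu> - 3 / 2 + 3"
      by simp_all
    then show "z powr (\<nu> - 1 / 2) = z powr (\<nu> - 3 / 2) * z" "z powr (\<nu> + 1 / 2) = z powr (\<nu> - 3 / 2) * z ^ 2"
      "z powr (\<nu> + 3 / 2) = z powr (\<nu> - 3 / 2) * z ^ 3"
      using that by (simp_all only: powr_add powr_one powr_numeral less_imp_le)
  qed
  have du: "(u has_real_derivative v z) (at z)" if "z > 0" for z
  proof -
    have "(u has_real_derivative (\<nu> + 1 / 2) * z powr (\<nu> + 1 / 2 - 1) * K0 z + (- K1 z * (z / 2)) * z powr (\<nu> + 1 / 2)) (at z)"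
      unfolding u_def[abs_def] using that
      by (intro DERIV_mult has_real_derivative_powr dK0)
    then show ?thesis
      by (rule DERIV_cong) (simp add: v_def pw[OF that] power_numeral_reduce)
  qed
  have dv: "(v has_real_derivative - (1 - c / z\<^sup>2) * u z) (at z)" if "z > 0" for z
  proof -
    have "(v has_real_derivative
        (\<nu> + 1 / 2) * (((\<nu> - 1 / 2) * z powr (\<nu> - 1 / 2 - 1)) * K0 z + (- K1 z * (z / 2)) * z powr (\<nu> - 1 / 2))
        - 1 / 2 * (((\<nu> + 3 / 2) * z powr (\<nu> + 3 / 2 - 1)) * K1 z + (- K2 z * (z / 2)) * z powr (\<nu> + 3 / 2))) (at z)"
      unfolding v' using that
      by (intro DERIV_diff DERIV_cmult DERIV_mult has_real_derivative_powr dK0 dK1)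
    moreover have "(\<nu> + 1 / 2) * (((\<nu> - 1 / 2) * z powr (\<nu> - 1 / 2 - 1)) * K0 z + (- K1 z * (z / 2)) * z powr (\<nu> - 1 / 2))
        - 1 / 2 * (((\<nu> + 3 / 2) * z powr (\<nu> + 3 / 2 - 1)) * K1 z + (- K2 z * (z / 2)) * z powr (\<nu> + 3 / 2))
      = - (1 - c / z\<^sup>2) * u z"
    proof -
      have e: "\<nu> - 1 / 2 - 1 = \<nu> - 3 / 2" "\<nu> + 3 / 2 - 1 = \<nu> + 1 / 2" by simp_all
      show ?thesis
        unfolding u_def rec[OF that] pw[OF that] e c_def using that
        by (simp add: field_simps power2_eq_square power3_eq_cube)
    qed
    ultimately show ?thesis by (rule DERIV_cong)
  qed
  define E where "E z = ((u z)\<^sup>2 + (v z)\<^sup>2) * exp (c / z)" for z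
  \<comment> \<open>Differentiating the sum of squares leaves only the cross term
    \<open>2 * c * u z * v z / z\<^sup>2\<close>; the weight \<open>exp (c / z)\<close> contributes
    \<open>- c / z\<^sup>2\<close> times the sum of squares, and together they form a perfect
    square.\<close>
  have dE: "(E has_real_derivative - exp (c / z) * (c / z\<^sup>2) * (u z - v z)\<^sup>2) (at z)" if "z > 0" for z
    unfolding E_def[abs_def] using that
    by (auto intro!: derivative_eq_intros du dv simp: power2_eq_square) (simp add: field_simps)
  have E_le: "E z \<le> E 1" if "z \<ge> 1" for z
  proof (rule DERIV_nonpos_imp_nonincreasing[OF that])
    fix y :: real assume "1 \<le> y"
    then show "\<exists>d. (E has_real_derivative d) (at y) \<and> d \<le> 0"
      using c by (intro exI[of _ "- exp (c / y) * (c / y\<^sup>2) * (u y - v y)\<^sup>2"] conjI dE) auto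
  qed
  have u_le: "(u z)\<^sup>2 \<le> E z" if "z \<ge> 1" for z
  proof -
    have "1 \<le> exp (c / z)" using c that by simp
    then have "((u z)\<^sup>2 + (v z)\<^sup>2) * 1 \<le> E z"
      unfolding E_def by (intro mult_left_mono) auto
    moreover have "(u z)\<^sup>2 \<le> ((u z)\<^sup>2 + (v z)\<^sup>2) * 1"
      by simp
    ultimately show ?thesis by (rule order_trans[rotated])
  qed
  show thesis
  proof (rule that)
    fix z :: real assume "1 \<le> z"
    from order_trans[OF u_le[OF this] E_le[OF this]]
    show "(z powr (\<nu> + 1 / 2) * bessel_clifford \<nu> (z\<^sup>2 / 4))\<^sup>2 \<le> E 1"
      unfolding u_def K .
  qed
qed

abbreviation (input) bc_decay :: "real \<Rightarrow> real \<Rightarrow> real" where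
  "bc_decay \<nu> x \<equiv> (1 + x) powr (- \<nu> / 2 - 1 / 4)"

text \<open>The energy bounds \<open>z powr (\<nu> + 1 / 2) * bessel_clifford \<nu> (z\<^sup>2 /
  4)\<close>, and \<open>z = 2 * sqrt x\<close> turns this into the stated power of \<open>x\<close>
  for \<open>x \<ge> 1\<close>. Compactness covers the rest, and \<open>1 + x\<close> serves both
  ranges.\<close>

theorem bessel_clifford_decay:
  assumes \<nu>: "1 / 2 \<le> \<nu>"
  obtains B where "B > 0" "\<And>x. 0 \<le> x \<Longrightarrow> \<bar>bessel_clifford \<nu> x\<bar> \<le> B * bc_decay \<nu> x"
proof -
  define e where "e = \<nu> / 2 + 1 / 4"
  have e: "e > 0" using \<nu> by (simp add: e_def)
  obtain E where E: "\<And>z. z \<ge> 1 \<Longrightarrow> (z powr (\<nu> + 1 / 2) * bessel_clifford \<nu> (z\<^sup>2 / 4))\<^sup>2 \<le> E"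
    using bessel_clifford_energy[OF \<nu>] by blast
  have large: "\<bar>bessel_clifford \<nu> x\<bar> \<le> sqrt E * x powr (- e)" if "x \<ge> 1" for x
  proof -
    define z where "z = 2 * sqrt x"
    have "sqrt x \<ge> 1" using that by simp
    then have z: "z \<ge> 1" "z\<^sup>2 / 4 = x"
      using that unfolding z_def by (linarith, simp add: power_mult_distrib)
    have "\<bar>z powr (\<nu> + 1 / 2) * bessel_clifford \<nu> x\<bar> \<le> sqrt E"
      using E[OF z(1)] unfolding z(2) by (intro real_le_rsqrt) simp
    moreover have "x powr e \<le> z powr (\<nu> + 1 / 2)"
    proof -
      have "x powr e = sqrt x powr (\<nu> + 1 / 2)"
        using that by (simp add: e_def powr_half_sqrt[symmetric] powr_powr field_simps)
      also have "\<dots> \<le> z powr (\<nu> + 1 / 2)"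
        using \<nu> that by (intro powr_mono2) (auto simp: z_def)
      finally show ?thesis .
    qed
    ultimately have "x powr e * \<bar>bessel_clifford \<nu> x\<bar> \<le> sqrt E"
      using mult_right_mono[of "x powr e" "z powr (\<nu> + 1 / 2)" "\<bar>bessel_clifford \<nu> x\<bar>"]
      by (simp add: abs_mult)
    moreover have "x powr e > 0" using that by simp
    ultimately show ?thesis
      by (simp add: powr_minus field_simps)
  qed
  have E0: "0 \<le> sqrt E" using E[of 1] zero_le_power2 order_trans by (metis order_refl real_sqrt_ge_zero)
  obtain M where M: "\<And>x. 0 \<le> x \<Longrightarrow> x \<le> 1 \<Longrightarrow> \<bar>bessel_clifford \<nu> x\<bar> \<le> M"
  proof -
    have "compact (bessel_clifford \<nu> ` {0..1})"
      using \<nu> by (intro compact_continuous_image continuous_on_bessel_clifford) auto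
    then show thesis
      using that by (force dest: compact_imp_bounded simp: bounded_iff)
  qed
  have M0: "0 \<le> M" using M[of 0] by simp
  \<comment> \<open>The factor \<open>2 powr e\<close> pays for \<open>1 + x \<le> 2\<close> on the
    unit interval and for \<open>1 + x \<le> 2 * x\<close> beyond it; the summand 1 makes
    \<open>B\<close> positive.\<close>
  define B where "B = (M + sqrt E + 1) * 2 powr e"
  show thesis
  proof (rule that[of B])
    have "0 < M + sqrt E + 1" using M0 E0 by linarith
    then show "B > 0" unfolding B_def by (intro mult_pos_pos) auto
    fix x :: real assume x: "0 \<le> x"
    have "\<bar>bessel_clifford \<nu> x\<bar> \<le> B * (1 + x) powr (- e)"
    proof (cases "x \<le> 1")
      case True
      have "(2::real) powr (- e) \<le> (1 + x) powr (- e)"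
        using x True e by (intro powr_mono2') auto
      then have "B * 2 powr (- e) \<le> B * (1 + x) powr (- e)"
        using \<open>B > 0\<close> by simp
      moreover have "B * 2 powr (- e) = M + sqrt E + 1"
        by (simp add: B_def powr_minus)
      ultimately show ?thesis using M[OF x True] E0 by linarith
    next
      case False
      have "(2 * x) powr (- e) \<le> (1 + x) powr (- e)"
        using False e by (intro powr_mono2') auto
      then have "sqrt E * 2 powr e * (2 * x) powr (- e) \<le> sqrt E * 2 powr e * (1 + x) powr (- e)"
        using E0 by (intro mult_left_mono) auto
      moreover have "sqrt E * 2 powr e * (2 * x) powr (- e) = sqrt E * x powr (- e)"
        using x by (simp add: powr_mult powr_minus)
      moreover have "sqrt E * 2 powr e * (1 + x) powr (- e) \<le> B * (1 + x) powr (- e)"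
        unfolding B_def using M0 by (intro mult_right_mono) auto
      ultimately show ?thesis using large[of x] False by linarith
    qed
    then show "\<bar>bessel_clifford \<nu> x\<bar> \<le> B * bc_decay \<nu> x"
      by (simp add: e_def algebra_simps)
  qed
qed

section \<open>Laplace transforms\<close>

lemma set_integrable_has_integral_nonneg:
  fixes f :: "real \<Rightarrow> real"
  assumes f: "(f has_integral I) A" and nonneg: "\<And>x. x \<in> A \<Longrightarrow> 0 \<le> f x"
    and meas: "(\<lambda>x. indicator A x * f x) \<in> borel_measurable borel"
  shows "has_bochner_integral lborel (\<lambda>x. indicator A x * f x) I"
proof (rule has_bochner_integral_nn_integral)
  show "(\<integral>\<^sup>+x. ennreal (indicator A x * f x) \<partial>lborel) = ennreal I"
    using nn_integral_has_integral_lebesgue[OF nonneg f] by simp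
  show "0 \<le> I" using has_integral_nonneg[OF f] nonneg by blast
qed (use meas nonneg in \<open>auto simp: indicator_def\<close>)

text \<open>The integrand of a Laplace transform, extended by zero so that Fubini's theorem,
  convolution and affine substitution can be applied on the whole line.\<close>

abbreviation (input) damped :: "real \<Rightarrow> real \<Rightarrow> real \<Rightarrow> real" where
  "damped l t y \<equiv> indicator {0..} t * (exp (- l * t) * y)"

lemma laplace_powr:
  assumes a: "0 < a" and l: "0 < (l::real)"
  shows "has_bochner_integral lborel (\<lambda>t. damped l t (t powr (a - 1)))
    (Gamma a * l powr (- a))"
proof -
  have "has_bochner_integral lborel (\<lambda>t. indicator {0..} t * (t powr (a - 1) / exp t)) (Gamma a)"
    by (rule set_integrable_has_integral_nonneg[OF Gamma_integral_real[OF a]]) auto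
  then have "has_bochner_integral lborel
      (\<lambda>t. indicator {0..} (0 + l * t) * ((0 + l * t) powr (a - 1) / exp (0 + l * t))) (Gamma a /\<^sub>R \<bar>l\<bar>)"
    using l by (subst (asm) lborel_has_bochner_integral_real_affine_iff[of l _ _ 0]) auto
  then have "has_bochner_integral lborel
      (\<lambda>t. l powr (1 - a) * (indicator {0..} (0 + l * t) * ((0 + l * t) powr (a - 1) / exp (0 + l * t))))
      (l powr (1 - a) * (Gamma a /\<^sub>R \<bar>l\<bar>))"
    by (intro has_bochner_integral_mult_right)
  moreover have "l powr (1 - a) * (indicator {0..} (0 + l * t) * ((0 + l * t) powr (a - 1) / exp (0 + l * t)))
      = damped l t (t powr (a - 1))" for t
  proof (cases "t \<ge> 0")
    case True
    have "l powr (1 - a) * l powr (a - 1) = 1" using l by (simp flip: powr_add)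
    with True l show ?thesis by (simp add: powr_mult exp_minus field_simps)
  next
    case False
    then show ?thesis using l by (simp add: indicator_def zero_le_mult_iff)
  qed
  moreover have "l powr (1 - a) * (Gamma a /\<^sub>R \<bar>l\<bar>) = Gamma a * l powr (- a)"
    using l by (simp add: powr_diff powr_minus field_simps)
  ultimately show ?thesis by (simp only:)
qed

lemma integrable_exp_powr:
  assumes "-1 < m" "0 < (l::real)"
  shows "integrable lborel (\<lambda>t. damped l t (t powr m))"
  using laplace_powr[of "m + 1" l] assms by (simp add: has_bochner_integral_iff)

text \<open>The kernel is \<open>(t/s) powr (\<nu>/2) * J\<^sub>\<nu> (2 \<surd>(t s))\<close>, whose Laplace transform in \<open>t\<close> intertwines
  the Laplace variables \<open>\<lambda>\<close> and \<open>1 / \<lambda>\<close>.\<close>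

definition inv_kernel :: "real \<Rightarrow> real \<Rightarrow> real \<Rightarrow> real" where
  "inv_kernel \<nu> t s = t powr \<nu> * bessel_clifford \<nu> (t * s)"

text \<open>Integration term by term: the transform of \<open>t powr (\<nu> + k)\<close> carries
  exactly the Gamma value in the denominator of \<open>bc_coeff\<close>, so an exponential series in
  \<open>- s / l\<close> remains. The absolute values sum to the same series in
  \<open>s / l\<close>, which justifies the interchange.\<close>

lemma laplace_inv_kernel:
  assumes \<nu>: "0 \<le> \<nu>" and l: "0 < l" and s: "0 \<le> s"
  shows "(\<integral>t. damped l t (inv_kernel \<nu> t s) \<partial>lborel)
    = l powr (- \<nu> - 1) * exp (- s / l)"
proof -
  define f where "f k t = bc_coeff \<nu> k * s ^ k * (damped l t (t powr (\<nu> + real k)))" for k t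
  have f: "has_bochner_integral lborel (f k) (bc_coeff \<nu> k * s ^ k * (Gamma (\<nu> + real k + 1) * l powr (- (\<nu> + real k + 1))))" for k
    unfolding f_def using laplace_powr[of "\<nu> + real k + 1" l] \<nu> l
    by (intro has_bochner_integral_mult_right) simp
  have f_abs: "has_bochner_integral lborel (\<lambda>t. norm (f k t))
      (\<bar>bc_coeff \<nu> k\<bar> * s ^ k * (Gamma (\<nu> + real k + 1) * l powr (- (\<nu> + real k + 1))))" for k
  proof -
    have "norm (f k t) = \<bar>bc_coeff \<nu> k\<bar> * s ^ k * (damped l t (t powr (\<nu> + real k)))" for t
      using s by (simp add: f_def abs_mult indicator_def)
    then show ?thesis
      using laplace_powr[of "\<nu> + real k + 1" l] \<nu> l
      by (auto intro!: has_bochner_integral_mult_right)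
  qed
  have val: "Gamma (\<nu> + real k + 1) * l powr (- (\<nu> + real k + 1)) / (fact k * Gamma (\<nu> + real k + 1))
      = l powr (- \<nu> - 1) * (1 / l) ^ k /\<^sub>R fact k" for k
  proof -
    have "0 < \<nu> + real k + 1" using \<nu> by simp
    then have "Gamma (\<nu> + real k + 1) \<noteq> 0" using Gamma_real_pos less_irrefl by metis
    moreover have "l powr (- (\<nu> + real k + 1)) = l powr (- \<nu> - 1) * (1 / l) ^ k"
    proof -
      have "- (\<nu> + real k + 1) = (- \<nu> - 1) + - real k" by simp
      then have "l powr (- (\<nu> + real k + 1)) = l powr (- \<nu> - 1) * l powr (- real k)"
        by (simp only: powr_add)
      then show ?thesis
        using l by (simp add: powr_minus powr_realpow power_divide inverse_eq_divide)
    qed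
    ultimately show ?thesis by (simp add: field_simps)
  qed
  have sums: "(\<lambda>k. l powr (- \<nu> - 1) * (x ^ k /\<^sub>R fact k)) sums (l powr (- \<nu> - 1) * exp x)" for x
    by (intro sums_mult exp_converges)
  have f_val: "integral\<^sup>L lborel (f k) = l powr (- \<nu> - 1) * ((- s / l) ^ k /\<^sub>R fact k)" for k
  proof -
    have "integral\<^sup>L lborel (f k) = (- 1) ^ k * s ^ k *
        (Gamma (\<nu> + real k + 1) * l powr (- (\<nu> + real k + 1)) / (fact k * Gamma (\<nu> + real k + 1)))"
      using has_bochner_integral_integral_eq[OF f] by (simp add: bc_coeff_def)
    also have "\<dots> = l powr (- \<nu> - 1) * ((- s / l) ^ k /\<^sub>R fact k)"
    proof -
      have "(- s / l) ^ k = (- 1) ^ k * s ^ k * (1 / l) ^ k"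
        by (simp flip: power_mult_distrib)
      then show ?thesis unfolding val by simp
    qed
    finally show ?thesis .
  qed
  have abs_val: "(\<integral>t. norm (f k t) \<partial>lborel) = l powr (- \<nu> - 1) * ((s / l) ^ k /\<^sub>R fact k)" for k
  proof -
    have "(\<integral>t. norm (f k t) \<partial>lborel) = s ^ k *
        (Gamma (\<nu> + real k + 1) * l powr (- (\<nu> + real k + 1)) / (fact k * Gamma (\<nu> + real k + 1)))"
      using has_bochner_integral_integral_eq[OF f_abs] by (simp add: abs_bc_coeff[OF \<nu>])
    also have "\<dots> = l powr (- \<nu> - 1) * ((s / l) ^ k /\<^sub>R fact k)"
      unfolding val by (simp add: power_divide field_simps)
    finally show ?thesis .
  qed
  have f_pt: "f k t = (indicator {0..} t * exp (- l * t) * t powr \<nu>) * (bc_coeff \<nu> k * (t * s) ^ k)" for k t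
  proof (cases "t > 0")
    case True
    then show ?thesis by (simp add: f_def powr_add powr_realpow power_mult_distrib)
  next
    case False
    show ?thesis
      using False by (cases "t = 0") (auto simp: f_def)
  qed
  have summ: "summable (\<lambda>k. norm (f k t))" for t
    using summable_mult[OF summable_bc_norm[OF \<nu>, of "t * s"], of "\<bar>indicator {0..} t * exp (- l * t) * t powr \<nu>\<bar>"]
    by (simp add: f_pt abs_mult mult_ac)
  have "(\<integral>t. (\<Sum>k. f k t) \<partial>lborel) = (\<Sum>k. integral\<^sup>L lborel (f k))"
  proof (rule integral_suminf)
    show "integrable lborel (f k)" for k using f has_bochner_integral_iff by blast
    show "summable (\<lambda>k. \<integral>t. norm (f k t) \<partial>lborel)"
      unfolding abs_val using sums by (rule sums_summable)
  qed (use summ in simp)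
  also have "(\<Sum>k. integral\<^sup>L lborel (f k)) = l powr (- \<nu> - 1) * exp (- s / l)"
    unfolding f_val using sums by (rule sums_unique[symmetric])
  finally have "(\<integral>t. (\<Sum>k. f k t) \<partial>lborel) = l powr (- \<nu> - 1) * exp (- s / l)" .
  moreover have "(\<Sum>k. f k t) = damped l t (inv_kernel \<nu> t s)" for t
    unfolding f_pt by (subst suminf_mult[OF summable_bc[OF \<nu>]])
      (simp add: inv_kernel_def bessel_clifford_def)
  ultimately show ?thesis by (simp only:)
qed

section \<open>Convolution and injectivity of the Laplace transform\<close>

lemma has_bochner_integral_convolution:
  fixes a b :: "real \<Rightarrow> real"
  assumes a: "integrable lborel a" and b: "integrable lborel b"
  shows "has_bochner_integral lborel (\<lambda>t. \<integral>s. a (t - s) * b s \<partial>lborel)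
    (integral\<^sup>L lborel a * integral\<^sup>L lborel b)"
proof -
  have [measurable]: "a \<in> borel_measurable borel" "b \<in> borel_measurable borel"
    using a b by auto
  have shift: "integrable lborel (\<lambda>t. a (t - s))" "(\<integral>t. a (t - s) \<partial>lborel) = integral\<^sup>L lborel a"
    "(\<integral>t. \<bar>a (t - s)\<bar> \<partial>lborel) = (\<integral>t. \<bar>a t\<bar> \<partial>lborel)" for s
    using lborel_integrable_real_affine[OF a, of 1 "- s"] lborel_integral_real_affine[of 1 a "- s"]
      lborel_integral_real_affine[of 1 "\<lambda>t. \<bar>a t\<bar>" "- s"] by auto
  have int: "integrable (lborel \<Otimes>\<^sub>M lborel) (\<lambda>(s, t). a (t - s) * b s)"
  proof (rule lborel_pair.Fubini_integrable)
    show "integrable lborel (\<lambda>s. \<integral>t. norm (case (s, t) of (s, t) \<Rightarrow> a (t - s) * b s) \<partial>lborel)"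
      using b by (simp add: abs_mult shift)
    show "AE s in lborel. integrable lborel (\<lambda>t. case (s, t) of (s, t) \<Rightarrow> a (t - s) * b s)"
      using shift(1) by simp
  qed measurable
  have "integrable lborel (\<lambda>t. \<integral>s. a (t - s) * b s \<partial>lborel)"
    using lborel_pair.integrable_snd[OF int] .
  moreover have "(\<integral>t. (\<integral>s. a (t - s) * b s \<partial>lborel) \<partial>lborel) = integral\<^sup>L lborel a * integral\<^sup>L lborel b"
    using lborel_pair.Fubini_integral[OF int] by (simp add: shift)
  ultimately show ?thesis by (simp add: has_bochner_integral_iff)
qed

lemma continuous_on_extend_half_line:
  fixes F :: "real \<Rightarrow> real"
  assumes "continuous_on {0..} F"
  shows "continuous_on UNIV (\<lambda>t. F (max 0 t))"
  by (rule continuous_on_compose2[OF assms]) (auto intro!: continuous_intros)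

lemma borel_measurable_half_line:
  fixes F :: "real \<Rightarrow> real"
  assumes "continuous_on {0..} F"
  shows "(\<lambda>t. indicator {0..} t * F t) \<in> borel_measurable borel"
proof -
  have "(\<lambda>t. indicator {0..} t * F (max 0 t)) \<in> borel_measurable borel"
    using borel_measurable_continuous_onI[OF continuous_on_extend_half_line[OF assms]] by measurable
  moreover have "indicator {0..} t * F (max 0 t) = indicator {0..} t * F t" for t
    by (simp add: indicator_def max_def)
  ultimately show ?thesis by simp
qed

text \<open>Lerch's theorem: with \<open>x = exp (- t)\<close> the hypothesis says that all moments vanish.\<close>

theorem laplace_eq_zero_imp_zero:
  fixes F :: "real \<Rightarrow> real"
  assumes cont: "continuous_on {0..} F" and bound: "\<And>t. 0 \<le> t \<Longrightarrow> \<bar>F t\<bar> \<le> B * exp t"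
    and zero: "\<And>l. 0 < l \<Longrightarrow> 2 \<le> l \<Longrightarrow> (\<integral>t. damped l t (F t) \<partial>lborel) = 0"
    and t: "0 < t"
  shows "F t = 0"
proof -
  have B: "0 \<le> B" using bound[of 0] by simp
  \<comment> \<open>The exponent 2 beats the growth \<open>exp t\<close> of \<open>F\<close> with
    one factor \<open>exp (- t)\<close> to spare. That factor makes \<open>f\<close> integrable, and
    it makes \<open>G\<close> continuous at 0 with value 0.\<close>
  define f where "f t = damped 2 t (F t)" for t
  have f_meas [measurable]: "f \<in> borel_measurable borel"
    unfolding f_def using cont by (intro borel_measurable_half_line continuous_intros)
  have f_bound: "\<bar>f t\<bar> \<le> B * (indicator {0..} t * exp (- t))" for t
  proof (cases "0 \<le> t")
    case True
    have "exp (- 2 * t) * \<bar>F t\<bar> \<le> exp (- 2 * t) * (B * exp t)"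
      using bound[OF True] by (intro mult_left_mono) auto
    also have "\<dots> = B * exp (- t)" by (simp flip: exp_add)
    finally show ?thesis using True by (simp add: f_def abs_mult)
  qed (simp add: f_def)
  \<comment> \<open>\<open>t powr 0\<close> equals 1 except at \<open>t = 0\<close>, hence the null
    set \<open>{0}\<close>.\<close>
  have int_exp: "integrable lborel (\<lambda>t::real. indicator {0..} t * exp (- t))"
    using integrable_exp_powr[of 0 1]
    by (rule integrable_cong_AE_imp) (auto intro!: AE_I[where N = "{0}"])
  have f_int: "integrable lborel f"
    using f_bound B
    by (intro integrable_dominated[OF integrable_mult_right[OF int_exp, of B]] AE_I2)
      (simp_all add: abs_mult)
  define G where "G x = (if x \<le> 0 then 0 else x ^ 2 * F (- ln x))" for x :: real
  have G_exp: "indicator {0..} t * G (exp (- t)) = f t" for t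
    by (simp add: G_def f_def power2_eq_square flip: exp_add)
  have G_cont: "continuous_on {0..1} G"
    unfolding continuous_on_eq_continuous_within
  proof
    fix x :: real assume x: "x \<in> {0..1}"
    show "continuous (at x within {0..1}) G"
    proof (cases "x = 0")
      case True
      have "(G \<longlongrightarrow> 0) (at 0 within {0..1})"
      proof (rule Lim_null_comparison)
        show "\<forall>\<^sub>F x in at 0 within {0..1}. norm (G x) \<le> B * x"
          unfolding eventually_at_filter
        proof (intro always_eventually allI impI)
          fix x :: real assume x: "x \<noteq> 0" "x \<in> {0..1}"
          then have "\<bar>F (- ln x)\<bar> \<le> B * exp (- ln x)"
            by (intro bound) auto
          then have "x\<^sup>2 * \<bar>F (- ln x)\<bar> \<le> x\<^sup>2 * (B * exp (- ln x))"
            by (intro mult_left_mono) auto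
          also have "\<dots> = B * x"
            using x by (simp add: exp_minus power2_eq_square)
          finally show "norm (G x) \<le> B * x" using x by (simp add: G_def abs_mult)
        qed
        have "((\<lambda>x. B * x) \<longlongrightarrow> B * 0) (at 0 within {0..1})"
          by (intro tendsto_intros)
        then show "((\<lambda>x. B * x) \<longlongrightarrow> 0) (at 0 within {0..1})" by simp
      qed
      then show ?thesis using True by (simp add: continuous_within G_def)
    next
      case False
      have "continuous_on {0<..1} (\<lambda>x. x ^ 2 * F (- ln x))"
        by (intro continuous_intros continuous_on_compose2[OF cont]) auto
      then have "continuous_on {0<..1} G"
        by (rule continuous_on_cong[THEN iffD1, rotated 2]) (auto simp: G_def)
      then have "continuous (at x within {0<..1}) G"
        using x False by (simp add: continuous_on_eq_continuous_within)
      moreover have "at x within {0<..1} = at x within {0..1}"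
        using x False by (intro at_within_nhd[of x "{0<..}"]) auto
      ultimately show ?thesis by (simp add: continuous_within)
    qed
  qed
  have poly: "(\<integral>t. f t * P (exp (- t)) \<partial>lborel) = 0" "integrable lborel (\<lambda>t. f t * P (exp (- t)))"
    if pf: "real_polynomial_function P" for P
  proof -
    obtain a n where P: "P = (\<lambda>x. \<Sum>i\<le>n. a i * x ^ i)"
      using iffD1[OF real_polynomial_function_iff_sum pf] by blast
    have term_int: "integrable lborel (\<lambda>t. f t * exp (- t) ^ i)" for i
    proof (rule integrable_dominated[OF f_int])
      show "AE t in lborel. norm (f t * exp (- t) ^ i) \<le> norm (f t)"
        by (intro AE_I2) (auto simp: f_def abs_mult indicator_def intro!: mult_right_le_one_le power_le_one mult_nonneg_nonneg)
    qed measurable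
    have term_zero: "(\<integral>t. f t * exp (- t) ^ i \<partial>lborel) = 0" for i
    proof -
      have "f t * exp (- t) ^ i = indicator {0..} t * (exp (- (2 + real i) * t) * F t)" for t
        by (simp add: f_def flip: exp_of_nat_mult exp_add) (simp add: algebra_simps)
      then show ?thesis using zero[of "2 + real i"] by simp
    qed
    have eq: "f t * P (exp (- t)) = (\<Sum>i\<le>n. a i * (f t * exp (- t) ^ i))" for t
      by (simp add: P sum_distrib_left mult_ac)
    show "integrable lborel (\<lambda>t. f t * P (exp (- t)))"
      unfolding eq by (intro Bochner_Integration.integrable_sum integrable_mult_right term_int)
    show "(\<integral>t. f t * P (exp (- t)) \<partial>lborel) = 0"
      unfolding eq using term_int term_zero
      by (subst Bochner_Integration.integral_sum) auto
  qed
  have ff_int: "integrable lborel (\<lambda>t. f t * f t)"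
  proof (rule integrable_dominated[OF integrable_mult_right[OF f_int, of B]])
    show "AE t in lborel. norm (f t * f t) \<le> norm (B * f t)"
    proof (intro AE_I2)
      fix t
      have "B * (indicator {0..} t * exp (- t)) \<le> B * 1"
        using B by (intro mult_left_mono) (auto simp: indicator_def)
      with f_bound[of t] have "\<bar>f t\<bar> \<le> B * 1" by (rule order_trans)
      then have "\<bar>f t\<bar> * \<bar>f t\<bar> \<le> B * \<bar>f t\<bar>"
        by (intro mult_right_mono) auto
      then show "norm (f t * f t) \<le> norm (B * f t)" using B by (simp add: abs_mult)
    qed
  qed measurable
  \<comment> \<open>\<open>f\<close> is orthogonal to every polynomial in \<open>exp (- t)\<close>
    and \<open>f t = G (exp (- t))\<close>. Subtracting from one factor of \<open>f t * f t\<close>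
    a polynomial close to \<open>G\<close> leaves the integral unchanged and makes it small.\<close>
  have small: "(\<integral>t. f t * f t \<partial>lborel) \<le> e * (\<integral>t. \<bar>f t\<bar> \<partial>lborel)" if e: "e > 0" for e
  proof -
    obtain P where P: "real_polynomial_function P" "\<And>x. x \<in> {0..1} \<Longrightarrow> \<bar>G x - P x\<bar> < e"
      using Stone_Weierstrass_real_polynomial_function[OF compact_Icc G_cont e] by blast
    have "(\<integral>t. f t * f t \<partial>lborel) = (\<integral>t. f t * f t - f t * P (exp (- t)) \<partial>lborel)"
      using poly[OF P(1)] ff_int by simp
    also have "\<dots> \<le> (\<integral>t. e * \<bar>f t\<bar> \<partial>lborel)"
    proof (rule integral_mono)
      show "integrable lborel (\<lambda>t. f t * f t - f t * P (exp (- t)))"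
        using poly[OF P(1)] ff_int by simp
      show "integrable lborel (\<lambda>t. e * \<bar>f t\<bar>)" using f_int by simp
      fix t
      show "f t * f t - f t * P (exp (- t)) \<le> e * \<bar>f t\<bar>"
      proof (cases "0 \<le> t")
        case True
        then have "\<bar>f t - P (exp (- t))\<bar> \<le> e"
          using P(2)[of "exp (- t)"] G_exp[of t] by simp
        then have "\<bar>f t\<bar> * \<bar>f t - P (exp (- t))\<bar> \<le> \<bar>f t\<bar> * e"
          by (intro mult_left_mono) auto
        then have "\<bar>f t * f t - f t * P (exp (- t))\<bar> \<le> e * \<bar>f t\<bar>"
          by (simp add: abs_mult mult.commute flip: right_diff_distrib)
        then show ?thesis by linarith
      qed (simp add: f_def)
    qed
    finally show ?thesis by simp
  qed
  have "(\<integral>t. f t * f t \<partial>lborel) \<le> 0"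
  proof (rule field_le_epsilon)
    fix e :: real assume "e > 0"
    define A where "A = (\<integral>t. \<bar>f t\<bar> \<partial>lborel)"
    have A: "0 \<le> A" by (simp add: A_def)
    have "0 < e / (A + 1)" using A \<open>e > 0\<close> by simp
    then have "(\<integral>t. f t * f t \<partial>lborel) \<le> e / (A + 1) * A"
      using small unfolding A_def by blast
    also have "\<dots> \<le> e" using A \<open>e > 0\<close> by (simp add: field_simps)
    finally show "(\<integral>t. f t * f t \<partial>lborel) \<le> 0 + e" by simp
  qed
  moreover have "0 \<le> (\<integral>t. f t * f t \<partial>lborel)" by (intro Bochner_Integration.integral_nonneg) simp
  ultimately have "(\<integral>t. f t * f t \<partial>lborel) = 0" by simp
  then have AE0: "AE t in lborel. f t * f t = 0"
    using integral_nonneg_eq_0_iff_AE[OF ff_int] by simp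
  \<comment> \<open>The zero set is closed by continuity, so vanishing almost everywhere on an open
    set becomes vanishing everywhere on it.\<close>
  have "t \<in> {t. F (max 0 t) = 0}"
  proof (rule mem_closed_if_AE_lebesgue_open[of "{0<..}"])
    show "closed {t. F (max 0 t) = 0}"
      by (intro closed_Collect_eq continuous_on_extend_half_line[OF cont] continuous_intros)
    have "AE t in lebesgue. f t * f t = 0"
      using AE0 by (rule AE_completion)
    then show "AE t \<in> {0<..} in lebesgue. t \<in> {t. F (max 0 t) = 0}"
      by eventually_elim (auto simp: f_def)
  qed (use t in auto)
  then show ?thesis using t by simp
qed

section \<open>Measurability, growth and integrability on the half-line\<close>

lemma borel_measurable_product_on_interval:
  fixes k F :: "real \<Rightarrow> real"
  assumes k [measurable]: "k \<in> borel_measurable borel" and F: "continuous_on {0..} F"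
  shows "(\<lambda>s. indicator {0..t} s * (k s * F s)) \<in> borel_measurable borel"
proof -
  have [measurable]: "(\<lambda>s. indicator {0..} s * F s) \<in> borel_measurable borel"
    by (rule borel_measurable_half_line[OF F])
  have "(\<lambda>s. indicator {0..t} s * (k s * (indicator {0..} s * F s))) \<in> borel_measurable borel"
    by measurable
  moreover have "(\<lambda>s. indicator {0..t} s * (k s * (indicator {0..} s * F s)))
      = (\<lambda>s. indicator {0..t} s * (k s * F s))"
    by (auto simp: indicator_def fun_eq_iff)
  ultimately show ?thesis by (simp only:)
qed

lemma powr_le_exp:
  fixes m :: real
  assumes m: "0 \<le> m"
  obtains c where "0 \<le> c" "\<And>t :: real. 0 \<le> t \<Longrightarrow> t powr m \<le> c * exp t"
proof (cases "m = 0")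
  case True
  have "t powr m \<le> 1 * exp t" if "0 \<le> t" for t :: real
    using True that by (cases "t = 0") auto
  then show thesis using that[of 1] by simp
next
  case False
  with m have m: "m > 0" by simp
  show thesis
  \<comment> \<open>The constant arises from raising \<open>t / m \<le> exp (t / m)\<close> to the
    power \<open>m\<close>.\<close>
  proof (rule that[of "m powr m"])
    fix t :: real assume t: "0 \<le> t"
    have "t / m \<le> exp (t / m)"
      using exp_ge_add_one_self[of "t / m"] by linarith
    then have "(t / m) powr m \<le> exp (t / m) powr m"
      using m t by (intro powr_mono2) auto
    then show "t powr m \<le> m powr m * exp t"
      using m t by (simp add: powr_divide powr_def[of "exp _"] field_simps)
  qed simp
qed

lemma integrable_one_plus_powr:
  fixes e :: real
  assumes e: "e < - 1"
  shows "integrable lborel (\<lambda>s. indicator {0..} s * (1 + s) powr e)"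
proof -
  have "has_bochner_integral lborel (\<lambda>s. indicator {1..} s * s powr e) (- (1 powr (e + 1)) / (e + 1))"
    by (rule set_integrable_has_integral_nonneg[OF has_integral_powr_to_inf[OF e]]) auto
  then have "integrable lborel (\<lambda>s. indicator {1..} s * s powr e)"
    by (simp add: has_bochner_integral_iff)
  from lborel_integrable_real_affine[OF this, of 1 1] show ?thesis
    by (simp add: indicator_def cong: if_cong)
qed

lemma borel_measurable_bessel_clifford:
  "0 \<le> \<nu> \<Longrightarrow> bessel_clifford \<nu> \<in> borel_measurable borel"
  by (intro borel_measurable_continuous_onI continuous_on_bessel_clifford)

section \<open>Pointwise bounds and weighted moments of the kernel\<close>

abbreviation (input) kernel_weight :: "real \<Rightarrow> real \<Rightarrow> real \<Rightarrow> real \<Rightarrow> real" where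
  "kernel_weight \<nu> \<beta> t s \<equiv> indicator {0..} s * (\<bar>inv_kernel \<nu> t s\<bar> * s powr \<beta>)"

abbreviation (input) kernel_diff :: "real \<Rightarrow> real \<Rightarrow> real \<Rightarrow> real \<Rightarrow> real \<Rightarrow> real" where
  "kernel_diff \<nu> \<beta> t r s \<equiv>
     indicator {0..} s * (\<bar>inv_kernel \<nu> t s - inv_kernel \<nu> r s\<bar> * s powr \<beta>)"

abbreviation (input) inv_integrand :: "real \<Rightarrow> (real \<Rightarrow> real) \<Rightarrow> real \<Rightarrow> real \<Rightarrow> real" where
  "inv_integrand \<nu> \<sigma> t s \<equiv> inv_kernel \<nu> t s * (indicator {0..} s * \<sigma> s)"

abbreviation (input) inv_transform :: "real \<Rightarrow> (real \<Rightarrow> real) \<Rightarrow> real \<Rightarrow> real" where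
  "inv_transform \<nu> \<sigma> t \<equiv> \<integral>s. inv_integrand \<nu> \<sigma> t s \<partial>lborel"

lemma inv_kernel_zero [simp]: "inv_kernel \<nu> 0 s = 0"
  by (simp add: inv_kernel_def)

text \<open>For \<open>t \<ge> a\<close> one has \<open>1 + t * s \<ge> c * (1 + s)\<close> with
  \<open>c = min 1 a\<close>, so one multiple of \<open>bc_decay \<nu> s\<close> dominates the
  kernel for all \<open>t\<close> in a compact range away from 0. This is the majorant for
  continuity in \<open>t\<close>.\<close>

lemma inv_kernel_bound:
  assumes \<nu>: "1 / 2 \<le> \<nu>" and a: "0 < a"
  obtains K where "0 \<le> K"
    "\<And>t s. a \<le> t \<Longrightarrow> t \<le> b \<Longrightarrow> 0 \<le> s \<Longrightarrow> \<bar>inv_kernel \<nu> t s\<bar> \<le> K * bc_decay \<nu> s"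
proof -
  define e where "e = - \<nu> / 2 - 1 / 4"
  have e: "e < 0" using \<nu> by (simp add: e_def)
  obtain B where B: "B > 0" "\<And>x. 0 \<le> x \<Longrightarrow> \<bar>bessel_clifford \<nu> x\<bar> \<le> B * (1 + x) powr e"
    by (rule bessel_clifford_decay[OF \<nu>, folded e_def]) blast
  define c where "c = min 1 a"
  have c: "0 < c" "c \<le> 1" "c \<le> a" using a by (auto simp: c_def)
  show thesis
  proof (rule that[of "b powr \<nu> * (B * c powr e)"])
    show "0 \<le> b powr \<nu> * (B * c powr e)" using B(1) by simp
    fix t s :: real assume t: "a \<le> t" "t \<le> b" and s: "0 \<le> s"
    have "c * (1 + s) \<le> 1 + t * s"
      using c t s mult_right_mono[of c t s] by (simp add: algebra_simps)
    then have "(1 + t * s) powr e \<le> (c * (1 + s)) powr e"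
      using c s e by (intro powr_mono2') auto
    then have "(1 + t * s) powr e \<le> c powr e * (1 + s) powr e"
      using c s by (simp add: powr_mult)
    then have "\<bar>bessel_clifford \<nu> (t * s)\<bar> \<le> B * (c powr e * (1 + s) powr e)"
      using B(2)[of "t * s"] B(1) t a s
      by (meson mult_left_mono less_imp_le order_trans mult_nonneg_nonneg less_le_trans)
    moreover have "t powr \<nu> \<le> b powr \<nu>"
      using t a \<nu> by (intro powr_mono2) auto
    ultimately have "t powr \<nu> * \<bar>bessel_clifford \<nu> (t * s)\<bar> \<le> b powr \<nu> * (B * (c powr e * (1 + s) powr e))"
      by (intro mult_mono) auto
    then show "\<bar>inv_kernel \<nu> t s\<bar> \<le> b powr \<nu> * (B * c powr e) * bc_decay \<nu> s"
      by (simp add: inv_kernel_def abs_mult e_def mult_ac)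
  qed
qed

text \<open>The product decays with exponent \<open>- \<nu> / 2 - 1 / 4 + \<beta>\<close>, which
  lies below \<open>- 1\<close> exactly when \<open>\<nu> > 2 * \<beta> + 3 / 2\<close>. For
  \<open>\<nu> = \<gamma> + \<beta> + 1\<close> this is the condition
  \<open>\<gamma> > \<beta> + 1 / 2\<close>.\<close>

lemma bessel_clifford_moment:
  assumes \<beta>: "0 \<le> \<beta>" and \<nu>: "2 * \<beta> + 3 / 2 < \<nu>"
  shows "integrable lborel (\<lambda>r. indicator {0..} r * (\<bar>bessel_clifford \<nu> r\<bar> * r powr \<beta>))"
proof -
  let ?w = "\<lambda>s. indicator {0..} s * (1 + s) powr (- \<nu> / 2 - 1 / 4 + \<beta>)"
  have \<nu>2: "1 / 2 \<le> \<nu>" using assms by simp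
  obtain B where B: "B > 0" "\<And>x. 0 \<le> x \<Longrightarrow> \<bar>bessel_clifford \<nu> x\<bar> \<le> B * bc_decay \<nu> x"
    by (rule bessel_clifford_decay[OF \<nu>2]) blast
  have int: "integrable lborel (\<lambda>s. B * ?w s)"
    using \<nu> by (intro integrable_mult_right integrable_one_plus_powr) simp
  show ?thesis
  proof (rule integrable_dominated[OF int])
    show "(\<lambda>r. indicator {0..} r * (\<bar>bessel_clifford \<nu> r\<bar> * r powr \<beta>)) \<in> borel_measurable lborel"
    proof -
      have [measurable]: "bessel_clifford \<nu> \<in> borel_measurable borel"
        using \<nu>2 by (intro borel_measurable_bessel_clifford) simp
      show ?thesis by measurable
    qed
    show "AE r in lborel. norm (indicator {0..} r * (\<bar>bessel_clifford \<nu> r\<bar> * r powr \<beta>))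
      \<le> norm (B * ?w r)"
    proof (intro AE_I2)
      fix r :: real
      have "\<bar>bessel_clifford \<nu> r\<bar> * r powr \<beta> \<le> (B * (1 + r) powr (- \<nu> / 2 - 1 / 4)) * (1 + r) powr \<beta>" if "0 \<le> r"
        using that B \<beta> by (intro mult_mono powr_mono2) auto
      then show "norm (indicator {0..} r * (\<bar>bessel_clifford \<nu> r\<bar> * r powr \<beta>))
        \<le> norm (B * ?w r)"
        using B(1) by (simp add: abs_mult indicator_def powr_add mult_ac)
    qed
  qed
qed

text \<open>Substituting \<open>r = t * s\<close> takes all dependence on \<open>t\<close> outside:
  \<open>\<nu>\<close> from the kernel, \<open>- \<beta>\<close> from the weight, \<open>- 1\<close>
  from the measure. For \<open>\<nu> = \<gamma> + \<beta> + 1\<close> the result is of order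
  \<open>t powr \<gamma>\<close>, the growth wanted for the inverse family.\<close>

lemma inv_kernel_moment:
  assumes \<beta>: "0 \<le> \<beta>" and \<nu>: "2 * \<beta> + 3 / 2 < \<nu>"
  obtains M where "0 \<le> M"
    "\<And>t. 0 < t \<Longrightarrow> has_bochner_integral lborel
       (\<lambda>s. kernel_weight \<nu> \<beta> t s) (M * t powr (\<nu> - \<beta> - 1))"
proof -
  define f where "f r = indicator {0..} r * (\<bar>bessel_clifford \<nu> r\<bar> * r powr \<beta>)" for r
  define M where "M = integral\<^sup>L lborel f"
  have f: "has_bochner_integral lborel f M"
    using bessel_clifford_moment[OF assms] by (simp add: has_bochner_integral_iff M_def f_def[abs_def])
  show thesis
  proof (rule that)
    show "0 \<le> M"
      unfolding M_def by (intro Bochner_Integration.integral_nonneg) (simp add: f_def)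
    fix t :: real assume t: "0 < t"
    have "has_bochner_integral lborel (\<lambda>s. f (0 + t * s)) (M /\<^sub>R \<bar>t\<bar>)"
      using f t by (subst (asm) lborel_has_bochner_integral_real_affine_iff[of t _ _ 0]) auto
    then have "has_bochner_integral lborel (\<lambda>s. t powr (\<nu> - \<beta>) * f (0 + t * s)) (t powr (\<nu> - \<beta>) * (M /\<^sub>R \<bar>t\<bar>))"
      by (intro has_bochner_integral_mult_right)
    moreover have "t powr (\<nu> - \<beta>) * f (0 + t * s) = kernel_weight \<nu> \<beta> t s" for s
    proof (cases "0 \<le> s")
      case True
      have "t powr (\<nu> - \<beta>) * t powr \<beta> = t powr \<nu>" by (simp flip: powr_add)
      moreover have "0 \<le> t * s" using True t by simp
      moreover have "(t * s) powr \<beta> = t powr \<beta> * s powr \<beta>" using True t by (simp add: powr_mult)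
      ultimately show ?thesis
        using True t by (simp add: f_def inv_kernel_def abs_mult)
    next
      case False
      then show ?thesis using t by (simp add: f_def zero_le_mult_iff)
    qed
    moreover have "t powr (\<nu> - \<beta>) * (M /\<^sub>R \<bar>t\<bar>) = M * t powr (\<nu> - \<beta> - 1)"
      using t powr_diff[of t "\<nu> - \<beta>" 1] by (simp add: divide_inverse mult_ac)
    ultimately show "has_bochner_integral lborel
       (\<lambda>s. kernel_weight \<nu> \<beta> t s) (M * t powr (\<nu> - \<beta> - 1))"
      by (simp only:)
  qed
qed

section \<open>Scalar form of the inversion formula\<close>

text \<open>\<open>\<sigma>\<close> stands for an orbit \<open>\<phi> (S s x)\<close>. Its bound is
  asked for \<open>s > 0\<close> only: if \<open>\<beta> = 0\<close>, the convention
  \<open>0 powr 0 = 0\<close> would force \<open>\<sigma> 0 = 0\<close>.\<close>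

context
  fixes \<beta> \<nu> B :: real and \<sigma> :: "real \<Rightarrow> real"
  assumes \<beta>: "0 \<le> \<beta>" and \<nu>: "2 * \<beta> + 3 / 2 < \<nu>"
    and \<sigma>: "continuous_on {0..} \<sigma>" and \<sigma>_bound: "\<And>s. 0 < s \<Longrightarrow> \<bar>\<sigma> s\<bar> \<le> B * s powr \<beta>"
begin

lemma source_measurable [measurable]: "(\<lambda>s. indicator {0..} s * \<sigma> s) \<in> borel_measurable borel"
  by (rule borel_measurable_half_line[OF \<sigma>])

lemma source_bound_nonneg: "0 \<le> B"
  using \<sigma>_bound[of 1] by simp

lemma inv_integrand_integrable:
  assumes t: "0 < t"
  shows "integrable lborel (\<lambda>s. inv_integrand \<nu> \<sigma> t s)"
    (is "integrable _ ?f")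
  and "(\<integral>s. \<bar>inv_integrand \<nu> \<sigma> t s\<bar> \<partial>lborel)
    \<le> B * (\<integral>s. kernel_weight \<nu> \<beta> t s \<partial>lborel)" (is ?bound)
proof -
  obtain M where M: "0 \<le> M" "\<And>t. 0 < t \<Longrightarrow> has_bochner_integral lborel
       (\<lambda>s. kernel_weight \<nu> \<beta> t s) (M * t powr (\<nu> - \<beta> - 1))"
    by (rule inv_kernel_moment[OF \<beta> \<nu>]) blast
  then have int: "integrable lborel (\<lambda>s. B * kernel_weight \<nu> \<beta> t s)"
    using M(2)[OF t] by (intro integrable_mult_right) (simp add: has_bochner_integral_iff)
  have le: "AE s in lborel. \<bar>?f s\<bar> \<le> B * kernel_weight \<nu> \<beta> t s"
  proof (rule AE_mp[OF AE_lborel_singleton[of 0]], intro AE_I2 impI)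
    fix s :: real assume "s \<noteq> 0"
    show "\<bar>?f s\<bar> \<le> B * kernel_weight \<nu> \<beta> t s"
    proof (cases "0 < s")
      case True
      then have "\<bar>inv_kernel \<nu> t s\<bar> * \<bar>\<sigma> s\<bar> \<le> \<bar>inv_kernel \<nu> t s\<bar> * (B * s powr \<beta>)"
        by (intro mult_left_mono \<sigma>_bound) auto
      then show ?thesis using True by (simp add: abs_mult mult_ac)
    qed (use \<open>s \<noteq> 0\<close> in simp)
  qed
  have \<nu>0: "0 \<le> \<nu>" using \<beta> \<nu> by simp
  have meas: "?f \<in> borel_measurable lborel"
    unfolding inv_kernel_def using borel_measurable_bessel_clifford[OF \<nu>0] by measurable
  show f: "integrable lborel ?f"
    using le by (intro integrable_dominated[OF int meas]) (auto elim!: eventually_mono)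
  have "(\<integral>s. \<bar>?f s\<bar> \<partial>lborel) \<le> (\<integral>s. B * kernel_weight \<nu> \<beta> t s \<partial>lborel)"
    using le by (intro integral_mono_AE int integrable_abs f)
  then show ?bound by simp
qed

lemma inv_transform_abs_bound:
  obtains M where "0 \<le> M" "\<And>t. 0 \<le> t \<Longrightarrow>
    (\<integral>s. \<bar>inv_integrand \<nu> \<sigma> t s\<bar> \<partial>lborel) \<le> M * t powr (\<nu> - \<beta> - 1)"
proof -
  obtain M where M: "0 \<le> M" "\<And>t. 0 < t \<Longrightarrow> has_bochner_integral lborel
       (\<lambda>s. kernel_weight \<nu> \<beta> t s) (M * t powr (\<nu> - \<beta> - 1))"
    by (rule inv_kernel_moment[OF \<beta> \<nu>]) blast
  have "(\<integral>s. \<bar>inv_integrand \<nu> \<sigma> t s\<bar> \<partial>lborel) \<le> (B * M) * t powr (\<nu> - \<beta> - 1)"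
    if "0 \<le> t" for t
  proof (cases "t = 0")
    case False
    with that have "0 < t" by simp
    from inv_integrand_integrable(2)[OF this] show ?thesis
      unfolding has_bochner_integral_integral_eq[OF M(2)[OF \<open>0 < t\<close>]] by (simp add: mult.assoc)
  qed simp
  moreover have "0 \<le> B * M"
    using M(1) source_bound_nonneg by simp
  ultimately show thesis by (rule that[rotated])
qed

lemma inv_transform_bound:
  "\<exists>M\<ge>0. \<forall>t\<ge>0. \<bar>inv_transform \<nu> \<sigma> t\<bar> \<le> M * t powr (\<nu> - \<beta> - 1)"
proof -
  obtain M where M: "0 \<le> M" "\<And>t. 0 \<le> t \<Longrightarrow>
      (\<integral>s. \<bar>inv_integrand \<nu> \<sigma> t s\<bar> \<partial>lborel) \<le> M * t powr (\<nu> - \<beta> - 1)"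
    by (rule inv_transform_abs_bound) blast
  show ?thesis
    by (intro exI[of _ M] conjI allI impI M(1) order_trans[OF integral_abs_bound M(2)])
qed

text \<open>Meant for a functional that attains a seminorm of a difference, so one side of the
  inequality is enough. The right-hand side depends on \<open>\<sigma>\<close> only through
  \<open>B\<close>, hence not on the functional.\<close>

lemma inv_transform_difference:
  assumes t: "0 < t" and r: "0 < r"
  shows "inv_transform \<nu> \<sigma> t - inv_transform \<nu> \<sigma> r
    \<le> B * (\<integral>s. kernel_diff \<nu> \<beta> t r s \<partial>lborel)"
proof -
  let ?d = "\<lambda>s. \<bar>inv_kernel \<nu> t s - inv_kernel \<nu> r s\<bar>"
  let ?f = "\<lambda>t s. inv_integrand \<nu> \<sigma> t s"
  obtain M where "0 \<le> M" and M: "\<And>t. 0 < t \<Longrightarrow> has_bochner_integral lborel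
      (\<lambda>s. kernel_weight \<nu> \<beta> t s) (M * t powr (\<nu> - \<beta> - 1))"
    by (rule inv_kernel_moment[OF \<beta> \<nu>]) blast
  have int: "integrable lborel (?f t)" "integrable lborel (?f r)"
    using inv_integrand_integrable(1) t r by auto
  have kint: "integrable lborel (\<lambda>s. kernel_diff \<nu> \<beta> t r s)"
  proof (rule integrable_dominated)
    show "integrable lborel (\<lambda>s. kernel_weight \<nu> \<beta> t s + kernel_weight \<nu> \<beta> r s)"
      using M[OF t] M[OF r] by (simp add: has_bochner_integral_iff)
    have [measurable]: "bessel_clifford \<nu> \<in> borel_measurable borel"
      using \<beta> \<nu> by (intro borel_measurable_bessel_clifford) simp
    show "(\<lambda>s. kernel_diff \<nu> \<beta> t r s) \<in> borel_measurable lborel"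
      unfolding inv_kernel_def by measurable
    show "AE s in lborel. norm (kernel_diff \<nu> \<beta> t r s)
      \<le> norm (kernel_weight \<nu> \<beta> t s + kernel_weight \<nu> \<beta> r s)"
    proof (intro AE_I2)
      fix s :: real
      have "?d s * s powr \<beta>
          \<le> (\<bar>inv_kernel \<nu> t s\<bar> + \<bar>inv_kernel \<nu> r s\<bar>) * s powr \<beta>"
        by (intro mult_right_mono abs_triangle_ineq4) auto
      then show "norm (kernel_diff \<nu> \<beta> t r s)
        \<le> norm (kernel_weight \<nu> \<beta> t s + kernel_weight \<nu> \<beta> r s)"
        by (simp add: indicator_def distrib_right)
    qed
  qed
  have "integral\<^sup>L lborel (?f t) - integral\<^sup>L lborel (?f r) = (\<integral>s. ?f t s - ?f r s \<partial>lborel)"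
    using int by simp
  also have "\<dots> \<le> (\<integral>s. B * kernel_diff \<nu> \<beta> t r s \<partial>lborel)"
  proof (rule integral_mono_AE[OF Bochner_Integration.integrable_diff[OF int] integrable_mult_right[OF kint]])
    show "AE s in lborel. ?f t s - ?f r s \<le> B * kernel_diff \<nu> \<beta> t r s"
    proof (rule AE_mp[OF AE_lborel_singleton[of 0]], intro AE_I2 impI)
      fix s :: real assume "s \<noteq> 0"
      have "(inv_kernel \<nu> t s - inv_kernel \<nu> r s) * \<sigma> s
          \<le> ?d s * (B * s powr \<beta>)" if "0 < s"
      proof -
        have "?d s * \<bar>\<sigma> s\<bar>
            \<le> ?d s * (B * s powr \<beta>)"
          using \<sigma>_bound[OF that] by (intro mult_left_mono) auto
        then show ?thesis
          unfolding abs_mult[symmetric] by (rule order_trans[OF abs_ge_self])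
      qed
      moreover have "?f t s - ?f r s = indicator {0..} s * ((inv_kernel \<nu> t s - inv_kernel \<nu> r s) * \<sigma> s)"
        by (simp add: algebra_simps)
      ultimately show "?f t s - ?f r s \<le> B * kernel_diff \<nu> \<beta> t r s"
        using \<open>s \<noteq> 0\<close> by (cases "0 < s") (simp_all add: mult_ac)
    qed
  qed
  finally show ?thesis by simp
qed

text \<open>Fubini: integrating first over \<open>t\<close> replaces the kernel by
  \<open>exp (- s / l)\<close>, which is the damping of a Laplace transform at \<open>1 / l\<close>.
  Absolute integrability holds because the inner integral of absolute values grows only like a power
  of \<open>t\<close>.\<close>

lemma laplace_inv_transform:
  assumes l: "0 < l"
  shows "has_bochner_integral lborel
    (\<lambda>t. damped l t (inv_transform \<nu> \<sigma> t))
    (l powr (- \<nu> - 1) * (\<integral>s. damped (1 / l) s (\<sigma> s) \<partial>lborel))"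
proof -
  have \<nu>0: "0 \<le> \<nu>" using \<beta> \<nu> by simp
  obtain M where M: "0 \<le> M" "\<And>t. 0 \<le> t \<Longrightarrow>
      (\<integral>s. \<bar>inv_integrand \<nu> \<sigma> t s\<bar> \<partial>lborel) \<le> M * t powr (\<nu> - \<beta> - 1)"
    by (rule inv_transform_abs_bound) blast
  define w where "w t = indicator {0..} t * exp (- l * t)" for t :: real
  have w: "0 \<le> w t" for t by (simp add: w_def)
  let ?h = "\<lambda>t s. w t * (inv_integrand \<nu> \<sigma> t s)"
  have [measurable]: "bessel_clifford \<nu> \<in> borel_measurable borel"
    using \<nu>0 by (rule borel_measurable_bessel_clifford)
  have [measurable]: "(\<lambda>(t, s). ?h t s) \<in> borel_measurable (lborel \<Otimes>\<^sub>M lborel)"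
    unfolding inv_kernel_def w_def by measurable
  have int: "integrable (lborel \<Otimes>\<^sub>M lborel) (\<lambda>(t, s). ?h t s)"
  proof (rule lborel_pair.Fubini_integrable)
    have "integrable lborel (\<lambda>t. M * damped l t (t powr (\<nu> - \<beta> - 1)))"
      using \<beta> \<nu> l by (intro integrable_mult_right integrable_exp_powr) auto
    then show "integrable lborel (\<lambda>t. \<integral>s. norm (case (t, s) of (t, s) \<Rightarrow> ?h t s) \<partial>lborel)"
    proof (rule integrable_dominated)
      show "(\<lambda>t. \<integral>s. norm (case (t, s) of (t, s) \<Rightarrow> ?h t s) \<partial>lborel) \<in> borel_measurable lborel"
        by measurable
      show "AE t in lborel. norm (\<integral>s. norm (case (t, s) of (t, s) \<Rightarrow> ?h t s) \<partial>lborel)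
        \<le> norm (M * damped l t (t powr (\<nu> - \<beta> - 1)))"
      proof (intro AE_I2)
        fix t :: real
        define A where "A = (\<integral>s. \<bar>inv_integrand \<nu> \<sigma> t s\<bar> \<partial>lborel)"
        have eq: "(\<integral>s. norm (case (t, s) of (t, s) \<Rightarrow> ?h t s) \<partial>lborel) = w t * A"
          by (simp only: prod.case real_norm_def abs_mult[of "w t"] abs_of_nonneg[OF w] integral_mult_right_zero A_def)
        have A: "0 \<le> A" unfolding A_def by (intro Bochner_Integration.integral_nonneg) simp
        show "norm (\<integral>s. norm (case (t, s) of (t, s) \<Rightarrow> ?h t s) \<partial>lborel)
          \<le> norm (M * damped l t (t powr (\<nu> - \<beta> - 1)))"
        proof (cases "0 \<le> t")
          case True
          have "w t * A \<le> w t * (M * t powr (\<nu> - \<beta> - 1))"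
            unfolding A_def using True w by (intro mult_left_mono M)
          then show ?thesis
            unfolding eq using M(1) A True by (simp add: w_def abs_mult mult_ac)
        qed (simp add: eq w_def)
      qed
    qed
    show "AE t in lborel. integrable lborel (\<lambda>s. case (t, s) of (t, s) \<Rightarrow> ?h t s)"
    proof (intro AE_I2)
      fix t
      show "integrable lborel (\<lambda>s. case (t, s) of (t, s) \<Rightarrow> ?h t s)"
      proof (cases "0 < t")
        case True
        then show ?thesis using inv_integrand_integrable(1) by simp
      next
        case False
        then have "(\<lambda>s. case (t, s) of (t, s) \<Rightarrow> ?h t s) = (\<lambda>s. 0)"
          by (cases "t = 0") (simp_all add: w_def)
        then show ?thesis by simp
      qed
    qed
  qed measurable
  have "integrable lborel (\<lambda>t. \<integral>s. ?h t s \<partial>lborel)"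
    using lborel_pair.integrable_fst[OF int] .
  moreover have "(\<integral>t. (\<integral>s. ?h t s \<partial>lborel) \<partial>lborel)
    = l powr (- \<nu> - 1) * (\<integral>s. damped (1 / l) s (\<sigma> s) \<partial>lborel)"
  proof -
    have "(\<integral>t. (\<integral>s. ?h t s \<partial>lborel) \<partial>lborel) = (\<integral>s. (\<integral>t. ?h t s \<partial>lborel) \<partial>lborel)"
      by (rule lborel_pair.Fubini_integral[OF int, symmetric])
    also have "\<dots> = (\<integral>s. l powr (- \<nu> - 1) * (damped (1 / l) s (\<sigma> s)) \<partial>lborel)"
    proof (rule Bochner_Integration.integral_cong[OF refl])
      fix s :: real
      have "(\<integral>t. ?h t s \<partial>lborel) = (\<integral>t. indicator {0..} s * \<sigma> s * (damped l t (inv_kernel \<nu> t s)) \<partial>lborel)"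
        by (simp add: w_def mult_ac)
      also have "\<dots> = indicator {0..} s * \<sigma> s * (\<integral>t. damped l t (inv_kernel \<nu> t s) \<partial>lborel)"
        by (rule integral_mult_right_zero)
      also have "\<dots> = l powr (- \<nu> - 1) * (damped (1 / l) s (\<sigma> s))"
        using laplace_inv_kernel[OF \<nu>0 l, of s] by (cases "0 \<le> s") (simp_all add: mult_ac)
      finally show "(\<integral>t. ?h t s \<partial>lborel) = l powr (- \<nu> - 1) * (damped (1 / l) s (\<sigma> s))" .
    qed
    finally show ?thesis by simp
  qed
  ultimately show ?thesis by (simp add: has_bochner_integral_iff w_def mult.assoc)
qed

lemma damped_integrable:
  assumes l: "0 < l"
  shows "integrable lborel (\<lambda>s. damped l s (\<sigma> s))"
proof (rule integrable_dominated)
  show "integrable lborel (\<lambda>s. B * damped l s (s powr \<beta>))"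
    using \<beta> l by (intro integrable_mult_right integrable_exp_powr) auto
  show "(\<lambda>s. damped l s (\<sigma> s)) \<in> borel_measurable lborel"
    using \<sigma> by (simp, intro borel_measurable_half_line continuous_intros) auto
  show "AE s in lborel. norm (damped l s (\<sigma> s)) \<le> norm (B * damped l s (s powr \<beta>))"
  proof (rule AE_mp[OF AE_lborel_singleton[of 0]], intro AE_I2 impI)
    fix s :: real assume "s \<noteq> 0"
    have "exp (- l * s) * \<bar>\<sigma> s\<bar> \<le> exp (- l * s) * (B * s powr \<beta>)" if "0 < s"
      using that by (intro mult_left_mono \<sigma>_bound) auto
    then show "norm (damped l s (\<sigma> s)) \<le> norm (B * damped l s (s powr \<beta>))"
      using \<open>s \<noteq> 0\<close> source_bound_nonneg by (simp add: abs_mult indicator_def mult_ac)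
  qed
qed

end

section \<open>Riemann-Liouville fractional integrals\<close>

abbreviation (input) rl_integrand :: "real \<Rightarrow> real \<Rightarrow> real \<Rightarrow> real \<Rightarrow> real" where
  "rl_integrand \<alpha> t s y \<equiv> indicator {0..t} s * ((t - s) powr (\<alpha> - 1) / Gamma \<alpha> * y)"

definition riemann_liouville :: "real \<Rightarrow> (real \<Rightarrow> real) \<Rightarrow> real \<Rightarrow> real" where
  "riemann_liouville \<alpha> F t = (\<integral>s. rl_integrand \<alpha> t s (F s) \<partial>lborel)"

text \<open>Splitting \<open>exp (- l * t)\<close> as
  \<open>exp (- l * (t - s)) * exp (- l * s)\<close> damps both factors, so that the convolution
  theorem for integrable functions on the line applies.\<close>

lemma riemann_liouville_as_convolution:
  fixes F :: "real \<Rightarrow> real" and s t :: real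
  assumes "0 \<le> t"
  shows "rl_integrand \<alpha> t s (F s) =
    exp (l * t) * ((indicator {0..} (t - s) * (exp (- l * (t - s)) * (t - s) powr (\<alpha> - 1)) / Gamma \<alpha>)
      * (damped l s (F s)))"
proof (cases "0 \<le> s \<and> s \<le> t")
  case True
  have one: "exp (l * t) * (exp (- l * (t - s)) * exp (- l * s)) = 1"
    by (simp add: algebra_simps flip: exp_add)
  show ?thesis using True one by simp
qed (auto simp: indicator_def)

lemma laplace_riemann_liouville:
  assumes \<alpha>: "0 < \<alpha>" and l: "0 < l"
    and F: "integrable lborel (\<lambda>s. damped l s (F s))"
  shows "has_bochner_integral lborel (\<lambda>t. damped l t (riemann_liouville \<alpha> F t))
    (l powr (- \<alpha>) * (\<integral>s. damped l s (F s) \<partial>lborel))"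
proof -
  define a where "a u = damped l u (u powr (\<alpha> - 1)) / Gamma \<alpha>" for u
  define b where "b s = damped l s (F s)" for s
  have "Gamma \<alpha> > 0" using \<alpha> by (rule Gamma_real_pos)
  then have a: "integrable lborel a" "integral\<^sup>L lborel a = l powr (- \<alpha>)"
    using laplace_powr[OF \<alpha> l] unfolding a_def by (simp_all add: has_bochner_integral_iff)
  have eq: "(\<integral>s. a (t - s) * b s \<partial>lborel) = damped l t (riemann_liouville \<alpha> F t)" for t
  proof (cases "0 \<le> t")
    case True
    have "riemann_liouville \<alpha> F t = exp (l * t) * (\<integral>s. a (t - s) * b s \<partial>lborel)"
      unfolding riemann_liouville_def a_def b_def
      by (subst riemann_liouville_as_convolution[OF True, of _ _ _ l]) simp
    then show ?thesis using True by (simp add: exp_minus)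
  next
    case False
    then have "(\<lambda>s. a (t - s) * b s) = (\<lambda>s. 0)" by (auto simp: a_def b_def indicator_def)
    then show ?thesis using False by simp
  qed
  show ?thesis
    using has_bochner_integral_convolution[OF a(1) F[folded b_def]] unfolding eq a(2) by (simp add: b_def)
qed

text \<open>The growth constant survives unchanged: \<open>exp s = exp t * exp (- (t - s))\<close>,
  and the kernel damped by \<open>exp (- u)\<close> has integral 1.\<close>

lemma riemann_liouville_integrable:
  assumes \<alpha>: "0 < \<alpha>" and F: "continuous_on {0..} F" "\<And>s. 0 \<le> s \<Longrightarrow> \<bar>F s\<bar> \<le> B * exp s" and t: "0 \<le> t"
  shows "integrable lborel (\<lambda>s. rl_integrand \<alpha> t s (F s))"
    and "\<bar>riemann_liouville \<alpha> F t\<bar> \<le> B * exp t"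
proof -
  define a where "a u = damped 1 u (u powr (\<alpha> - 1)) / Gamma \<alpha>" for u
  have \<Gamma>: "Gamma \<alpha> > 0" using \<alpha> by (rule Gamma_real_pos)
  then have a: "has_bochner_integral lborel a 1"
    using laplace_powr[OF \<alpha>, of 1] unfolding a_def by (simp add: has_bochner_integral_iff)
  then have "has_bochner_integral lborel (\<lambda>s. a (t - s)) 1"
    using lborel_has_bochner_integral_real_affine_iff[of "-1" a 1 t] by simp
  then have "has_bochner_integral lborel (\<lambda>s. B * exp t * a (t - s)) (B * exp t * 1)"
    by (intro has_bochner_integral_mult_right)
  then have a': "has_bochner_integral lborel (\<lambda>s. B * exp t * a (t - s)) (B * exp t)"
    by simp
  have B: "0 \<le> B" using F(2)[of 0] by simp
  have a_nonneg: "0 \<le> a u" for u using \<Gamma> by (simp add: a_def)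
  have le: "\<bar>rl_integrand \<alpha> t s (F s)\<bar> \<le> B * exp t * a (t - s)" for s
  proof (cases "0 \<le> s \<and> s \<le> t")
    case True
    have "(t - s) powr (\<alpha> - 1) / Gamma \<alpha> * \<bar>F s\<bar> \<le> (t - s) powr (\<alpha> - 1) / Gamma \<alpha> * (B * exp s)"
      using True F(2) \<Gamma> by (intro mult_left_mono) auto
    also have "\<dots> = B * exp t * a (t - s)"
      using True by (simp add: a_def exp_diff)
    finally show ?thesis using True \<Gamma> by (simp add: abs_mult)
  next
    case False
    then show ?thesis using a_nonneg B by (auto simp: indicator_def)
  qed
  have meas: "(\<lambda>s. rl_integrand \<alpha> t s (F s)) \<in> borel_measurable lborel"
    using borel_measurable_product_on_interval[OF _ F(1), of "\<lambda>s. (t - s) powr (\<alpha> - 1) / Gamma \<alpha>" t] by simp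
  show int: "integrable lborel (\<lambda>s. rl_integrand \<alpha> t s (F s))"
  proof (rule integrable_dominated[OF _ meas])
    show "integrable lborel (\<lambda>s. B * exp t * a (t - s))" using a' by (simp add: has_bochner_integral_iff)
    show "AE s in lborel. norm (rl_integrand \<alpha> t s (F s)) \<le> norm (B * exp t * a (t - s))"
      using le by (intro AE_I2) (simp add: order_trans[OF _ abs_ge_self])
  qed
  have "\<bar>riemann_liouville \<alpha> F t\<bar> \<le> (\<integral>s. B * exp t * a (t - s) \<partial>lborel)"
    unfolding riemann_liouville_def using a' le
    by (intro order_trans[OF integral_abs_bound] integral_mono integrable_abs int) (auto simp: has_bochner_integral_iff)
  then show "\<bar>riemann_liouville \<alpha> F t\<bar> \<le> B * exp t"
    unfolding has_bochner_integral_integral_eq[OF a'] .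
qed

lemma riemann_liouville_zero: "riemann_liouville \<alpha> F 0 = 0"
proof -
  have "AE s in lborel. indicator {0..0} s * ((0 - s) powr (\<alpha> - 1) / Gamma \<alpha> * F s) = (0::real)"
    by (rule AE_mp[OF AE_lborel_singleton[of 0]], intro AE_I2) auto
  then show ?thesis
    unfolding riemann_liouville_def by (rule integral_eq_zero_AE)
qed

text \<open>After \<open>s = t * r\<close> the singular kernel no longer depends on
  \<open>t\<close>; only \<open>F (t * r)\<close> does, and dominated convergence with the fixed
  majorant \<open>\<bar>k r\<bar> * D\<close> applies. \<open>F'\<close> extends \<open>F\<close> by
  a constant to have continuity on the whole line.\<close>

lemma continuous_on_riemann_liouville:
  assumes \<alpha>: "0 < \<alpha>" and F: "continuous_on {0..} F"
  shows "continuous_on {0..} (riemann_liouville \<alpha> F)"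
proof -
  define F' where "F' s = F (max 0 s)" for s
  have F': "continuous_on UNIV F'"
    unfolding F'_def by (rule continuous_on_extend_half_line[OF F])
  define k where "k r = indicator {0..1} r * ((1 - r) powr (\<alpha> - 1) / Gamma \<alpha>)" for r :: real
  have k_int: "integrable lborel k"
    using riemann_liouville_integrable(1)[OF \<alpha>, of "\<lambda>_. 1" 1 1] unfolding k_def by simp
  have eq: "riemann_liouville \<alpha> F t = t powr \<alpha> * (\<integral>r. k r * F' (t * r) \<partial>lborel)" if "0 \<le> t" for t
  proof (cases "t = 0")
    case True
    then show ?thesis by (simp add: riemann_liouville_zero)
  next
    case False
    with that have t: "0 < t" by simp
    have pt: "t * (indicator {0..t} (0 + t * r) * ((t - (0 + t * r)) powr (\<alpha> - 1) / Gamma \<alpha> * F (0 + t * r)))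
        = t powr \<alpha> * (k r * F' (t * r))" for r
    proof (cases "0 \<le> r \<and> r \<le> 1")
      case True
      have "t - t * r = t * (1 - r)" by (simp add: algebra_simps)
      then have "(t - t * r) powr (\<alpha> - 1) = t powr (\<alpha> - 1) * (1 - r) powr (\<alpha> - 1)"
        using t True by (simp add: powr_mult)
      moreover have "t * t powr (\<alpha> - 1) = t powr \<alpha>" using t by (simp add: powr_diff)
      ultimately show ?thesis
        using t True by (simp add: k_def F'_def max_def mult_le_cancel_left2)
    next
      case False
      then have "0 + t * r \<notin> {0..t}" using t by (simp add: zero_le_mult_iff mult_le_cancel_left2) 
      then show ?thesis using False by (auto simp: k_def)
    qed
    have "riemann_liouville \<alpha> F t = \<bar>t\<bar> *\<^sub>R (\<integral>r. indicator {0..t} (0 + t * r) * ((t - (0 + t * r)) powr (\<alpha> - 1) / Gamma \<alpha> * F (0 + t * r)) \<partial>lborel)"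
      unfolding riemann_liouville_def using t
      by (intro lborel_integral_real_affine[of t _ 0]) simp
    also have "\<dots> = (\<integral>r. t * (indicator {0..t} (0 + t * r) * ((t - (0 + t * r)) powr (\<alpha> - 1) / Gamma \<alpha> * F (0 + t * r))) \<partial>lborel)"
      using t by simp
    also have "\<dots> = t powr \<alpha> * (\<integral>r. k r * F' (t * r) \<partial>lborel)"
      unfolding pt by simp
    finally show ?thesis .
  qed
  have "continuous_on {0..} (\<lambda>t. \<integral>r. k r * F' (t * r) \<partial>lborel)"
    unfolding continuous_on_sequentially comp_def
  proof (intro allI ballI impI)
    fix x :: "nat \<Rightarrow> real" and t :: real
    assume t: "t \<in> {0..}" and x: "(\<forall>n. x n \<in> {0..}) \<and> x \<longlonglongrightarrow> t"
    obtain T where T: "\<And>n. \<bar>x n\<bar> \<le> T"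
      using x convergent_imp_Bseq[of x] unfolding convergent_def Bseq_def by fastforce
    have "compact (F' ` {0..T})"
      by (intro compact_continuous_image continuous_on_subset[OF F']) auto
    then obtain D where D: "\<And>s. 0 \<le> s \<Longrightarrow> s \<le> T \<Longrightarrow> \<bar>F' s\<bar> \<le> D"
      by (force dest: compact_imp_bounded simp: bounded_iff)
    have "T \<ge> 0" using T[of 0] by simp
    have k_meas: "k \<in> borel_measurable lborel" using k_int by auto
    have [measurable]: "F' \<in> borel_measurable borel" by (rule borel_measurable_continuous_onI[OF F'])
    show "(\<lambda>n. \<integral>r. k r * F' (x n * r) \<partial>lborel) \<longlonglongrightarrow> (\<integral>r. k r * F' (t * r) \<partial>lborel)"
    proof (rule integral_dominated_convergence[where w = "\<lambda>r. \<bar>k r\<bar> * D"])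
      show "AE r in lborel. (\<lambda>n. k r * F' (x n * r)) \<longlonglongrightarrow> k r * F' (t * r)"
        using x by (intro AE_I2 tendsto_mult tendsto_const continuous_on_tendsto_compose[OF F']) auto
      show "AE r in lborel. norm (k r * F' (x n * r)) \<le> \<bar>k r\<bar> * D" for n
      proof (intro AE_I2)
        fix r :: real
        have "\<bar>F' (x n * r)\<bar> \<le> D" if r: "0 \<le> r" "r \<le> 1"
          using r x T[of n] mult_left_le[of r "x n"] by (intro D) auto
        then show "norm (k r * F' (x n * r)) \<le> \<bar>k r\<bar> * D"
          by (cases "0 \<le> r \<and> r \<le> 1") (auto simp: abs_mult k_def intro!: mult_left_mono divide_right_mono)
      qed
    qed (use k_int k_meas in \<open>auto intro!: borel_measurable_times\<close>)
  qed
  then have "continuous_on {0..} (\<lambda>t. t powr \<alpha> * (\<integral>r. k r * F' (t * r) \<partial>lborel))"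
    using \<alpha> by (intro continuous_on_mult continuous_on_powr') (auto intro!: continuous_intros)
  then show ?thesis
    by (rule continuous_on_cong[THEN iffD1, rotated 2]) (auto simp: eq)
qed

text \<open>To be read for a pair \<open>(y, x)\<close> of the given operator, with
  \<open>\<sigma>\<close>, \<open>\<tau>\<close> and \<open>F\<close> the images under a functional
  of the orbits \<open>S s x\<close>, \<open>S s y\<close> and \<open>R s y\<close>, and
  \<open>c\<close> that of \<open>C y\<close>. Both sides have the same Laplace transform, and
  Lerch's theorem together with continuity gives equality at every \<open>t > 0\<close>.\<close>

theorem scalar_inversion_formula:
  fixes \<alpha> \<beta> \<gamma> c :: real and \<sigma> \<tau> F :: "real \<Rightarrow> real"
  defines "T \<equiv> \<lambda>\<sigma> t. inv_transform (\<gamma> + \<beta> + 1) \<sigma> t"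
  assumes \<alpha>: "0 < \<alpha>" and \<beta>: "0 \<le> \<beta>" and \<gamma>: "\<beta> + 1 / 2 < \<gamma>"
    and \<sigma>: "continuous_on {0..} \<sigma>" "\<And>s. 0 < s \<Longrightarrow> \<bar>\<sigma> s\<bar> \<le> B * s powr \<beta>"
    and \<tau>: "continuous_on {0..} \<tau>" "\<And>s. 0 < s \<Longrightarrow> \<bar>\<tau> s\<bar> \<le> B * s powr \<beta>"
    and res: "\<And>t. 0 < t \<Longrightarrow> riemann_liouville \<alpha> \<sigma> t = \<tau> t - t powr \<beta> / Gamma (\<beta> + 1) * c"
    and F: "continuous_on {0..} F" "\<And>t. 0 \<le> t \<Longrightarrow> F t = t powr \<gamma> / Gamma (\<gamma> + 1) * c - T \<tau> t"
    and T\<sigma>: "continuous_on {0..} (T \<sigma>)" and t: "0 < t"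
  shows "riemann_liouville \<alpha> F t = - T \<sigma> t"
proof -
  define \<nu> where "\<nu> = \<gamma> + \<beta> + 1"
  have \<nu>: "2 * \<beta> + 3 / 2 < \<nu>" using \<gamma> by (simp add: \<nu>_def)
  have \<Gamma>: "Gamma (\<beta> + 1) > 0" "Gamma (\<gamma> + 1) > 0"
    using \<beta> \<gamma> by (auto intro!: Gamma_real_pos)
  note \<sigma>' = \<beta> \<nu> \<sigma> and \<tau>' = \<beta> \<nu> \<tau>
  have T_eq: "T \<sigma> t = inv_transform \<nu> \<sigma> t" for \<sigma> t
    by (simp add: T_def \<nu>_def)
  define L where "L f l = (\<integral>s. damped l s (f s) \<partial>lborel)" for f :: "real \<Rightarrow> real" and l
  have L_power: "has_bochner_integral lborel (\<lambda>s. damped l s (s powr m / Gamma (m + 1) * c)) (l powr (- m - 1) * c)"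
    if "0 < l" "0 \<le> m" for l m
  proof -
    have G: "Gamma (m + 1) > 0" using that by (intro Gamma_real_pos) simp
    have "has_bochner_integral lborel (\<lambda>s. (damped l s (s powr (m + 1 - 1))) * (c / Gamma (m + 1)))
        (Gamma (m + 1) * l powr (- (m + 1)) * (c / Gamma (m + 1)))"
      using that by (intro has_bochner_integral_mult_left laplace_powr) auto
    then show ?thesis using G by (simp add: mult_ac)
  qed
  \<comment> \<open>The only information on the original family that enters: its integral equation
    after a Laplace transform.\<close>
  have relation: "l powr (- \<alpha>) * L \<sigma> l = L \<tau> l - l powr (- \<beta> - 1) * c" if l: "0 < l" for l
  proof -
    have "l powr (- \<alpha>) * L \<sigma> l = (\<integral>t. damped l t (riemann_liouville \<alpha> \<sigma> t) \<partial>lborel)"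
      unfolding L_def using laplace_riemann_liouville[OF \<alpha> l damped_integrable[OF \<sigma>' l]]
      by (simp add: has_bochner_integral_iff)
    also have "\<dots> = (\<integral>t. damped l t (\<tau> t) - damped l t ((t powr \<beta> / Gamma (\<beta> + 1) * c)) \<partial>lborel)"
    proof (rule integral_cong_AE)
      show "(\<lambda>t. damped l t (riemann_liouville \<alpha> \<sigma> t)) \<in> borel_measurable lborel"
        using laplace_riemann_liouville[OF \<alpha> l damped_integrable[OF \<sigma>' l]] by auto
      show "(\<lambda>t. damped l t (\<tau> t) - damped l t ((t powr \<beta> / Gamma (\<beta> + 1) * c))) \<in> borel_measurable lborel"
        using damped_integrable[OF \<tau>' l] L_power[OF l \<beta>] by (auto simp: has_bochner_integral_iff)
      show "AE t in lborel. damped l t (riemann_liouville \<alpha> \<sigma> t) =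
          damped l t (\<tau> t) - damped l t ((t powr \<beta> / Gamma (\<beta> + 1) * c))"
        by (rule AE_mp[OF AE_lborel_singleton[of 0]], intro AE_I2) (auto simp: indicator_def res algebra_simps)
    qed
    also have "\<dots> = L \<tau> l - l powr (- \<beta> - 1) * c"
      using damped_integrable[OF \<tau>' l] L_power[OF l \<beta>]
      by (simp add: L_def has_bochner_integral_iff)
    finally show ?thesis .
  qed
  obtain M1 where M1: "0 \<le> M1" "\<And>t. 0 \<le> t \<Longrightarrow> \<bar>T \<sigma> t\<bar> \<le> M1 * t powr (\<nu> - \<beta> - 1)"
    using inv_transform_bound[OF \<sigma>', folded T_eq] by blast
  obtain M2 where M2: "0 \<le> M2" "\<And>t. 0 \<le> t \<Longrightarrow> \<bar>T \<tau> t\<bar> \<le> M2 * t powr (\<nu> - \<beta> - 1)"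
    using inv_transform_bound[OF \<tau>', folded T_eq] by blast
  have exponent: "\<nu> - \<beta> - 1 = \<gamma>" by (simp add: \<nu>_def)
  \<comment> \<open>\<open>laplace_eq_zero_imp_zero\<close> expects growth of at most order
    \<open>exp t\<close>; the bounds at hand are powers of \<open>t\<close>.\<close>
  obtain q where q: "0 \<le> q" "\<And>t. 0 \<le> t \<Longrightarrow> t powr \<gamma> \<le> q * exp t"
    using powr_le_exp[of \<gamma>] \<beta> \<gamma> by auto
  have F_bound: "\<bar>F t\<bar> \<le> ((\<bar>c\<bar> / Gamma (\<gamma> + 1) + M2) * q) * exp t" if "0 \<le> t" for t
  proof -
    have "\<bar>F t\<bar> \<le> \<bar>t powr \<gamma> / Gamma (\<gamma> + 1) * c\<bar> + \<bar>T \<tau> t\<bar>"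
      unfolding F(2)[OF that] by (rule abs_triangle_ineq4)
    also have "\<dots> \<le> t powr \<gamma> / Gamma (\<gamma> + 1) * \<bar>c\<bar> + M2 * t powr \<gamma>"
      using M2(2)[OF that] \<Gamma> by (simp add: abs_mult exponent)
    also have "\<dots> = (\<bar>c\<bar> / Gamma (\<gamma> + 1) + M2) * t powr \<gamma>"
      by (simp add: algebra_simps)
    also have "\<dots> \<le> (\<bar>c\<bar> / Gamma (\<gamma> + 1) + M2) * (q * exp t)"
      using q(2)[OF that] \<Gamma> M2(1) by (intro mult_left_mono) auto
    finally show ?thesis by (simp add: mult.assoc)
  qed
  have LF: "has_bochner_integral lborel (\<lambda>s. damped l s (F s)) (l powr (- \<gamma> - 1) * c - l powr (- \<nu> - 1) * L \<tau> (1 / l))"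
    if l: "0 < l" for l
  proof -
    have "has_bochner_integral lborel (\<lambda>s. damped l s ((s powr \<gamma> / Gamma (\<gamma> + 1) * c)) -
        damped l s (T \<tau> s)) (l powr (- \<gamma> - 1) * c - l powr (- \<nu> - 1) * L \<tau> (1 / l))"
      unfolding L_def T_eq using \<beta> \<gamma> l
      by (intro has_bochner_integral_diff L_power laplace_inv_transform[OF \<tau>']) auto
    moreover have "damped l s ((s powr \<gamma> / Gamma (\<gamma> + 1) * c)) -
        damped l s (T \<tau> s) = damped l s (F s)" for s
      by (simp add: indicator_def F(2) algebra_simps)
    ultimately show ?thesis by simp
  qed
  have "riemann_liouville \<alpha> F t + T \<sigma> t = 0"
  proof (rule laplace_eq_zero_imp_zero[OF _ _ _ t, where F = "\<lambda>t. riemann_liouville \<alpha> F t + T \<sigma> t"])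
    show "continuous_on {0..} (\<lambda>t. riemann_liouville \<alpha> F t + T \<sigma> t)"
      by (intro continuous_on_add continuous_on_riemann_liouville \<alpha> F T\<sigma>)
    show "\<bar>riemann_liouville \<alpha> F t + T \<sigma> t\<bar> \<le> ((\<bar>c\<bar> / Gamma (\<gamma> + 1) + M2) * q + M1 * q) * exp t" if "0 \<le> t" for t
    proof -
      have "\<bar>riemann_liouville \<alpha> F t\<bar> \<le> ((\<bar>c\<bar> / Gamma (\<gamma> + 1) + M2) * q) * exp t"
        by (rule riemann_liouville_integrable(2)[OF \<alpha> F(1) F_bound that])
      moreover have "\<bar>T \<sigma> t\<bar> \<le> M1 * (q * exp t)"
        using M1(2)[OF that] mult_left_mono[OF q(2)[OF that] M1(1)] by (simp add: exponent)
      ultimately show ?thesis by (simp add: algebra_simps)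
    qed
    fix l :: real assume l: "0 < l"
    have RF: "has_bochner_integral lborel (\<lambda>t. damped l t (riemann_liouville \<alpha> F t))
        (l powr (- \<alpha>) * (l powr (- \<gamma> - 1) * c - l powr (- \<nu> - 1) * L \<tau> (1 / l)))"
      using laplace_riemann_liouville[OF \<alpha> l, of F] LF[OF l] by (simp add: has_bochner_integral_iff)
    have TS: "has_bochner_integral lborel (\<lambda>t. damped l t (T \<sigma> t)) (l powr (- \<nu> - 1) * L \<sigma> (1 / l))"
      unfolding L_def T_eq by (rule laplace_inv_transform[OF \<sigma>' l])
    have "(\<integral>t. damped l t ((riemann_liouville \<alpha> F t + T \<sigma> t)) \<partial>lborel)
        = l powr (- \<alpha>) * (l powr (- \<gamma> - 1) * c - l powr (- \<nu> - 1) * L \<tau> (1 / l)) + l powr (- \<nu> - 1) * L \<sigma> (1 / l)"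
      using has_bochner_integral_add[OF RF TS] by (simp add: has_bochner_integral_iff algebra_simps)
    also have "\<dots> = 0"
    proof -
      \<comment> \<open>With this value at \<open>1 / l\<close>, the terms with
        \<open>L \<sigma>\<close> cancel by \<open>p1\<close>, and those with \<open>c\<close>
        cancel by \<open>p2\<close>, where \<open>\<nu> = \<gamma> + \<beta> + 1\<close> is
        used.\<close>
      have rel: "L \<tau> (1 / l) = l powr \<alpha> * L \<sigma> (1 / l) + l powr (\<beta> + 1) * c"
        using relation[of "1 / l"] l by (simp add: powr_divide powr_minus powr_diff powr_add field_simps)
      have p1: "l powr (- \<alpha>) * l powr \<alpha> = 1" using l by (simp flip: powr_add)
      have p2: "l powr (- \<nu> - 1) * l powr (\<beta> + 1) = l powr (- \<gamma> - 1)" by (simp add: \<nu>_def flip: powr_add)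
      have "l powr (- \<alpha>) * (l powr (- \<gamma> - 1) * c - l powr (- \<nu> - 1) * L \<tau> (1 / l)) + l powr (- \<nu> - 1) * L \<sigma> (1 / l)
        = l powr (- \<alpha>) * c * (l powr (- \<gamma> - 1) - l powr (- \<nu> - 1) * l powr (\<beta> + 1))
          + l powr (- \<nu> - 1) * L \<sigma> (1 / l) * (1 - l powr (- \<alpha>) * l powr \<alpha>)"
        unfolding rel by (simp add: algebra_simps)
      then show ?thesis unfolding p1 p2 by simp
    qed
    finally show "(\<integral>t. damped l t ((riemann_liouville \<alpha> F t + T \<sigma> t)) \<partial>lborel) = 0" .
  qed
  then show ?thesis by simp
qed

text \<open>Continuity of the kernel in \<open>t\<close>, in the mean with weight
  \<open>s powr \<beta>\<close>. It is what makes the orbits of the inverse family continuous at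
  positive times, uniformly over all functionals below a given seminorm.\<close>

lemma inv_kernel_L1_continuous:
  assumes \<beta>: "0 \<le> \<beta>" and \<nu>: "2 * \<beta> + 3 / 2 < \<nu>" and t: "0 < t" and X: "X \<longlonglongrightarrow> t"
  shows "(\<lambda>n. \<integral>s. kernel_diff \<nu> \<beta> (X n) t s \<partial>lborel) \<longlonglongrightarrow> 0"
proof -
  let ?w = "\<lambda>s. indicator {0..} s * (1 + s) powr (- \<nu> / 2 - 1 / 4 + \<beta>)"
  have \<nu>2: "1 / 2 \<le> \<nu>" "0 \<le> \<nu>" using \<beta> \<nu> by auto
  \<comment> \<open>\<open>X\<close> is altered at finitely many indices so that every term lies
    between \<open>t / 2\<close> and \<open>2 * t\<close>, where one majorant works.\<close>
  define Y where "Y n = (if t / 2 \<le> X n \<and> X n \<le> 2 * t then X n else t)" for n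
  have ev: "\<forall>\<^sub>F n in sequentially. t / 2 < X n \<and> X n < 2 * t"
    using order_tendstoD(1)[OF X, of "t / 2"] order_tendstoD(2)[OF X, of "2 * t"] t
    by (intro eventually_conj) auto
  then have YX: "\<forall>\<^sub>F n in sequentially. Y n = X n"
    by eventually_elim (simp add: Y_def)
  have Y: "Y \<longlonglongrightarrow> t" "\<And>n. t / 2 \<le> Y n" "\<And>n. Y n \<le> 2 * t"
    using X t by (auto simp: Lim_transform_eventually tendsto_cong[OF YX] Y_def)
  have "0 < t / 2" using t by simp
  then obtain K where K: "0 \<le> K" "\<And>r s. t / 2 \<le> r \<Longrightarrow> r \<le> 2 * t \<Longrightarrow> 0 \<le> s \<Longrightarrow>
      \<bar>inv_kernel \<nu> r s\<bar> \<le> K * bc_decay \<nu> s"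
    by (rule inv_kernel_bound[OF \<nu>2(1)]) blast
  define f where "f r s = kernel_diff \<nu> \<beta> r t s" for r s
  have [measurable]: "bessel_clifford \<nu> \<in> borel_measurable borel"
    using \<nu>2 by (intro borel_measurable_bessel_clifford) simp
  have f_meas: "f r \<in> borel_measurable lborel" for r
    unfolding f_def inv_kernel_def by measurable
  have "(\<lambda>n. integral\<^sup>L lborel (f (Y n))) \<longlonglongrightarrow> integral\<^sup>L lborel (\<lambda>_::real. 0::real)"
  proof (rule integral_dominated_convergence[where w = "\<lambda>s. 2 * K * ?w s"])
    show "integrable lborel (\<lambda>s. 2 * K * ?w s)"
      using \<nu> by (intro integrable_mult_right integrable_one_plus_powr) simp
    show "AE s in lborel. (\<lambda>n. f (Y n) s) \<longlonglongrightarrow> 0"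
    proof (intro AE_I2)
      fix s :: real
      have "(\<lambda>n. inv_kernel \<nu> (Y n) s) \<longlonglongrightarrow> inv_kernel \<nu> t s"
        unfolding inv_kernel_def using Y(1) t
        by (intro tendsto_mult tendsto_powr tendsto_const
            continuous_on_tendsto_compose[OF continuous_on_bessel_clifford[OF \<nu>2(2), of UNIV]]) auto
      then have "(\<lambda>n. f (Y n) s) \<longlonglongrightarrow> indicator {0..} s * (\<bar>inv_kernel \<nu> t s - inv_kernel \<nu> t s\<bar> * s powr \<beta>)"
        unfolding f_def by (intro tendsto_mult tendsto_rabs tendsto_diff tendsto_const)
      then show "(\<lambda>n. f (Y n) s) \<longlonglongrightarrow> 0" by simp
    qed
    show "AE s in lborel. norm (f (Y n) s) \<le> 2 * K * ?w s" for n
    proof (intro AE_I2)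
      fix s :: real
      have "\<bar>inv_kernel \<nu> (Y n) s - inv_kernel \<nu> t s\<bar> * s powr \<beta>
          \<le> (2 * (K * bc_decay \<nu> s)) * (1 + s) powr \<beta>" if s: "0 \<le> s"
      proof (intro mult_mono)
        show "\<bar>inv_kernel \<nu> (Y n) s - inv_kernel \<nu> t s\<bar> \<le> 2 * (K * bc_decay \<nu> s)"
          using K(2)[OF Y(2,3) s, of n] K(2)[of t s] s t by linarith
        show "s powr \<beta> \<le> (1 + s) powr \<beta>" using s \<beta> by (intro powr_mono2) auto
      qed (use K(1) in auto)
      then show "norm (f (Y n) s) \<le> 2 * K * ?w s"
        by (simp add: f_def abs_mult powr_add indicator_def mult_ac)
    qed
  qed (use f_meas in simp_all)
  then have "(\<lambda>n. integral\<^sup>L lborel (f (Y n))) \<longlonglongrightarrow> 0" by simp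
  moreover have "\<forall>\<^sub>F n in sequentially. integral\<^sup>L lborel (f (Y n)) = integral\<^sup>L lborel (f (X n))"
    using YX by eventually_elim simp
  ultimately have "(\<lambda>n. integral\<^sup>L lborel (f (X n))) \<longlonglongrightarrow> 0"
    by (rule Lim_transform_eventually)
  then show ?thesis unfolding f_def .
qed

section \<open>Passing between integrals over \<open>lebesgue_on\<close> and over
  \<open>lborel\<close>\<close>

lemma
  fixes f :: "real \<Rightarrow> real"
  assumes \<Omega>: "\<Omega> \<in> sets borel" and f: "(\<lambda>s. indicator \<Omega> s * f s) \<in> borel_measurable borel"
  shows borel_measurable_lebesgue_on: "f \<in> borel_measurable (lebesgue_on \<Omega>)"
    and integrable_lebesgue_on:
      "integrable (lebesgue_on \<Omega>) f \<longleftrightarrow> integrable lborel (\<lambda>s. indicator \<Omega> s * f s)"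
    and has_bochner_integral_lebesgue_on:
      "has_bochner_integral (lebesgue_on \<Omega>) f I \<longleftrightarrow> has_bochner_integral lborel (\<lambda>s. indicator \<Omega> s * f s) I"
proof -
  have \<Omega>': "\<Omega> \<inter> space lebesgue \<in> sets lebesgue" using \<Omega> by simp
  have f': "(\<lambda>s. indicator \<Omega> s * f s) \<in> borel_measurable lborel" using f by simp
  show "f \<in> borel_measurable (lebesgue_on \<Omega>)"
    unfolding borel_measurable_restrict_space_iff[OF \<Omega>'] using measurable_completion[OF f'] by simp
  show int_eq: "integrable (lebesgue_on \<Omega>) f \<longleftrightarrow> integrable lborel (\<lambda>s. indicator \<Omega> s * f s)"
    by (rule trans[OF integrable_restrict_space[OF \<Omega>', of f, unfolded real_scaleR_def] integrable_completion[OF f']])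
  have "integral\<^sup>L (lebesgue_on \<Omega>) f = (\<integral>s. indicator \<Omega> s * f s \<partial>lborel)"
    by (rule trans[OF integral_restrict_space[OF \<Omega>', of f, unfolded real_scaleR_def] integral_completion[OF f']])
  then show "has_bochner_integral (lebesgue_on \<Omega>) f I \<longleftrightarrow> has_bochner_integral lborel (\<lambda>s. indicator \<Omega> s * f s) I"
    by (simp only: has_bochner_integral_iff int_eq)
qed

section \<open>Limits of linear combinations of operators\<close>

text \<open>Nodes and weights are chosen before \<open>x\<close>: the sums at \<open>x + y\<close>,
  at \<open>C x\<close>, or at both components of a pair in a graph are then the same linear
  combination of operators, and algebraic identities pass to the limit.\<close>

definition quadrature_limit :: "(real \<Rightarrow> 'x::complex_locally_convex_space \<Rightarrow> 'x) \<Rightarrow> ('x \<Rightarrow> 'x) \<Rightarrow> bool" where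
  "quadrature_limit S T \<longleftrightarrow> (\<exists>(N :: nat \<Rightarrow> nat) c \<sigma>. (\<forall>n j. 0 \<le> \<sigma> n j) \<and>
     (\<forall>x. (\<lambda>n. \<Sum>j<N n. c n j *\<^sub>R S (\<sigma> n j) x) \<longlonglongrightarrow> T x))"

lemma tendsto_scaleC_const:
  fixes X :: "'a \<Rightarrow> 'x::complex_locally_convex_space"
  assumes "(X \<longlongrightarrow> x) F"
  shows "((\<lambda>n. c *\<^sub>C X n) \<longlongrightarrow> c *\<^sub>C x) F"
  using filterlim_compose[OF tendsto_scaleC_Pair filterlim_Pair[OF tendsto_const assms]] by simp

lemma continuous_linear_operatorsD:
  assumes "T \<in> continuous_linear_operators"
  shows "T (x + y) = T x + T y" "T (c *\<^sub>C x) = c *\<^sub>C T x" "T (r *\<^sub>R x) = r *\<^sub>R T x"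
    "T (x - y) = T x - T y" "T (sum f A) = (\<Sum>i\<in>A. T (f i))" "continuous_on UNIV T"
proof -
  have lin: "Vector_Spaces.linear scaleC scaleC T" and cont: "continuous_on UNIV T"
    using assms by (auto simp: continuous_linear_operators_def)
  interpret Vector_Spaces.linear scaleC scaleC T by (rule lin)
  show "T (x + y) = T x + T y" "T (c *\<^sub>C x) = c *\<^sub>C T x" "T (r *\<^sub>R x) = r *\<^sub>R T x"
    "T (x - y) = T x - T y" "T (sum f A) = (\<Sum>i\<in>A. T (f i))" "continuous_on UNIV T"
    using cont by (simp_all add: add scale scaleR_scaleC diff sum)
qed

lemma quadrature_limit_linear:
  fixes S :: "real \<Rightarrow> 'x::{complex_locally_convex_space, t2_space} \<Rightarrow> 'x"
  assumes S: "\<And>s. 0 \<le> s \<Longrightarrow> S s \<in> continuous_linear_operators" and T: "quadrature_limit S T"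
  shows "T (x + y) = T x + T y" "T (c *\<^sub>C x) = c *\<^sub>C T x"
proof -
  obtain N :: "nat \<Rightarrow> nat" and d \<sigma> where \<sigma>: "\<And>n j. 0 \<le> \<sigma> n j"
    and lim: "\<And>x. (\<lambda>n. \<Sum>j<N n. d n j *\<^sub>R S (\<sigma> n j) x) \<longlonglongrightarrow> T x"
    using T unfolding quadrature_limit_def by blast
  have "(\<lambda>n. \<Sum>j<N n. d n j *\<^sub>R S (\<sigma> n j) (x + y)) \<longlonglongrightarrow> T x + T y"
    using tendsto_add[OF lim[of x] lim[of y]]
    by (simp add: continuous_linear_operatorsD(1)[OF S[OF \<sigma>]] scaleR_add_right sum.distrib)
  then show "T (x + y) = T x + T y" using lim LIMSEQ_unique by blast
  have "(\<lambda>n. \<Sum>j<N n. d n j *\<^sub>R S (\<sigma> n j) (c *\<^sub>C x)) \<longlonglongrightarrow> c *\<^sub>C T x"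
    using tendsto_scaleC_const[OF lim[of x], of c]
    by (simp add: continuous_linear_operatorsD(2)[OF S[OF \<sigma>]] scaleR_scaleC_commute complex_vector.scale_sum_right)
  then show "T (c *\<^sub>C x) = c *\<^sub>C T x" using lim LIMSEQ_unique by blast
qed

lemma quadrature_limit_commute:
  fixes S :: "real \<Rightarrow> 'x::{complex_locally_convex_space, t2_space} \<Rightarrow> 'x"
  assumes C: "C \<in> continuous_linear_operators" and SC: "\<And>s. 0 \<le> s \<Longrightarrow> S s \<circ> C = C \<circ> S s"
    and T: "quadrature_limit S T"
  shows "T (C x) = C (T x)"
proof -
  obtain N :: "nat \<Rightarrow> nat" and d \<sigma> where \<sigma>: "\<And>n j. 0 \<le> \<sigma> n j"
    and lim: "\<And>x. (\<lambda>n. \<Sum>j<N n. d n j *\<^sub>R S (\<sigma> n j) x) \<longlonglongrightarrow> T x"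
    using T unfolding quadrature_limit_def by blast
  have SC': "S (\<sigma> n j) (C x) = C (S (\<sigma> n j) x)" for n j
    using SC[OF \<sigma>] by (simp add: fun_eq_iff)
  have "(\<lambda>n. C (\<Sum>j<N n. d n j *\<^sub>R S (\<sigma> n j) x)) \<longlonglongrightarrow> C (T x)"
    using continuous_linear_operatorsD(6)[OF C] lim by (rule continuous_on_tendsto_compose) auto
  then have "(\<lambda>n. \<Sum>j<N n. d n j *\<^sub>R S (\<sigma> n j) (C x)) \<longlonglongrightarrow> C (T x)"
    by (simp add: continuous_linear_operatorsD(3,5)[OF C] SC')
  then show ?thesis using lim LIMSEQ_unique by blast
qed

section \<open>Graphs of multivalued operators and their inverses\<close>

lemma mloD:
  assumes "mlo A"
  shows "(0, 0) \<in> A" "(x, u) \<in> A \<Longrightarrow> (y, v) \<in> A \<Longrightarrow> (x + y, u + v) \<in> A"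
    "(x, u) \<in> A \<Longrightarrow> (c *\<^sub>C x, c *\<^sub>C u) \<in> A"
proof -
  show add: "(x + y, u + v) \<in> A" if "(x, u) \<in> A" "(y, v) \<in> A"
    using assms that unfolding mlo_def by blast
  show scale: "(c *\<^sub>C x, c *\<^sub>C u) \<in> A" if "(x, u) \<in> A" for c x u
    using assms that unfolding mlo_def by blast
  have "0 \<in> Domain A"
    using assms complex_vector.subspace_0 unfolding mlo_def by blast
  \<comment> \<open>Some \<open>(0, z)\<close> lies in the graph; multiplying it by the scalar 0
    gives \<open>(0, 0)\<close>.\<close>
  then obtain z where "(0, z) \<in> A" by blast
  from scale[OF this, of 0] show "(0, 0) \<in> A" by simp
qed

lemma mlo_converse:
  assumes A: "mlo A"
  shows "mlo (A\<inverse>)"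
  unfolding mlo_def complex_vector.subspace_def
  using mloD[OF A] by (auto simp: Domain_converse) blast+

lemma op_commutes_with_iff: "op_commutes_with T A \<longleftrightarrow> (\<forall>x y. (x, y) \<in> A \<longrightarrow> (T x, T y) \<in> A)"
  unfolding op_commutes_with_def op_graph_def by auto

text \<open>Commutation means that \<open>T\<close>, applied to both components, maps the graph into
  itself, a condition symmetric in the components.\<close>

lemma op_commutes_with_converse: "op_commutes_with T (A\<inverse>) \<longleftrightarrow> op_commutes_with T A"
  unfolding op_commutes_with_iff by auto

text \<open>Each quadrature sum, taken at \<open>x\<close> and at \<open>y\<close>, is a pair in
  \<open>A\<close> since the graph is a subspace, and closedness keeps the limiting pair
  there.\<close>

lemma quadrature_limit_closed_mlo:
  assumes A: "mlo A" "closed A" and SA: "\<And>s. 0 \<le> s \<Longrightarrow> op_commutes_with (S s) A"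
    and T: "quadrature_limit S T"
  shows "op_commutes_with T A"
  unfolding op_commutes_with_iff
proof (intro allI impI)
  fix x y assume xy: "(x, y) \<in> A"
  obtain N :: "nat \<Rightarrow> nat" and d \<sigma> where \<sigma>: "\<And>n j. 0 \<le> \<sigma> n j"
    and lim: "\<And>x. (\<lambda>n. \<Sum>j<N n. d n j *\<^sub>R S (\<sigma> n j) x) \<longlonglongrightarrow> T x"
    using T unfolding quadrature_limit_def by blast
  have sum_in: "((\<Sum>j<m. d n j *\<^sub>R S (\<sigma> n j) x), (\<Sum>j<m. d n j *\<^sub>R S (\<sigma> n j) y)) \<in> A" for n m
  proof (induction m)
    case (Suc m)
    have "(S (\<sigma> n m) x, S (\<sigma> n m) y) \<in> A"
      using SA[OF \<sigma>] xy by (simp add: op_commutes_with_iff)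
    then have "(d n m *\<^sub>R S (\<sigma> n m) x, d n m *\<^sub>R S (\<sigma> n m) y) \<in> A"
      unfolding scaleR_scaleC by (rule mloD(3)[OF A(1)])
    with Suc show ?case by (simp add: mloD(2)[OF A(1)])
  qed (simp add: mloD(1)[OF A(1)])
  show "(T x, T y) \<in> A"
    by (rule Lim_in_closed_set[OF A(2) _ _ tendsto_Pair[OF lim[of x] lim[of y]]]) (auto simp: sum_in)
qed

lemma functional_continuous:
  fixes \<phi> :: "'x::complex_locally_convex_space \<Rightarrow> real"
  assumes \<phi>: "linear \<phi>" "\<And>x. \<bar>\<phi> x\<bar> \<le> p x" and p: "continuous_seminorm p"
  shows "continuous_on A \<phi>"
  unfolding continuous_on_def
proof
  fix x
  show "(\<phi> \<longlongrightarrow> \<phi> x) (at x within A)"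
  proof (rule LIM_zero_cancel, rule Lim_null_comparison)
    show "\<forall>\<^sub>F y in at x within A. norm (\<phi> y - \<phi> x) \<le> p (y - x)"
      using \<phi>(2) by (intro always_eventually) (simp flip: linear_diff[OF \<phi>(1)])
    show "((\<lambda>y. p (y - x)) \<longlongrightarrow> 0) (at x within A)"
      by (rule tendsto_seminorm[OF p tendsto_ident_at])
  qed
qed

section \<open>The inverse family\<close>

text \<open>Produces the integral for all \<open>x\<close> from one quadrature rule, which depends
  on \<open>t\<close> and on growth alone. The estimate \<open>bound\<close> serves only to provide
  a majorant in each seminorm.\<close>

lemma inv_operator:
  fixes S :: "real \<Rightarrow> 'x::seq_complete_complex_lcs \<Rightarrow> 'x"
  assumes \<beta>: "0 \<le> \<beta>" and \<nu>: "2 * \<beta> + 3 / 2 < \<nu>" and S: "\<And>x. continuous_on {0..} (\<lambda>s. S s x)"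
    and bound: "\<And>p. continuous_seminorm p \<Longrightarrow>
      \<exists>q. continuous_seminorm q \<and> (\<forall>s>0. \<forall>x. p (S s x) \<le> s powr \<beta> * q x)"
    and t: "0 \<le> t"
  obtains T where "quadrature_limit S T"
    "\<And>x. has_lc_integral (lebesgue_on {0..}) (\<lambda>s. inv_kernel \<nu> t s *\<^sub>R S s x) (T x)"
proof -
  let ?w = "\<lambda>s. indicator {0..} s * (1 + s) powr (- \<nu> / 2 - 1 / 4 + \<beta>)"
  define h where "h = inv_kernel \<nu> t"
  \<comment> \<open>\<open>1 + s\<close> in place of \<open>s\<close>: the weight has to be positive
    at \<open>s = 0\<close>, where \<open>S 0 x\<close> need not vanish and the power bound says
    nothing.\<close>
  define w where "w s = (1 + s) powr \<beta>" for s :: real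
  have \<nu>2: "1 / 2 \<le> \<nu>" "0 \<le> \<nu>" using \<beta> \<nu> by auto
  have [measurable]: "bessel_clifford \<nu> \<in> borel_measurable borel"
    using \<nu>2 by (intro borel_measurable_bessel_clifford) simp
  have [measurable]: "h \<in> borel_measurable borel"
    unfolding h_def inv_kernel_def by measurable
  have h: "h \<in> borel_measurable (lebesgue_on {0..})"
    by (rule borel_measurable_lebesgue_on) measurable
  have hw_meas: "(\<lambda>s. indicator {0..} s * (h s * w s)) \<in> borel_measurable borel"
    unfolding w_def by measurable
  have "integrable lborel (\<lambda>s. indicator {0..} s * (h s * w s))"
  proof (cases "t = 0")
    case True
    then show ?thesis by (simp add: h_def)
  next
    case False
    with t have "0 < t" by simp
    then obtain K where K: "0 \<le> K" "\<And>r s. t \<le> r \<Longrightarrow> r \<le> t \<Longrightarrow> 0 \<le> s \<Longrightarrow>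
        \<bar>inv_kernel \<nu> r s\<bar> \<le> K * bc_decay \<nu> s"
      by (rule inv_kernel_bound[OF \<nu>2(1)]) blast
    have int: "integrable lborel (\<lambda>s. K * ?w s)"
      using \<nu> by (intro integrable_mult_right integrable_one_plus_powr) simp
    show ?thesis
    proof (rule integrable_dominated[OF int])
      show "(\<lambda>s. indicator {0..} s * (h s * w s)) \<in> borel_measurable lborel"
        using hw_meas by simp
      show "AE s in lborel. norm (indicator {0..} s * (h s * w s)) \<le> norm (K * ?w s)"
      proof (intro AE_I2)
        fix s :: real
        have "\<bar>h s\<bar> * w s \<le> K * bc_decay \<nu> s * w s" if "0 \<le> s"
          using K(2)[OF order_refl order_refl that] unfolding h_def
          by (intro mult_right_mono) (auto simp: w_def)
        then show "norm (indicator {0..} s * (h s * w s)) \<le> norm (K * ?w s)"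
          using K(1) by (simp add: abs_mult w_def powr_add indicator_def mult_ac)
      qed
    qed
  qed
  then have hw: "integrable (lebesgue_on {0..}) (\<lambda>s. h s * w s)"
    by (subst integrable_lebesgue_on[OF _ hw_meas]) auto
  obtain N :: "nat \<Rightarrow> nat" and c \<sigma> where \<sigma>: "\<And>n j. 0 \<le> \<sigma> n j"
    and quad: "\<And>f :: real \<Rightarrow> 'x. continuous_on {0..} f \<Longrightarrow>
       (\<And>p. continuous_seminorm p \<Longrightarrow> \<exists>B. \<forall>s\<in>{0..}. p (f s) \<le> B * w s) \<Longrightarrow>
       \<exists>I. (\<lambda>n. \<Sum>j<N n. c n j *\<^sub>R f (\<sigma> n j)) \<longlonglongrightarrow> I \<and> has_lc_integral (lebesgue_on {0..}) (\<lambda>s. h s *\<^sub>R f s) I"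
  proof (rule quadrature_has_lc_integral[OF _ _ _ h hw])
    show "w r \<le> w s" if "s \<in> {0..}" "0 \<le> r" "r \<le> s" for r s
      using that \<beta> unfolding w_def by (intro powr_mono2) auto
  qed (auto simp: w_def)
  have "\<exists>I. (\<lambda>n. \<Sum>j<N n. c n j *\<^sub>R S (\<sigma> n j) x) \<longlonglongrightarrow> I \<and> has_lc_integral (lebesgue_on {0..}) (\<lambda>s. h s *\<^sub>R S s x) I" for x
  proof (rule quad[OF S])
    fix p :: "'x \<Rightarrow> real" assume p: "continuous_seminorm p"
    then obtain q where q: "continuous_seminorm q" "\<And>s x. 0 < s \<Longrightarrow> p (S s x) \<le> s powr \<beta> * q x"
      using bound by blast
    \<comment> \<open>The constant has one summand for \<open>s = 0\<close> and one for
      \<open>s > 0\<close>.\<close>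
    have "p (S s x) \<le> (p (S 0 x) + q x) * w s" if "0 \<le> s" for s
    proof (cases "s = 0")
      case True
      then show ?thesis using seminorm_nonneg[OF q(1), of x] by (simp add: w_def)
    next
      case False
      with that have "p (S s x) \<le> s powr \<beta> * q x" by (intro q) simp
      also have "\<dots> \<le> w s * q x"
        using that \<beta> seminorm_nonneg[OF q(1)] unfolding w_def by (intro mult_right_mono powr_mono2) auto
      also have "\<dots> \<le> w s * (p (S 0 x) + q x)"
        using seminorm_nonneg[OF p] by (intro mult_left_mono) (auto simp: w_def)
      finally show ?thesis by (simp add: mult.commute)
    qed
    then show "\<exists>B. \<forall>s\<in>{0..}. p (S s x) \<le> B * w s" by auto
  qed
  then have "\<forall>x. \<exists>I. (\<lambda>n. \<Sum>j<N n. c n j *\<^sub>R S (\<sigma> n j) x) \<longlonglongrightarrow> I \<and>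
      has_lc_integral (lebesgue_on {0..}) (\<lambda>s. h s *\<^sub>R S s x) I" ..
  then obtain T where T: "\<forall>x. (\<lambda>n. \<Sum>j<N n. c n j *\<^sub>R S (\<sigma> n j) x) \<longlonglongrightarrow> T x \<and>
      has_lc_integral (lebesgue_on {0..}) (\<lambda>s. h s *\<^sub>R S s x) (T x)"
    by (rule choice[THEN exE])
  show thesis
  proof (rule that)
    show "quadrature_limit S T"
      unfolding quadrature_limit_def
      by (intro exI[of _ N] exI[of _ c] exI[of _ \<sigma>] conjI allI \<sigma> T[rule_format, THEN conjunct1])
    show "has_lc_integral (lebesgue_on {0..}) (\<lambda>s. inv_kernel \<nu> t s *\<^sub>R S s x) (T x)" for x
      using T unfolding h_def by simp
  qed
qed

text \<open>A real-linear functional can be moved past real scalars only, so the complex-valued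
  \<open>g\<close> has to be traded for its real values.\<close>

definition g_real :: "real \<Rightarrow> real \<Rightarrow> real" where
  "g_real \<zeta> t = (if t = 0 \<and> \<zeta> = 1 then 1 else t powr (\<zeta> - 1) / Gamma \<zeta>)"

lemma g_eq_of_real: "g \<zeta> t = complex_of_real (g_real \<zeta> t)"
  by (simp add: g_def g_real_def)

lemma scaleC_g: "g \<zeta> t *\<^sub>C v = g_real \<zeta> t *\<^sub>R v"
  by (simp add: g_eq_of_real scaleR_scaleC)

lemma riemann_liouville_g_real:
  fixes F :: "real \<Rightarrow> real"
  assumes \<alpha>: "0 < \<alpha>" and F: "continuous_on {0..} F" and t: "0 \<le> t"
    and I: "has_bochner_integral (lebesgue_on {0..t}) (\<lambda>s. g_real \<alpha> (t - s) * F s) I"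
  shows "I = riemann_liouville \<alpha> F t"
proof -
  have meas: "(\<lambda>s. indicator {0..t} s * (g_real \<alpha> (t - s) * F s)) \<in> borel_measurable borel"
    by (rule borel_measurable_product_on_interval[OF _ F]) (unfold g_real_def, measurable)
  have meas': "(\<lambda>s. rl_integrand \<alpha> t s (F s)) \<in> borel_measurable borel"
    by (rule borel_measurable_product_on_interval[OF _ F]) measurable
  have "I = (\<integral>s. indicator {0..t} s * (g_real \<alpha> (t - s) * F s) \<partial>lborel)"
    using I has_bochner_integral_lebesgue_on[OF _ meas] has_bochner_integral_integral_eq by fastforce
  also have "\<dots> = riemann_liouville \<alpha> F t"
    unfolding riemann_liouville_def
  proof (rule integral_cong_AE)
    \<comment> \<open>For \<open>\<alpha> = 1\<close> the integrands may differ at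
      \<open>s = t\<close>: there \<open>g_real\<close> has the value 1, whereas
      \<open>0 powr 0 = 0\<close>.\<close>
    show "AE s in lborel. indicator {0..t} s * (g_real \<alpha> (t - s) * F s) = rl_integrand \<alpha> t s (F s)"
      by (rule AE_mp[OF AE_lborel_singleton[of t]], intro AE_I2) (auto simp: g_real_def)
  qed (use meas meas' in simp_all)
  finally show ?thesis .
qed

text \<open>Functionals can only identify the value of the integral in the resolvent equation; that
  it exists is shown here, by quadrature with constant weight, \<open>f\<close> being bounded in
  every seminorm on a compact interval.\<close>

lemma has_lc_integral_g_real:
  fixes f :: "real \<Rightarrow> 'x::seq_complete_complex_lcs"
  assumes \<alpha>: "0 < \<alpha>" and f: "continuous_on {0..} f" and t: "0 \<le> t"
  obtains I where "has_lc_integral (lebesgue_on {0..t}) (\<lambda>s. g_real \<alpha> (t - s) *\<^sub>R f s) I"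
proof -
  have meas: "(\<lambda>s. indicator {0..t} s * g_real \<alpha> (t - s)) \<in> borel_measurable borel"
    unfolding g_real_def by measurable
  have meas1: "(\<lambda>s. indicator {0..t} s * (g_real \<alpha> (t - s) * 1)) \<in> borel_measurable borel"
    using meas by simp
  have "integrable lborel (\<lambda>s. rl_integrand \<alpha> t s 1)"
    using riemann_liouville_integrable(1)[OF \<alpha>, of "\<lambda>_. 1" 1 t] t by simp
  then have "integrable lborel (\<lambda>s. indicator {0..t} s * (g_real \<alpha> (t - s) * 1))"
  proof (rule integrable_cong_AE_imp)
    show "AE s in lborel. rl_integrand \<alpha> t s 1 = indicator {0..t} s * (g_real \<alpha> (t - s) * 1)"
      by (rule AE_mp[OF AE_lborel_singleton[of t]], intro AE_I2) (auto simp: g_real_def)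
  qed (use meas1 in simp)
  then have hint: "integrable (lebesgue_on {0..t}) (\<lambda>s. g_real \<alpha> (t - s) * 1)"
    by (subst integrable_lebesgue_on[OF _ meas1]) auto
  have hmeas: "(\<lambda>s. g_real \<alpha> (t - s)) \<in> borel_measurable (lebesgue_on {0..t})"
    by (rule borel_measurable_lebesgue_on[OF _ meas]) simp
  obtain N :: "nat \<Rightarrow> nat" and c \<sigma> where quad: "\<And>f :: real \<Rightarrow> 'x. continuous_on {0..t} f \<Longrightarrow>
       (\<And>p. continuous_seminorm p \<Longrightarrow> \<exists>B. \<forall>s\<in>{0..t}. p (f s) \<le> B * 1) \<Longrightarrow>
       \<exists>I. (\<lambda>n. \<Sum>j<N n. c n j *\<^sub>R f (\<sigma> n j)) \<longlonglongrightarrow> I \<and>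
         has_lc_integral (lebesgue_on {0..t}) (\<lambda>s. g_real \<alpha> (t - s) *\<^sub>R f s) I"
    by (rule quadrature_has_lc_integral[OF _ _ _ hmeas hint]) auto
  have ft: "continuous_on {0..t} f" using f by (rule continuous_on_subset) auto
  have "\<exists>I. (\<lambda>n. \<Sum>j<N n. c n j *\<^sub>R f (\<sigma> n j)) \<longlonglongrightarrow> I \<and>
      has_lc_integral (lebesgue_on {0..t}) (\<lambda>s. g_real \<alpha> (t - s) *\<^sub>R f s) I"
  proof (rule quad[OF ft])
    fix p :: "'x \<Rightarrow> real" assume p: "continuous_seminorm p"
    have "compact ((\<lambda>s. p (f s)) ` {0..t})"
      by (intro compact_continuous_image continuous_on_compose2[OF seminorm_continuous[OF p] ft]) auto
    then have "bounded ((\<lambda>s. p (f s)) ` {0..t})"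
      by (rule compact_imp_bounded)
    then obtain B where "\<forall>r\<in>(\<lambda>s. p (f s)) ` {0..t}. norm r \<le> B"
      unfolding bounded_iff by blast
    then have "\<forall>s\<in>{0..t}. p (f s) \<le> B * 1"
      by (auto dest: abs_le_D1)
    then show "\<exists>B. \<forall>s\<in>{0..t}. p (f s) \<le> B * 1" by blast
  qed
  then show thesis using that by blast
qed

lemma powr_bound_imp_tendsto_0:
  fixes \<gamma> K :: real
  assumes "0 < \<gamma>"
  shows "((\<lambda>t. K * t powr \<gamma>) \<longlongrightarrow> 0) (at 0 within {0..})"
proof -
  have "continuous_on {0..} (\<lambda>t. K * t powr \<gamma>)"
    using assms by (intro continuous_on_mult continuous_on_const continuous_on_powr') auto
  then show ?thesis
    unfolding continuous_on_def by (drule_tac bspec[of _ _ 0]) auto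
qed

theorem inverse_resolvent_family:
  fixes C :: "'x::seq_complete_complex_lcs \<Rightarrow> 'x"
  assumes C: "C \<in> continuous_linear_operators" and \<alpha>: "0 < \<alpha>" and \<beta>: "0 \<le> \<beta>"
    and A: "mlo \<A>" "closed \<A>"
    and S: "regularized_resolvent_family (g \<alpha>) (g (\<beta> + 1)) C S \<A>"
    and equi: "equicontinuous {\<lambda>x. (t powr (- \<beta>)) *\<^sub>R S t x | t. t > 0}"
    and \<gamma>: "\<beta> + 1 / 2 < \<gamma>"
  shows "\<exists>R. regularized_resolvent_family (g \<alpha>) (g (\<gamma> + 1)) C R (\<A>\<inverse>) \<and>
    equicontinuous {\<lambda>x. (t powr (- \<gamma>)) *\<^sub>R R t x | t. t > 0}"
proof -
  let ?\<kappa> = "\<lambda>t. t powr \<gamma> / Gamma (\<gamma> + 1)"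
  define \<nu> where "\<nu> = \<gamma> + \<beta> + 1"
  let ?int = "\<lambda>t x. has_lc_integral (lebesgue_on {0..}) (\<lambda>s. inv_kernel \<nu> t s *\<^sub>R S s x)"
  have \<nu>: "2 * \<beta> + 3 / 2 < \<nu>" using \<gamma> by (simp add: \<nu>_def)
  have \<gamma>0: "0 < \<gamma>" using \<beta> \<gamma> by simp
  have \<Gamma>: "Gamma (\<gamma> + 1) > 0" using \<gamma>0 by (intro Gamma_real_pos) simp
  have power_cont: "continuous_on {0..} ?\<kappa>"
  proof (rule continuous_on_divide[OF _ continuous_on_const])
    show "continuous_on {0..} (\<lambda>t. t powr \<gamma>)"
      using \<gamma>0 by (intro continuous_on_powr' continuous_on_id continuous_on_const) auto
    show "\<forall>t\<in>{0..}. Gamma (\<gamma> + 1) \<noteq> 0" using \<Gamma> by (metis less_irrefl)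
  qed
  have S_op: "\<And>s. 0 \<le> s \<Longrightarrow> S s \<in> continuous_linear_operators"
    and S_cont: "\<And>x. continuous_on {0..} (\<lambda>s. S s x)"
    and S_int: "\<And>t x y. 0 \<le> t \<Longrightarrow> (x, y) \<in> \<A> \<Longrightarrow>
      has_lc_integral (lebesgue_on {0..t}) (\<lambda>s. g \<alpha> (t - s) *\<^sub>C S s y) (S t x - g (\<beta> + 1) t *\<^sub>C C x)"
    and SC: "\<And>s. 0 \<le> s \<Longrightarrow> S s \<circ> C = C \<circ> S s"
    and SA: "\<And>s. 0 \<le> s \<Longrightarrow> op_commutes_with (S s) \<A>"
    and CA: "op_commutes_with C \<A>"
    and a: "\<forall>t\<ge>0. g \<alpha> absolutely_integrable_on {0..t}" "\<not> (AE t in lebesgue. 0 \<le> t \<longrightarrow> g \<alpha> t = 0)"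
    using S unfolding regularized_resolvent_family_def by blast+
  \<comment> \<open>The form in which equicontinuity of the rescaled family is used:
    \<open>q\<close> depends on \<open>p\<close> but not on \<open>s\<close>.\<close>
  have bound: "\<exists>q. continuous_seminorm q \<and> (\<forall>s>0. \<forall>x. p (S s x) \<le> s powr \<beta> * q x)"
    if p: "continuous_seminorm p" for p
  proof -
    obtain q where q: "continuous_seminorm q"
      "\<And>T x. T \<in> {\<lambda>x. (t powr (- \<beta>)) *\<^sub>R S t x | t. t > 0} \<Longrightarrow> p (T x) \<le> q x"
    proof (rule equicontinuous_seminorm[OF equi _ p])
      show "T (r *\<^sub>R x) = r *\<^sub>R T x" if "T \<in> {\<lambda>x. (t powr (- \<beta>)) *\<^sub>R S t x | t. t > 0}" for T x r
        using that by (auto simp: continuous_linear_operatorsD(3)[OF S_op])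
    qed blast
    have "p (S s x) \<le> s powr \<beta> * q x" if s: "0 < s" for s x
    proof -
      have "p ((s powr (- \<beta>)) *\<^sub>R S s x) \<le> q x"
        using s q(2)[of "\<lambda>x. (s powr (- \<beta>)) *\<^sub>R S s x"] by blast
      then show ?thesis
        using s by (simp add: seminorm_scaleR[OF p] powr_minus field_simps)
    qed
    with q(1) show ?thesis by blast
  qed
  have "\<exists>T. 0 \<le> t \<longrightarrow> quadrature_limit S T \<and>
      (\<forall>x. ?int t x (T x))" for t
  proof (cases "0 \<le> t")
    case True
    show ?thesis
    proof (rule inv_operator[OF \<beta> \<nu> S_cont bound True])
      fix T
      assume "quadrature_limit S T"
        "\<And>x. ?int t x (T x)"
      then show ?thesis by (intro exI[of _ T]) simp
    qed
  qed simp
  then have "\<forall>t. \<exists>T. 0 \<le> t \<longrightarrow> quadrature_limit S T \<and>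
      (\<forall>x. ?int t x (T x))" ..
  then obtain T where "\<forall>t. 0 \<le> t \<longrightarrow> quadrature_limit S (T t) \<and>
      (\<forall>x. ?int t x (T t x))"
    by (rule choice[THEN exE])
  then have T_quad: "\<And>t. 0 \<le> t \<Longrightarrow> quadrature_limit S (T t)"
    and T_int: "\<And>t x. 0 \<le> t \<Longrightarrow> ?int t x (T t x)"
    by simp_all
  \<comment> \<open>Subtracting the power times \<open>C x\<close> reflects the term
    \<open>l powr (- \<gamma> - 1)\<close> in the expected Laplace transform.\<close>
  define R where "R t x = ?\<kappa> t *\<^sub>R C x - T t x" for t x

  have \<phi>_cont: "continuous_on {0..} (\<lambda>s. \<phi> (f s))"
    if "linear \<phi>" "\<And>x. \<bar>\<phi> x\<bar> \<le> p x" "continuous_seminorm p" "continuous_on {0..} f"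
    for \<phi> :: "'x \<Rightarrow> real" and p f
    using functional_continuous[OF that(1-3), of UNIV] that(4) by (rule continuous_on_compose2) auto
  \<comment> \<open>Under a functional, \<open>T t x\<close> becomes the
    \<open>inv_transform\<close> of the scalar orbit, to which the moment and Laplace formulas
    apply.\<close>
  have T_functional: "\<phi> (T t x) = (\<integral>s. inv_kernel \<nu> t s * (indicator {0..} s * \<phi> (S s x)) \<partial>lborel)"
    if \<phi>: "linear \<phi>" "\<And>x. \<bar>\<phi> x\<bar> \<le> p x" "continuous_seminorm p" and t: "0 \<le> t" for \<phi> :: "'x \<Rightarrow> real" and p t x
  proof -
    have [measurable]: "bessel_clifford \<nu> \<in> borel_measurable borel"
      using \<beta> \<nu> by (intro borel_measurable_bessel_clifford) simp
    have [measurable]: "(\<lambda>s. indicator {0..} s * \<phi> (S s x)) \<in> borel_measurable borel"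
      by (rule borel_measurable_half_line[OF \<phi>_cont[OF \<phi> S_cont]])
    have "(\<lambda>s. inv_kernel \<nu> t s * (indicator {0..} s * \<phi> (S s x))) \<in> borel_measurable borel"
      unfolding inv_kernel_def by measurable
    then have meas: "(\<lambda>s. indicator {0..} s * \<phi> (inv_kernel \<nu> t s *\<^sub>R S s x)) \<in> borel_measurable borel"
      by (simp add: linear_scale[OF \<phi>(1)] mult_ac)
    have "has_bochner_integral (lebesgue_on {0..}) (\<lambda>s. \<phi> (inv_kernel \<nu> t s *\<^sub>R S s x)) (\<phi> (T t x))"
      by (rule has_lc_integral_functional[OF T_int[OF t] \<phi> borel_measurable_lebesgue_on[OF _ meas]]) simp
    then have "has_bochner_integral lborel (\<lambda>s. indicator {0..} s * \<phi> (inv_kernel \<nu> t s *\<^sub>R S s x)) (\<phi> (T t x))"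
      by (subst (asm) has_bochner_integral_lebesgue_on[OF _ meas]) auto
    from has_bochner_integral_integral_eq[OF this] show ?thesis
      by (simp add: linear_scale[OF \<phi>(1)] mult_ac)
  qed

  obtain M where M: "0 \<le> M" "\<And>t. 0 < t \<Longrightarrow> has_bochner_integral lborel
       (\<lambda>s. kernel_weight \<nu> \<beta> t s) (M * t powr (\<nu> - \<beta> - 1))"
    by (rule inv_kernel_moment[OF \<beta> \<nu>]) blast
  \<comment> \<open>A functional attaining \<open>p\<close> at \<open>T t x\<close> reduces the
    estimate to the weighted moment of the kernel, and \<open>\<nu> - \<beta> - 1 = \<gamma>\<close>
    gives the power.\<close>
  have T_bound: "p (T t x) \<le> M * t powr \<gamma> * q x"
    if p: "continuous_seminorm p" and q: "\<And>s x. 0 < s \<Longrightarrow> p (S s x) \<le> s powr \<beta> * q x" and t: "0 < t" for p q t x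
  proof -
    obtain \<phi> where \<phi>: "linear \<phi>" "\<And>x. \<bar>\<phi> x\<bar> \<le> p x" "\<phi> (T t x) = p (T t x)"
      using seminorm_functional[OF p, of "T t x"] by blast
    have "\<bar>\<phi> (S s x)\<bar> \<le> q x * s powr \<beta>" if "0 < s" for s
      using \<phi>(2)[of "S s x"] q[OF that, of x] by (simp add: mult.commute)
    note hyps = \<beta> \<nu> \<phi>_cont[OF \<phi>(1,2) p S_cont[of x]] this
    have "p (T t x) \<le> \<bar>\<integral>s. inv_kernel \<nu> t s * (indicator {0..} s * \<phi> (S s x)) \<partial>lborel\<bar>"
      using T_functional[OF \<phi>(1,2) p, of t x] \<phi>(3) t by simp
    also have "\<dots> \<le> q x * (\<integral>s. kernel_weight \<nu> \<beta> t s \<partial>lborel)"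
      by (rule order_trans[OF integral_abs_bound inv_integrand_integrable(2)[OF hyps t]])
    also have "\<dots> = M * t powr \<gamma> * q x"
      using has_bochner_integral_integral_eq[OF M(2)[OF t]] by (simp add: \<nu>_def)
    finally show ?thesis .
  qed
  \<comment> \<open>The kernel vanishes identically at \<open>t = 0\<close>, so every functional
    sees the value 0.\<close>
  have T_zero: "T 0 x = 0" for x
  proof (rule functional_separation)
    fix p and \<phi> :: "'x \<Rightarrow> real" assume "continuous_seminorm p" "linear \<phi>" "\<And>x. \<bar>\<phi> x\<bar> \<le> p x"
    then show "\<phi> (T 0 x) = \<phi> 0"
      using T_functional[of \<phi> p 0 x] by (simp add: linear_0)
  qed
  have R_zero: "R 0 x = 0" for x
    using \<gamma>0 by (simp add: R_def T_zero)
  have R_bound: "\<exists>r. continuous_seminorm r \<and> (\<forall>t>0. \<forall>x. p (R t x) \<le> t powr \<gamma> * r x)"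
    if p: "continuous_seminorm p" for p
  proof -
    obtain q where q: "continuous_seminorm q" "\<And>s x. 0 < s \<Longrightarrow> p (S s x) \<le> s powr \<beta> * q x"
      using bound[OF p] by blast
    show ?thesis
    proof (intro exI[of _ "\<lambda>x. 1 / Gamma (\<gamma> + 1) * p (C x) + M * q x"] conjI allI impI)
      show "continuous_seminorm (\<lambda>x. 1 / Gamma (\<gamma> + 1) * p (C x) + M * q x)"
        using \<Gamma>
        by (intro continuous_seminorm_add[OF continuous_seminorm_scale[OF continuous_operator_seminorm[OF C p]]
              continuous_seminorm_scale[OF q(1) M(1)]]) simp
      fix t :: real and x assume t: "0 < t"
      have "p (R t x) \<le> p (?\<kappa> t *\<^sub>R C x) + p (T t x)"
        unfolding R_def by (rule seminorm_diff[OF p])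
      also have "\<dots> \<le> ?\<kappa> t * p (C x) + M * t powr \<gamma> * q x"
        using T_bound[OF p q(2) t, of x] \<Gamma> by (simp add: seminorm_scaleR[OF p])
      also have "\<dots> = t powr \<gamma> * (1 / Gamma (\<gamma> + 1) * p (C x) + M * q x)"
        by (simp add: algebra_simps)
      finally show "p (R t x) \<le> t powr \<gamma> * (1 / Gamma (\<gamma> + 1) * p (C x) + M * q x)" .
    qed
  qed

  have R_op: "R t \<in> continuous_linear_operators" if t: "0 \<le> t" for t
  proof -
    have add: "R t (x + y) = R t x + R t y" and scale: "R t (c *\<^sub>C x) = c *\<^sub>C R t x" for x y c
      using quadrature_limit_linear[OF S_op T_quad[OF t]]
      by (simp_all add: R_def continuous_linear_operatorsD[OF C] scaleR_add_right scaleR_scaleC_commute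
          complex_vector.scale_right_diff_distrib)
    have lin: "Vector_Spaces.linear scaleC scaleC (R t)"
      by (intro Vector_Spaces.linear.intro module_hom.intro module_hom_axioms.intro)
        (simp_all add: add scale complex_vector.vector_space_axioms complex_vector.module_axioms)
    interpret lin: Vector_Spaces.linear scaleC scaleC "R t" by (rule lin)
    have "continuous_on UNIV (R t)"
    proof (rule continuous_seminorm_boundI)
      show "R t (x - y) = R t x - R t y" for x y by (rule lin.diff)
      fix p :: "'x \<Rightarrow> real" assume p: "continuous_seminorm p"
      then obtain r where r: "continuous_seminorm r" "\<And>t x. 0 < t \<Longrightarrow> p (R t x) \<le> t powr \<gamma> * r x"
        using R_bound by blast
      have "p (R t x) \<le> t powr \<gamma> * r x" for x
        using r(2)[of t x] t by (cases "t = 0") (auto simp: R_zero seminorm_zero[OF p])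
      then show "\<exists>q. continuous_seminorm q \<and> (\<forall>x. p (R t x) \<le> q x)"
        using continuous_seminorm_scale[OF r(1), of "t powr \<gamma>"] by auto
    qed
    with lin show ?thesis by (simp add: continuous_linear_operators_def)
  qed

  \<comment> \<open>At 0 the growth bound alone forces the limit 0; at \<open>t0 > 0\<close>
    continuity of the kernel in weighted mean is needed.\<close>
  have R_cont: "continuous_on {0..} (\<lambda>t. R t x)" for x
    unfolding continuous_on_def
  proof (intro ballI tendsto_seminormI)
    fix t0 :: real and p :: "'x \<Rightarrow> real" assume t0: "t0 \<in> {0..}" and p: "continuous_seminorm p"
    show "((\<lambda>t. p (R t x - R t0 x)) \<longlongrightarrow> 0) (at t0 within {0..})"
    proof (cases "t0 = 0")
      case True
      obtain r where r: "continuous_seminorm r" "\<And>t x. 0 < t \<Longrightarrow> p (R t x) \<le> t powr \<gamma> * r x"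
        using R_bound[OF p] by blast
      show ?thesis
      proof (rule Lim_null_comparison)
        show "\<forall>\<^sub>F t in at t0 within {0..}. norm (p (R t x - R t0 x)) \<le> r x * t powr \<gamma>"
          unfolding eventually_at_filter
          using r(2) True by (intro always_eventually) (auto simp: R_zero seminorm_nonneg[OF p] mult.commute)
        show "((\<lambda>t. r x * t powr \<gamma>) \<longlongrightarrow> 0) (at t0 within {0..})"
          unfolding True by (rule powr_bound_imp_tendsto_0[OF \<gamma>0])
      qed
    next
      case False
      with t0 have t0: "0 < t0" by simp
      obtain q where q: "continuous_seminorm q" "\<And>s x. 0 < s \<Longrightarrow> p (S s x) \<le> s powr \<beta> * q x"
        using bound[OF p] by blast
      define \<Phi> where "\<Phi> t = (\<integral>s. kernel_diff \<nu> \<beta> t t0 s \<partial>lborel)" for t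
      \<comment> \<open>The functional is chosen anew for each \<open>t\<close>, but the resulting
        bound does not refer to it.\<close>
      have T_diff: "p (T t x - T t0 x) \<le> q x * \<Phi> t" if t: "0 < t" for t
      proof -
        obtain \<phi> where \<phi>: "linear \<phi>" "\<And>x. \<bar>\<phi> x\<bar> \<le> p x" "\<phi> (T t x - T t0 x) = p (T t x - T t0 x)"
          using seminorm_functional[OF p, of "T t x - T t0 x"] by blast
        have \<sigma>_bound: "\<bar>\<phi> (S s x)\<bar> \<le> q x * s powr \<beta>" if "0 < s" for s
          using \<phi>(2)[of "S s x"] q(2)[OF that, of x] by (simp add: mult.commute)
        show ?thesis
          using inv_transform_difference[OF \<beta> \<nu> \<phi>_cont[OF \<phi>(1,2) p S_cont[of x]] \<sigma>_bound t t0]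
            T_functional[OF \<phi>(1,2) p, of t x] T_functional[OF \<phi>(1,2) p, of t0 x] t t0 \<phi>(3)
          by (simp add: linear_diff[OF \<phi>(1)] \<Phi>_def)
      qed
      show ?thesis
        unfolding tendsto_at_iff_sequentially comp_def
      proof (intro allI impI)
        fix X :: "nat \<Rightarrow> real" assume "X \<longlonglongrightarrow> t0"
        have \<Phi>_lim: "(\<lambda>n. \<Phi> (X n)) \<longlonglongrightarrow> 0"
          unfolding \<Phi>_def by (rule inv_kernel_L1_continuous[OF \<beta> \<nu> t0 \<open>X \<longlonglongrightarrow> t0\<close>])
        have powr_lim: "(\<lambda>n. ?\<kappa> (X n)) \<longlonglongrightarrow> ?\<kappa> t0"
          using t0 \<Gamma> \<open>X \<longlonglongrightarrow> t0\<close> by (intro tendsto_intros) auto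
        let ?e = "\<lambda>n. \<bar>?\<kappa> (X n) - ?\<kappa> t0\<bar> * p (C x) + q x * \<Phi> (X n)"
        have "?e \<longlonglongrightarrow>
            \<bar>?\<kappa> t0 - ?\<kappa> t0\<bar> * p (C x) + q x * 0"
          by (intro tendsto_add tendsto_mult tendsto_rabs tendsto_diff tendsto_const powr_lim \<Phi>_lim)
        then have lim: "?e \<longlonglongrightarrow> 0"
          by simp
        show "(\<lambda>n. p (R (X n) x - R t0 x)) \<longlonglongrightarrow> 0"
        proof (rule Lim_null_comparison[OF _ lim])
          have "\<forall>\<^sub>F n in sequentially. 0 < X n"
            using order_tendstoD(1)[OF \<open>X \<longlonglongrightarrow> t0\<close> t0] .
          then show "\<forall>\<^sub>F n in sequentially. norm (p (R (X n) x - R t0 x))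
            \<le> ?e n"
          proof eventually_elim
            case (elim n)
            have "R (X n) x - R t0 x = (?\<kappa> (X n) - ?\<kappa> t0) *\<^sub>R C x - (T (X n) x - T t0 x)"
              by (simp add: R_def scaleR_diff_left)
            then have "p (R (X n) x - R t0 x) \<le> \<bar>?\<kappa> (X n) - ?\<kappa> t0\<bar> * p (C x) + p (T (X n) x - T t0 x)"
              using seminorm_diff[OF p] by (simp add: seminorm_scaleR[OF p, symmetric])
            then show ?case
              using T_diff[OF elim] seminorm_nonneg[OF p, of "R (X n) x - R t0 x"] by simp
          qed
        qed
      qed
    qed
  qed

  \<comment> \<open>A pair \<open>(x, y)\<close> of the inverse appears as
    \<open>(y, x) \<in> \<A>\<close>: the equation of \<open>S\<close> integrates the orbit of
    \<open>x\<close>, the one of \<open>R\<close> that of \<open>y\<close>.\<close>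
  have R_int: "has_lc_integral (lebesgue_on {0..t}) (\<lambda>s. g \<alpha> (t - s) *\<^sub>C R s y) (R t x - g (\<gamma> + 1) t *\<^sub>C C x)"
    if t: "0 \<le> t" and yx: "(y, x) \<in> \<A>" for t x y
  proof -
    obtain I where I: "has_lc_integral (lebesgue_on {0..t}) (\<lambda>s. g_real \<alpha> (t - s) *\<^sub>R R s y) I"
      using has_lc_integral_g_real[OF \<alpha> R_cont t] by blast
    have g\<gamma>: "g_real (\<gamma> + 1) t = ?\<kappa> t" for t
      using \<gamma>0 by (simp add: g_real_def)
    have "I = R t x - g_real (\<gamma> + 1) t *\<^sub>R C x"
    proof (rule functional_separation)
      fix p and \<phi> :: "'x \<Rightarrow> real" assume p: "continuous_seminorm p" and \<phi>: "linear \<phi>" "\<And>x. \<bar>\<phi> x\<bar> \<le> p x"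
      \<comment> \<open>Used twice: for the unknown integral \<open>I\<close> over \<open>R\<close>,
        and for the given integral equation of \<open>S\<close>.\<close>
      have functional_rl: "\<phi> J = riemann_liouville \<alpha> (\<lambda>s. \<phi> (f s)) t"
        if f: "continuous_on {0..} f" and t: "0 \<le> t"
          and J: "has_lc_integral (lebesgue_on {0..t}) (\<lambda>s. g_real \<alpha> (t - s) *\<^sub>R f s) J" for f J t
      proof -
        have \<phi>f: "continuous_on {0..} (\<lambda>s. \<phi> (f s))" by (rule \<phi>_cont[OF \<phi> p f])
        have "(\<lambda>s. indicator {0..t} s * (g_real \<alpha> (t - s) * \<phi> (f s))) \<in> borel_measurable borel"
          by (rule borel_measurable_product_on_interval[OF _ \<phi>f]) (unfold g_real_def, measurable)
        then have meas: "(\<lambda>s. indicator {0..t} s * \<phi> (g_real \<alpha> (t - s) *\<^sub>R f s)) \<in> borel_measurable borel"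
          by (simp add: linear_scale[OF \<phi>(1)])
        have "has_bochner_integral (lebesgue_on {0..t}) (\<lambda>s. \<phi> (g_real \<alpha> (t - s) *\<^sub>R f s)) (\<phi> J)"
          by (rule has_lc_integral_functional[OF J \<phi> p borel_measurable_lebesgue_on[OF _ meas]]) simp
        then show ?thesis
          by (intro riemann_liouville_g_real[OF \<alpha> \<phi>f t]) (simp add: linear_scale[OF \<phi>(1)])
      qed
      obtain q where q: "continuous_seminorm q" "\<And>s x. 0 < s \<Longrightarrow> p (S s x) \<le> s powr \<beta> * q x"
        using bound[OF p] by blast
      \<comment> \<open>The sum \<open>q x + q y\<close> serves as one constant for both orbits, as
        the scalar formula requires.\<close>
      have \<sigma>_bound: "\<bar>\<phi> (S s z)\<bar> \<le> (q x + q y) * s powr \<beta>" if "0 < s" "z \<in> {x, y}" for s z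
      proof -
        have "\<bar>\<phi> (S s z)\<bar> \<le> s powr \<beta> * q z" using \<phi>(2)[of "S s z"] q(2)[OF that(1), of z] by linarith
        also have "\<dots> \<le> s powr \<beta> * (q x + q y)"
          using that(2) seminorm_nonneg[OF q(1)] by (intro mult_left_mono) auto
        finally show ?thesis by (simp add: mult.commute)
      qed
      have \<phi>R: "\<phi> (R t z) = ?\<kappa> t * \<phi> (C z) -
          (\<integral>s. inv_kernel (\<gamma> + \<beta> + 1) t s * (indicator {0..} s * \<phi> (S s z)) \<partial>lborel)" if "0 \<le> t" for t z
        using T_functional[OF \<phi> p that, of z]
        by (simp add: R_def \<nu>_def linear_diff[OF \<phi>(1)] linear_scale[OF \<phi>(1)])
      have "\<phi> I = riemann_liouville \<alpha> (\<lambda>s. \<phi> (R s y)) t"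
        by (rule functional_rl[OF R_cont t I])
      also have "\<dots> = \<phi> (R t x) - ?\<kappa> t * \<phi> (C x)"
      proof (cases "t = 0")
        case True
        then show ?thesis by (simp add: riemann_liouville_zero R_zero linear_0[OF \<phi>(1)])
      next
        case False
        with t have t': "0 < t" by simp
        have "riemann_liouville \<alpha> (\<lambda>s. \<phi> (R s y)) t =
            - (\<integral>s. inv_kernel (\<gamma> + \<beta> + 1) t s * (indicator {0..} s * \<phi> (S s x)) \<partial>lborel)"
        \<comment> \<open>Applied with \<open>\<sigma>\<close> the orbit of \<open>x\<close> and
          \<open>\<tau>\<close> that of \<open>y\<close>; the result, minus the transform of the
          orbit of \<open>x\<close>, is \<open>\<phi> (R t x)\<close> without its power
          term.\<close>
        proof (rule scalar_inversion_formula[OF \<alpha> \<beta> \<gamma> _ _ _ _ _ _ _ _ t'])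
          show "continuous_on {0..} (\<lambda>s. \<phi> (S s x))" "continuous_on {0..} (\<lambda>s. \<phi> (S s y))"
            "continuous_on {0..} (\<lambda>s. \<phi> (R s y))"
            using S_cont R_cont by (auto intro!: \<phi>_cont[OF \<phi> p])
          show "\<bar>\<phi> (S s x)\<bar> \<le> (q x + q y) * s powr \<beta>" "\<bar>\<phi> (S s y)\<bar> \<le> (q x + q y) * s powr \<beta>" if "0 < s" for s
            using that by (auto intro: \<sigma>_bound)
          show "riemann_liouville \<alpha> (\<lambda>s. \<phi> (S s x)) t = \<phi> (S t y) - t powr \<beta> / Gamma (\<beta> + 1) * \<phi> (C y)"
            if t: "0 < t" for t
          proof -
            have "has_lc_integral (lebesgue_on {0..t}) (\<lambda>s. g_real \<alpha> (t - s) *\<^sub>R S s x) (S t y - g_real (\<beta> + 1) t *\<^sub>R C y)"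
              using S_int[OF _ yx, of t] t by (simp add: scaleC_g)
            from functional_rl[OF S_cont _ this] t show ?thesis
              by (simp add: g_real_def linear_diff[OF \<phi>(1)] linear_scale[OF \<phi>(1)])
          qed
          show "\<phi> (R t y) = ?\<kappa> t * \<phi> (C y) -
              (\<integral>s. inv_kernel (\<gamma> + \<beta> + 1) t s * (indicator {0..} s * \<phi> (S s y)) \<partial>lborel)" if "0 \<le> t" for t
            by (rule \<phi>R[OF that])
          \<comment> \<open>Continuity of the transform is recovered from that of
            \<open>R t x\<close>, by solving \<open>\<phi>R\<close> for the integral.\<close>
          have "continuous_on {0..} (\<lambda>t. ?\<kappa> t * \<phi> (C x) - \<phi> (R t x))"
            by (intro continuous_on_diff continuous_on_mult continuous_on_const power_cont \<phi>_cont[OF \<phi> p R_cont])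
          then show "continuous_on {0..} (\<lambda>t. \<integral>s. inv_kernel (\<gamma> + \<beta> + 1) t s * (indicator {0..} s * \<phi> (S s x)) \<partial>lborel)"
            by (rule continuous_on_cong[THEN iffD1, rotated 2]) (auto simp: \<phi>R)
        qed
        then show ?thesis by (simp add: \<phi>R[OF t])
      qed
      also have "\<dots> = \<phi> (R t x - g_real (\<gamma> + 1) t *\<^sub>R C x)"
        by (simp add: g\<gamma> linear_diff[OF \<phi>(1)] linear_scale[OF \<phi>(1)])
      finally show "\<phi> I = \<phi> (R t x - g_real (\<gamma> + 1) t *\<^sub>R C x)" .
    qed
    with I show ?thesis by (simp add: scaleC_g)
  qed

  have RC: "R t \<circ> C = C \<circ> R t" if t: "0 \<le> t" for t
    using quadrature_limit_commute[OF C SC T_quad[OF t]]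
    by (simp add: fun_eq_iff R_def continuous_linear_operatorsD[OF C])
  \<comment> \<open>\<open>R t\<close> is a combination of \<open>C\<close> and \<open>T t\<close>,
    both of which preserve the graph of \<open>\<A>\<close>, and the graph is a subspace.\<close>
  have RA: "op_commutes_with (R t) \<A>" if t: "0 \<le> t" for t
    unfolding op_commutes_with_iff
  proof (intro allI impI)
    fix x y assume xy: "(x, y) \<in> \<A>"
    have "(T t x, T t y) \<in> \<A>"
      using quadrature_limit_closed_mlo[OF A SA T_quad[OF t]] xy by (simp add: op_commutes_with_iff)
    from mloD(3)[OF A(1) this, of "- 1"] have "(- T t x, - T t y) \<in> \<A>"
      by (simp add: scaleC_minus1)
    moreover have "(?\<kappa> t *\<^sub>R C x, ?\<kappa> t *\<^sub>R C y) \<in> \<A>"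
      unfolding scaleR_scaleC using CA xy by (intro mloD(3)[OF A(1)]) (simp add: op_commutes_with_iff)
    ultimately show "(R t x, R t y) \<in> \<A>"
      using mloD(2)[OF A(1)] by (fastforce simp: R_def diff_conv_add_uminus simp del: add_uminus_conv_diff)
  qed

  have g_cont: "continuous_on {0..} (g (\<gamma> + 1))"
  proof -
    have "continuous_on {0..} (\<lambda>t. complex_of_real (?\<kappa> t))"
      by (intro continuous_on_of_real power_cont)
    then show ?thesis
      by (rule continuous_on_cong[THEN iffD1, rotated 2]) (use \<gamma>0 in \<open>auto simp: g_def\<close>)
  qed
  have "g (\<gamma> + 1) 1 \<noteq> 0"
    using \<Gamma> by (simp add: g_def)
  then have g_nonzero: "\<exists>t\<ge>0. g (\<gamma> + 1) t \<noteq> 0"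
    by (intro exI[of _ 1]) simp

  have "regularized_resolvent_family (g \<alpha>) (g (\<gamma> + 1)) C R (\<A>\<inverse>)"
    unfolding regularized_resolvent_family_def op_commutes_with_converse
    using g_cont g_nonzero a mlo_converse[OF A(1)] C CA R_op R_cont R_int RC RA by auto
  moreover have "equicontinuous {\<lambda>x. (t powr (- \<gamma>)) *\<^sub>R R t x | t. t > 0}"
  proof (rule equicontinuous_seminormI)
    fix p :: "'x \<Rightarrow> real" assume p: "continuous_seminorm p"
    then obtain r where r: "continuous_seminorm r" "\<And>t x. 0 < t \<Longrightarrow> p (R t x) \<le> t powr \<gamma> * r x"
      using R_bound by blast
    have "p ((t powr (- \<gamma>)) *\<^sub>R R t x) \<le> r x" if "0 < t" for t x
      using r(2)[OF that, of x] that by (simp add: seminorm_scaleR[OF p] powr_minus field_simps)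
    with r(1) show "\<exists>q. continuous_seminorm q \<and> (\<forall>T\<in>{\<lambda>x. (t powr (- \<gamma>)) *\<^sub>R R t x | t. t > 0}. \<forall>x. p (T x) \<le> q x)"
      by blast
  qed
  ultimately show ?thesis by blast
qed

theorem theorem2p8:
  fixes C :: "'x::seq_complete_complex_lcs \<Rightarrow> 'x"
    and \<A> :: "('x \<times> 'x) set"
    and S :: "real \<Rightarrow> 'x \<Rightarrow> 'x"
    and \<alpha> \<beta> :: real
  assumes "C \<in> continuous_linear_operators"
    and "0 < \<alpha>" "\<alpha> \<le> 2" "0 \<le> \<beta>"
    and "mlo \<A>" "closed \<A>"
    and "regularized_resolvent_family (g \<alpha>) (g (\<beta> + 1)) C S \<A>"
    and "exponentially_equicontinuous S"
    and "equicontinuous {\<lambda>x. (t powr (- \<beta>)) *\<^sub>R S t x | t. t > 0}"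
  shows "\<forall>\<gamma>::real. \<gamma> > \<beta> + 1 / 2 \<longrightarrow>
           (\<exists>R. regularized_resolvent_family (g \<alpha>) (g (\<gamma> + 1)) C R (\<A>\<inverse>) \<and>
                equicontinuous {\<lambda>x. (t powr (- \<gamma>)) *\<^sub>R R t x | t. t > 0})"
  using inverse_resolvent_family[OF assms(1,2,4-7,9)] by blast

end
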